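(* For every $q_0\in(0,1]$ it holds that $$\lim_{q\to q_0}\mathrm{dist}^s\big((\mathrm{Lip}_q(S^1),L_q),(\mathrm{Lip}_{q_0}(S^1),L_{q_0})\big)=0,$$ where $q$ ranges over $(0,1]$ and $\mathrm{dist}^s$ is Kerr's complete Gromov-Hausdorff distance.
   Context: **$q$-integers.** For $q\in(0,1)$ and $n\in\mathbb{Z}$ put $[n]_q := \frac{q^n-q^{-n}}{q-q^{-1}}$; for $q=1$ put $[n]_1 := n$. **Identification of $C(S^1)$.** $\ell^2(\mathbb{Z})$ has standard orthonormal basis $(e_j)_{j\in\mathbb{Z}}$, inner products are linear in the second variable, and $\|\cdot\|_\infty$ denotes the operator norm. For a bounded operator $T$ on $\ell^2(\mathbb{Z})$ write $T_{jk} := \langle e_j, Te_k\rangle$. Let $U$ be the bilateral shift, $U e_j = e_{j+1}$. The $C^*$-algebra $C(S^1)$ is identified with $C^*(U)\subseteq \mathbb{B}(\ell^2(\mathbb{Z}))$ via $z\mapsto U$, where $z:S^1\to\mathbb{C}$ is the inclusion. **$q$-derivative.** $\mathrm{Lip}_q(\ell^2(\mathbb{Z}))$ is the set of bounded operators $T$ on $\ell^2(\mathbb{Z})$ such that the infinite matrix $(i[j-k]_q T_{jk})_{j,k\in\mathbb{Z}}$ is the matrix of a bounded operator; this bounded operator is denoted $\mathrm{d}_q(T)$. Put $\mathrm{Lip}_q(S^1) := C(S^1)\cap \mathrm{Lip}_q(\ell^2(\mathbb{Z}))$ and $L_q(T):=\|\mathrm{d}_q(T)\|_\infty$. For each $q\in(0,1]$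 the pair $(\mathrm{Lip}_q(S^1),L_q)$ is a compact quantum metric space in the sense below. **Compact quantum metric spaces.** An operator system $\mathcal{X}$ is a (not necessarily closed) $*$-invariant subspace containing $1$ of a unital $C^*$-algebra. A slip-norm on $\mathcal{X}$ is a seminorm $L:\mathcal{X}\to[0,\infty)$ with $L(x^* )=L(x)$ for all $x$ and $L(1)=0$. The pair $(\mathcal{X},L)$ is a compact quantum metric space if the metric $\rho_L(\varphi,\psi)=\sup\{|\varphi(x)-\psi(x)| : L(x)\le 1\}$ on the state space $S(\mathcal{X})$ (unital positive linear functionals) induces the weak-$*$ topology. **Kerr's complete Gromov-Hausdorff distance.** For an operator system $\mathcal{X}$ and $n\in\mathbb{N}$ let $\mathrm{UCP}_n(\mathcal{X})$ be the set of unital completely positive maps $\mathcal{X}\to M_n(\mathbb{C})$; a slip-norm $L$ gives $\rho_{L,n}(\varphi,\psi):=\sup\{\|\varphi(x)-\psi(x)\| : L(x)\le 1\}$ on it. Let $(\mathcal{X},L_{\mathcal{X}})$ and $(\mathcal{Y},L_{\mathcal{Y}})$ be compact quantum metric spaces. A slip-norm $L$ on the operator system $\mathcal{X}\oplus\mathcal{Y}$ is admissible if $(\mathcal{X}\oplus\mathcal{Y},L)$ is a compact quantum metric space and the quotient seminorms of $L$ under the coordinate projections onto $\mathcal{X}$ and $\mathcal{Y}$ are $L_{\mathcal{X}}$ and $L_{\mathcal{Y}}$, respectively. Composition with the coordinate projections embeds $\mathrm{UCP}_n(\mathcal{X})$ and $\mathrm{UCP}_n(\mathcal{Y})$ in $\mathrm{UCP}_n(\mathcal{X}\oplus\mathcal{Y})$.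 Then $$\mathrm{dist}^s\big((\mathcal{X},L_{\mathcal{X}}),(\mathcal{Y},L_{\mathcal{Y}})\big):=\inf_{L}\ \sup_{n\in\mathbb{N}}\ \mathrm{dist}_H^{\rho_{L,n}}\big(\mathrm{UCP}_n(\mathcal{X}),\mathrm{UCP}_n(\mathcal{Y})\big),$$ the infimum being over all admissible $L$ and $\mathrm{dist}_H^{\rho_{L,n}}$ denoting the Hausdorff distance with respect to $\rho_{L,n}$. *)

theory Defs
  imports "HOL-Analysis.Analysis" "Jordan_Normal_Form.Matrix"
begin

no_notation scalar_prod (infix \<open>\<bullet>\<close> 70)

section \<open>Complex Hilbert spaces\<close>

text \<open>
  The library has no complex inner product spaces. Extending the real Hilbert spaces has the
  advantage that \<open>'h \<Rightarrow>\<^sub>L 'k\<close> with its operator norm and the Hilbert direct sum \<open>'h \<times> 'k\<close> with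
  its Euclidean norm can be reused. The complex inner product is linear in its second variable.
\<close>

class scaleC =
  fixes scaleC :: "complex \<Rightarrow> 'a \<Rightarrow> 'a"  (infixr \<open>*\<^sub>C\<close> 75)

class chilbert_space = real_inner + banach + scaleC +
  fixes cinner :: "'a \<Rightarrow> 'a \<Rightarrow> complex"
  assumes scaleC_add_right: "c *\<^sub>C (x + y) = c *\<^sub>C x + c *\<^sub>C y"
    and scaleC_add_left: "(c + d) *\<^sub>C x = c *\<^sub>C x + d *\<^sub>C x"
    and scaleC_scaleC: "c *\<^sub>C d *\<^sub>C x = (c * d) *\<^sub>C x"
    and scaleC_of_real: "complex_of_real r *\<^sub>C x = r *\<^sub>R x"
    and cinner_commute: "cinner x y = cnj (cinner y x)"
    and cinner_add_right: "cinner x (y + z) = cinner x y + cinner x z"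
    and cinner_scaleC_right: "cinner x (c *\<^sub>C y) = c * cinner x y"
    and Re_cinner: "Re (cinner x y) = x \<bullet> y"

lemma norm_scaleC: "norm (c *\<^sub>C (x::'a::chilbert_space)) = cmod c * norm x"
proof -
  have "cinner (c *\<^sub>C x) (c *\<^sub>C x) = c * cnj (c * cinner x x)"
    by (metis cinner_commute cinner_scaleC_right)
  also have "cnj (c * cinner x x) = cnj c * cinner x x"
    by (metis cinner_commute complex_cnj_mult)
  finally have "cinner (c *\<^sub>C x) (c *\<^sub>C x) = of_real ((cmod c)\<^sup>2) * cinner x x"
    by (metis complex_norm_square mult.assoc of_real_power)
  then have "(norm (c *\<^sub>C x))\<^sup>2 = (cmod c * norm x)\<^sup>2"
    by (simp add: power2_norm_eq_inner power_mult_distrib Re_cinner[symmetric]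
        del: of_real_power)
  then show ?thesis
    by (simp add: power2_eq_iff_nonneg)
qed

instantiation prod :: (chilbert_space, chilbert_space) chilbert_space
begin

definition scaleC_prod where "c *\<^sub>C p = (c *\<^sub>C fst p, c *\<^sub>C snd p)"

definition cinner_prod where "cinner p r = cinner (fst p) (fst r) + cinner (snd p) (snd r)"

instance
proof
  fix p r s :: "'a \<times> 'b" and c d :: complex and t :: real
  show "c *\<^sub>C (p + r) = c *\<^sub>C p + c *\<^sub>C r"
    by (simp add: scaleC_prod_def scaleC_add_right)
  show "(c + d) *\<^sub>C p = c *\<^sub>C p + d *\<^sub>C p"
    by (simp add: scaleC_prod_def scaleC_add_left)
  show "c *\<^sub>C d *\<^sub>C p = (c * d) *\<^sub>C p"
    by (simp add: scaleC_prod_def scaleC_scaleC)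
  show "complex_of_real t *\<^sub>C p = t *\<^sub>R p"
    by (simp add: scaleC_prod_def scaleC_of_real scaleR_prod_def)
  show "cinner p r = cnj (cinner r p)"
    unfolding cinner_prod_def by (metis cinner_commute complex_cnj_add)
  show "cinner p (r + s) = cinner p r + cinner p s"
    by (simp add: cinner_prod_def cinner_add_right)
  show "cinner p (c *\<^sub>C r) = c * cinner p r"
    by (simp add: cinner_prod_def scaleC_prod_def cinner_scaleC_right distrib_left)
  show "Re (cinner p r) = p \<bullet> r"
    by (simp add: cinner_prod_def Re_cinner inner_prod_def)
qed

end

section \<open>The Hilbert space of square summable families\<close>

typedef 'i ell2 = "{f :: 'i \<Rightarrow> complex. (\<lambda>i. (cmod (f i))\<^sup>2) summable_on UNIV}"
  morphisms ell2_nth Ell2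
  by (rule exI[of _ "\<lambda>_. 0"]) simp

setup_lifting type_definition_ell2

lemma ell2_add:
  assumes "(\<lambda>i. (cmod (f i))\<^sup>2) summable_on UNIV" "(\<lambda>i. (cmod (g i))\<^sup>2) summable_on UNIV"
  shows "(\<lambda>i. (cmod (f i + g i))\<^sup>2) summable_on UNIV"
proof (rule summable_on_comparison_test)
  show "(\<lambda>i. 2 * (cmod (f i))\<^sup>2 + 2 * (cmod (g i))\<^sup>2) summable_on UNIV"
    by (intro summable_on_add summable_on_cmult_right assms)
  fix i
  have "(cmod (f i + g i))\<^sup>2 \<le> (cmod (f i) + cmod (g i))\<^sup>2"
    by (simp add: norm_triangle_ineq power_mono)
  also have "\<dots> \<le> 2 * (cmod (f i))\<^sup>2 + 2 * (cmod (g i))\<^sup>2"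
    using sum_squares_bound[of "cmod (f i)" "cmod (g i)"] by (simp add: power2_sum)
  finally show "(cmod (f i + g i))\<^sup>2 \<le> 2 * (cmod (f i))\<^sup>2 + 2 * (cmod (g i))\<^sup>2" .
qed simp

lemma ell2_mult:
  assumes "(\<lambda>i. (cmod (f i))\<^sup>2) summable_on UNIV"
  shows "(\<lambda>i. (cmod (c * f i))\<^sup>2) summable_on UNIV"
  by (simp add: norm_mult power_mult_distrib summable_on_cmult_right assms)

lemma ell2_inner_abs_summable:
  assumes "(\<lambda>i. (cmod (f i))\<^sup>2) summable_on UNIV" "(\<lambda>i. (cmod (g i))\<^sup>2) summable_on UNIV"
  shows "(\<lambda>i. cmod (cnj (f i) * g i)) summable_on UNIV"
proof (rule Infinite_Sum.abs_summable_on_comparison_test')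
  show "(\<lambda>i. (cmod (f i))\<^sup>2 + (cmod (g i))\<^sup>2) summable_on UNIV"
    by (intro summable_on_add assms)
  fix i
  have "2 * cmod (f i) * cmod (g i) \<le> (cmod (f i))\<^sup>2 + (cmod (g i))\<^sup>2"
    by (rule sum_squares_bound)
  moreover have "0 \<le> cmod (f i) * cmod (g i)" by simp
  ultimately have "cmod (f i) * cmod (g i) \<le> (cmod (f i))\<^sup>2 + (cmod (g i))\<^sup>2" by linarith
  then show "cmod (cnj (f i) * g i) \<le> (cmod (f i))\<^sup>2 + (cmod (g i))\<^sup>2"
    by (simp add: norm_mult)
qed

lemma ell2_inner_summable:
  assumes "(\<lambda>i. (cmod (f i))\<^sup>2) summable_on UNIV" "(\<lambda>i. (cmod (g i))\<^sup>2) summable_on UNIV"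
  shows "(\<lambda>i. cnj (f i) * g i) summable_on UNIV"
  by (rule Infinite_Sum.abs_summable_summable[OF ell2_inner_abs_summable[OF assms]])

instantiation ell2 :: (type) real_inner
begin

lift_definition zero_ell2 :: "'a ell2" is "\<lambda>_. 0" by simp

lift_definition plus_ell2 :: "'a ell2 \<Rightarrow> 'a ell2 \<Rightarrow> 'a ell2" is "\<lambda>f g i. f i + g i"
  by (rule ell2_add)

lift_definition uminus_ell2 :: "'a ell2 \<Rightarrow> 'a ell2" is "\<lambda>f i. - f i" by simp

lift_definition minus_ell2 :: "'a ell2 \<Rightarrow> 'a ell2 \<Rightarrow> 'a ell2" is "\<lambda>f g i. f i - g i"
  subgoal for f g using ell2_add[of f "\<lambda>i. - g i"] by simp
  done

lift_definition scaleR_ell2 :: "real \<Rightarrow> 'a ell2 \<Rightarrow> 'a ell2" is "\<lambda>r f i. complex_of_real r * f i"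
  by (rule ell2_mult)

definition inner_ell2 :: "'a ell2 \<Rightarrow> 'a ell2 \<Rightarrow> real"
  where "inner_ell2 x y = Re (\<Sum>\<^sub>\<infinity>i. cnj (ell2_nth x i) * ell2_nth y i)"

definition norm_ell2 :: "'a ell2 \<Rightarrow> real"
  where "norm_ell2 x = sqrt (x \<bullet> x)"

definition sgn_ell2 :: "'a ell2 \<Rightarrow> 'a ell2"
  where "sgn_ell2 x = inverse (norm x) *\<^sub>R x"

definition dist_ell2 :: "'a ell2 \<Rightarrow> 'a ell2 \<Rightarrow> real"
  where "dist_ell2 x y = norm (x - y)"

definition uniformity_ell2 :: "('a ell2 \<times> 'a ell2) filter"
  where "uniformity_ell2 = (INF e\<in>{0<..}. principal {(x, y). dist x y < e})"

definition open_ell2 :: "'a ell2 set \<Rightarrow> bool"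
  where "open_ell2 U = (\<forall>x\<in>U. eventually (\<lambda>(x', y). x' = x \<longrightarrow> y \<in> U) uniformity)"

lemma ell2_nth_summable: "(\<lambda>i. (cmod (ell2_nth x i))\<^sup>2) summable_on UNIV"
  using ell2_nth[of x] by simp

lemma ell2_inner_self: "x \<bullet> x = (\<Sum>\<^sub>\<infinity>i. (cmod (ell2_nth x i))\<^sup>2)" for x :: "'a ell2"
proof -
  have "Re (cnj z * z) = (cmod z)\<^sup>2" for z
    by (simp add: cmod_power2) (simp add: power2_eq_square)
  then show ?thesis
    unfolding inner_ell2_def
    by (subst infsum_Re[symmetric]) (simp_all add: ell2_inner_summable ell2_nth_summable)
qed

instance
proof
  fix x y z :: "'a ell2" and r s :: real
  show "x + y + z = x + (y + z)" by transfer (simp add: algebra_simps)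
  show "x + y = y + x" by transfer (simp add: algebra_simps)
  show "0 + x = x" by transfer simp
  show "- x + x = 0" by transfer simp
  show "x - y = x + - y" by transfer simp
  show "r *\<^sub>R (x + y) = r *\<^sub>R x + r *\<^sub>R y" by transfer (simp add: algebra_simps)
  show "(r + s) *\<^sub>R x = r *\<^sub>R x + s *\<^sub>R x" by transfer (simp add: algebra_simps)
  show "r *\<^sub>R s *\<^sub>R x = (r * s) *\<^sub>R x" by transfer (simp add: mult.assoc)
  show "1 *\<^sub>R x = x" by transfer simp
  show "dist x y = norm (x - y)" by (rule dist_ell2_def)
  show "sgn x = inverse (norm x) *\<^sub>R x" by (rule sgn_ell2_def)
  show "(uniformity :: ('a ell2 \<times> 'a ell2) filter)
      = (INF e\<in>{0<..}. principal {(x, y). dist x y < e})" by (rule uniformity_ell2_def)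
  show "open U = (\<forall>x\<in>U. eventually (\<lambda>(x', y). x' = x \<longrightarrow> y \<in> U) uniformity)"
    for U :: "'a ell2 set" by (rule open_ell2_def)
  show "norm x = sqrt (x \<bullet> x)" by (rule norm_ell2_def)
  have "(\<Sum>\<^sub>\<infinity>i. cnj (ell2_nth x i) * ell2_nth y i)
      = cnj (\<Sum>\<^sub>\<infinity>i. cnj (ell2_nth y i) * ell2_nth x i)"
    by (subst infsum_cnj[symmetric]) (simp add: mult.commute)
  then show "x \<bullet> y = y \<bullet> x" unfolding inner_ell2_def by simp
  show "(x + y) \<bullet> z = x \<bullet> z + y \<bullet> z"
    unfolding inner_ell2_def plus_ell2.rep_eq
    by (simp add: distrib_right infsum_add ell2_inner_summable ell2_nth_summable)
  show "(r *\<^sub>R x) \<bullet> y = r * (x \<bullet> y)"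
    unfolding inner_ell2_def scaleR_ell2.rep_eq
    by (simp add: mult.assoc infsum_cmult_right')
  show "0 \<le> x \<bullet> x"
    unfolding ell2_inner_self by (simp add: infsum_nonneg)
  show "x \<bullet> x = 0 \<longleftrightarrow> x = 0"
  proof
    assume "x \<bullet> x = 0"
    then have "(cmod (ell2_nth x i))\<^sup>2 = 0" for i
      unfolding ell2_inner_self
      by (intro nonneg_infsum_le_0D[where f = "\<lambda>i. (cmod (ell2_nth x i))\<^sup>2", OF _ ell2_nth_summable]) auto
    then show "x = 0" by (simp add: ell2_nth_inject[symmetric] zero_ell2.rep_eq fun_eq_iff)
  qed (simp add: inner_ell2_def zero_ell2.rep_eq)
qed

end

lemma ell2_norm_sq: "(norm x)\<^sup>2 = (\<Sum>\<^sub>\<infinity>i. (cmod (ell2_nth x i))\<^sup>2)"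
  by (simp add: ell2_inner_self power2_norm_eq_inner)

lemma ell2_finite_sum_le: "finite F \<Longrightarrow> (\<Sum>i\<in>F. (cmod (ell2_nth x i))\<^sup>2) \<le> (norm x)\<^sup>2"
  unfolding ell2_norm_sq by (rule finite_sum_le_infsum[OF ell2_nth_summable]) auto

lemma ell2_nth_le_norm: "cmod (ell2_nth x i) \<le> norm x"
  using ell2_finite_sum_le[of "{i}" x] by (simp add: power2_le_iff_abs_le)

instance ell2 :: (type) banach
proof
  fix X :: "nat \<Rightarrow> 'a ell2"
  assume X: "Cauchy X"
  have "Cauchy (\<lambda>n. ell2_nth (X n) i)" for i
  proof (rule CauchyI)
    fix e :: real assume "0 < e"
    then obtain M where M: "\<And>m n. m \<ge> M \<Longrightarrow> n \<ge> M \<Longrightarrow> norm (X m - X n) < e"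
      using X by (metis Cauchy_iff)
    show "\<exists>M. \<forall>m\<ge>M. \<forall>n\<ge>M. norm (ell2_nth (X m) i - ell2_nth (X n) i) < e"
      by (metis M ell2_nth_le_norm le_less_trans minus_ell2.rep_eq)
  qed
  then have "\<forall>i. \<exists>l. (\<lambda>n. ell2_nth (X n) i) \<longlonglongrightarrow> l"
    by (simp add: Cauchy_convergent_iff convergent_def)
  then obtain g where g: "\<And>i. (\<lambda>n. ell2_nth (X n) i) \<longlonglongrightarrow> g i"
    unfolding choice_iff by blast
  have fin: "(\<Sum>i\<in>F. (cmod (ell2_nth (X m) i - g i))\<^sup>2) \<le> e\<^sup>2"
    if "finite F" and M: "\<And>n. n \<ge> M \<Longrightarrow> norm (X m - X n) \<le> e" for F m M e
  proof (rule tendsto_upperbound)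
    show "(\<lambda>n. \<Sum>i\<in>F. (cmod (ell2_nth (X m) i - ell2_nth (X n) i))\<^sup>2)
        \<longlonglongrightarrow> (\<Sum>i\<in>F. (cmod (ell2_nth (X m) i - g i))\<^sup>2)"
      by (intro tendsto_intros g)
    show "\<forall>\<^sub>F n in sequentially. (\<Sum>i\<in>F. (cmod (ell2_nth (X m) i - ell2_nth (X n) i))\<^sup>2) \<le> e\<^sup>2"
    proof (rule eventually_sequentiallyI)
      fix n assume "M \<le> n"
      then have "(norm (X m - X n))\<^sup>2 \<le> e\<^sup>2" using M by (simp add: power_mono)
      then show "(\<Sum>i\<in>F. (cmod (ell2_nth (X m) i - ell2_nth (X n) i))\<^sup>2) \<le> e\<^sup>2"
        using ell2_finite_sum_le[OF \<open>finite F\<close>, of "X m - X n"]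
        by (simp add: minus_ell2.rep_eq)
    qed
  qed simp
  have diff: "(\<lambda>i. (cmod (ell2_nth (X m) i - g i))\<^sup>2) summable_on UNIV"
    if "\<And>n. n \<ge> M \<Longrightarrow> norm (X m - X n) \<le> e" for m M e
    using fin[OF _ that] by (intro nonneg_bdd_above_summable_on) (auto intro!: bdd_aboveI)
  obtain M1 where M1: "\<And>m n. m \<ge> M1 \<Longrightarrow> n \<ge> M1 \<Longrightarrow> norm (X m - X n) < 1"
    using CauchyD[OF X, of 1] by auto
  have "(\<lambda>i. (cmod (ell2_nth (X M1) i + (- 1) * (ell2_nth (X M1) i - g i)))\<^sup>2) summable_on UNIV"
    using diff[of M1 M1 1] M1 by (intro ell2_add ell2_mult ell2_nth_summable) (auto intro: less_imp_le)
  then have "(\<lambda>i. (cmod (g i))\<^sup>2) summable_on UNIV" by simp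
  then have G: "ell2_nth (Ell2 g) = g" by (simp add: Ell2_inverse)
  have "X \<longlonglongrightarrow> Ell2 g"
  proof (rule LIMSEQ_I)
    fix r :: real assume "0 < r"
    then obtain M where M: "\<And>m n. m \<ge> M \<Longrightarrow> n \<ge> M \<Longrightarrow> norm (X m - X n) < r / 2"
      using X by (metis Cauchy_iff half_gt_zero)
    have "norm (X m - Ell2 g) < r" if "m \<ge> M" for m
    proof -
      have *: "norm (X m - X n) \<le> r / 2" if "n \<ge> M" for n
        using M[OF \<open>m \<ge> M\<close> that] by simp
      have "(norm (X m - Ell2 g))\<^sup>2 \<le> (r / 2)\<^sup>2"
        unfolding ell2_norm_sq minus_ell2.rep_eq G
        by (rule infsum_le_finite_sums[OF diff[OF *] fin[OF _ *]])
      then have "norm (X m - Ell2 g) \<le> r / 2"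
        using \<open>0 < r\<close> by (simp add: power2_le_iff_abs_le)
      then show ?thesis using \<open>0 < r\<close> by linarith
    qed
    then show "\<exists>M. \<forall>m\<ge>M. norm (X m - Ell2 g) < r" by blast
  qed
  then show "convergent X" by (rule convergentI)
qed

instantiation ell2 :: (type) chilbert_space
begin

lift_definition scaleC_ell2 :: "complex \<Rightarrow> 'a ell2 \<Rightarrow> 'a ell2" is "\<lambda>c f i. c * f i"
  by (rule ell2_mult)

definition cinner_ell2 :: "'a ell2 \<Rightarrow> 'a ell2 \<Rightarrow> complex"
  where "cinner_ell2 x y = (\<Sum>\<^sub>\<infinity>i. cnj (ell2_nth x i) * ell2_nth y i)"

instance
proof
  fix x y z :: "'a ell2" and c d :: complex and r :: real
  show "c *\<^sub>C (x + y) = c *\<^sub>C x + c *\<^sub>C y" by transfer (simp add: algebra_simps)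
  show "(c + d) *\<^sub>C x = c *\<^sub>C x + d *\<^sub>C x" by transfer (simp add: algebra_simps)
  show "c *\<^sub>C d *\<^sub>C x = (c * d) *\<^sub>C x" by transfer (simp add: algebra_simps)
  show "complex_of_real r *\<^sub>C x = r *\<^sub>R x" by transfer simp
  show "cinner x y = cnj (cinner y x)"
    unfolding cinner_ell2_def by (subst infsum_cnj[symmetric]) (simp add: mult.commute)
  show "cinner x (y + z) = cinner x y + cinner x z"
    unfolding cinner_ell2_def plus_ell2.rep_eq
    by (simp add: distrib_left infsum_add ell2_inner_summable ell2_nth_summable)
  show "cinner x (c *\<^sub>C y) = c * cinner x y"
    unfolding cinner_ell2_def scaleC_ell2.rep_eq
    by (simp add: mult.left_commute infsum_cmult_right')
  show "Re (cinner x y) = x \<bullet> y" by (simp add: cinner_ell2_def inner_ell2_def)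
qed

end

lift_definition basis_vec :: "'i \<Rightarrow> 'i ell2" is "\<lambda>j i. if i = j then 1 else 0"
  by (rule finite_nonzero_values_imp_summable_on) simp

section \<open>Bounded operators\<close>

instantiation blinfun :: (real_normed_vector, chilbert_space) scaleC
begin

lift_definition scaleC_blinfun :: "complex \<Rightarrow> ('a \<Rightarrow>\<^sub>L 'b) \<Rightarrow> 'a \<Rightarrow>\<^sub>L 'b" is "\<lambda>c f x. c *\<^sub>C f x"
proof -
  fix c :: complex and f :: "'a \<Rightarrow> 'b"
  assume f: "bounded_linear f"
  have "bounded_linear (\<lambda>y::'b. c *\<^sub>C y)"
    by (rule bounded_linear_intro[where K = "cmod c"])
      (auto simp: scaleC_add_right norm_scaleC scaleC_of_real[symmetric] scaleC_scaleC mult.commute)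
  from bounded_linear_compose[OF this f] show "bounded_linear (\<lambda>x. c *\<^sub>C f x)" .
qed

instance ..

end

text \<open>
  The type \<open>'h \<Rightarrow>\<^sub>L 'h\<close> consists of real linear operators; \<open>bounded_ops\<close> is the C*-algebra of
  bounded complex linear operators, with product \<open>o\<^sub>L\<close>, unit \<open>id_blinfun\<close> and the operator norm.
\<close>

definition bounded_ops :: "('h::chilbert_space \<Rightarrow>\<^sub>L 'h) set"
  where "bounded_ops = {T. \<forall>c x. blinfun_apply T (c *\<^sub>C x) = c *\<^sub>C T x}"

definition op_star :: "('h::chilbert_space \<Rightarrow>\<^sub>L 'h) \<Rightarrow> 'h \<Rightarrow>\<^sub>L 'h"
  where "op_star T = (THE S. S \<in> bounded_ops \<and> (\<forall>x y. cinner (S x) y = cinner x (T y)))"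

definition complex_subspace :: "('h::chilbert_space \<Rightarrow>\<^sub>L 'h) set \<Rightarrow> bool"
  where "complex_subspace X \<longleftrightarrow>
    0 \<in> X \<and> (\<forall>x\<in>X. \<forall>y\<in>X. x + y \<in> X) \<and> (\<forall>c. \<forall>x\<in>X. c *\<^sub>C x \<in> X)"

definition cstar_subalgebra :: "('h::chilbert_space \<Rightarrow>\<^sub>L 'h) set \<Rightarrow> bool"
  where "cstar_subalgebra A \<longleftrightarrow>
    A \<subseteq> bounded_ops \<and> complex_subspace A \<and> (\<forall>x\<in>A. \<forall>y\<in>A. x o\<^sub>L y \<in> A) \<and>
    (\<forall>x\<in>A. op_star x \<in> A) \<and> closed A"

definition cstar_generated :: "('h::chilbert_space \<Rightarrow>\<^sub>L 'h) set \<Rightarrow> ('h \<Rightarrow>\<^sub>L 'h) set"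
  where "cstar_generated G = \<Inter>{A. cstar_subalgebra A \<and> G \<subseteq> A}"

section \<open>Operator systems and compact quantum metric spaces\<close>

text \<open>
  Operator systems are taken in their concrete form, inside the C*-algebra of bounded operators
  on a Hilbert space.
\<close>

definition operator_system :: "('h::chilbert_space \<Rightarrow>\<^sub>L 'h) set \<Rightarrow> bool"
  where "operator_system X \<longleftrightarrow>
    X \<subseteq> bounded_ops \<and> complex_subspace X \<and> (\<forall>x\<in>X. op_star x \<in> X) \<and> id_blinfun \<in> X"

text \<open>Positivity of an \<open>m \<times> m\<close> matrix of operators, regarded as an operator on the \<open>m\<close>-fold
  direct sum of \<open>'h\<close>.\<close>

definition positive_op_matrix :: "nat \<Rightarrow> (nat \<Rightarrow> nat \<Rightarrow> 'h::chilbert_space \<Rightarrow>\<^sub>L 'h) \<Rightarrow> bool"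
  where "positive_op_matrix m T \<longleftrightarrow>
    (\<forall>v. (\<Sum>i<m. \<Sum>j<m. cinner (v i) (T i j (v j))) \<in> \<real>\<^sub>\<ge>\<^sub>0)"

definition positive_op :: "('h::chilbert_space \<Rightarrow>\<^sub>L 'h) \<Rightarrow> bool"
  where "positive_op T \<longleftrightarrow> (\<forall>v. cinner v (T v) \<in> \<real>\<^sub>\<ge>\<^sub>0)"

text \<open>Functions on \<open>X\<close> are represented by extensional ones, so that equality is equality on \<open>X\<close>.\<close>

definition states :: "('h::chilbert_space \<Rightarrow>\<^sub>L 'h) set \<Rightarrow> (('h \<Rightarrow>\<^sub>L 'h) \<Rightarrow> complex) set"
  where "states X = {\<phi> \<in> extensional X.
    (\<forall>x\<in>X. \<forall>y\<in>X. \<phi> (x + y) = \<phi> x + \<phi> y) \<and>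
    (\<forall>c. \<forall>x\<in>X. \<phi> (c *\<^sub>C x) = c * \<phi> x) \<and>
    \<phi> id_blinfun = 1 \<and>
    (\<forall>x\<in>X. positive_op x \<longrightarrow> \<phi> x \<in> \<real>\<^sub>\<ge>\<^sub>0)}"

definition weak_star_topology ::
    "('h::chilbert_space \<Rightarrow>\<^sub>L 'h) set \<Rightarrow> (('h \<Rightarrow>\<^sub>L 'h) \<Rightarrow> complex) topology"
  where "weak_star_topology X = subtopology (product_topology (\<lambda>_. euclidean) X) (states X)"

definition slip_norm :: "('h::chilbert_space \<Rightarrow>\<^sub>L 'h) set \<Rightarrow> (('h \<Rightarrow>\<^sub>L 'h) \<Rightarrow> real) \<Rightarrow> bool"
  where "slip_norm X L \<longleftrightarrow>
    (\<forall>x\<in>X. 0 \<le> L x) \<and>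
    (\<forall>x\<in>X. \<forall>y\<in>X. L (x + y) \<le> L x + L y) \<and>
    (\<forall>c. \<forall>x\<in>X. L (c *\<^sub>C x) = cmod c * L x) \<and>
    (\<forall>x\<in>X. L (op_star x) = L x) \<and>
    L id_blinfun = 0"

text \<open>The supremum may be infinite for a general slip-norm, hence the values in \<open>ennreal\<close>;
  a compact quantum metric space is required to have a finite metric.\<close>

definition state_dist :: "('h::chilbert_space \<Rightarrow>\<^sub>L 'h) set \<Rightarrow> (('h \<Rightarrow>\<^sub>L 'h) \<Rightarrow> real) \<Rightarrow>
    (('h \<Rightarrow>\<^sub>L 'h) \<Rightarrow> complex) \<Rightarrow> (('h \<Rightarrow>\<^sub>L 'h) \<Rightarrow> complex) \<Rightarrow> ennreal"
  where "state_dist X L \<phi> \<psi> = (SUP x\<in>{x \<in> X. L x \<le> 1}. ennreal (cmod (\<phi> x - \<psi> x)))"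

definition compact_quantum_metric_space ::
    "('h::chilbert_space \<Rightarrow>\<^sub>L 'h) set \<Rightarrow> (('h \<Rightarrow>\<^sub>L 'h) \<Rightarrow> real) \<Rightarrow> bool"
  where "compact_quantum_metric_space X L \<longleftrightarrow>
    operator_system X \<and> slip_norm X L \<and>
    (\<forall>\<phi>\<in>states X. \<forall>\<psi>\<in>states X. state_dist X L \<phi> \<psi> < \<infinity>) \<and>
    Metric_space (states X) (\<lambda>\<phi> \<psi>. enn2real (state_dist X L \<phi> \<psi>)) \<and>
    Metric_space.mtopology (states X) (\<lambda>\<phi> \<psi>. enn2real (state_dist X L \<phi> \<psi>))
      = weak_star_topology X"

section \<open>Unital completely positive maps into matrix algebras\<close>

definition cvec_norm :: "complex Matrix.vec \<Rightarrow> real"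
  where "cvec_norm v = sqrt (\<Sum>i<dim_vec v. (cmod (vec_index v i))\<^sup>2)"

definition mat_norm :: "complex Matrix.mat \<Rightarrow> real"
  where "mat_norm A = (SUP v\<in>{v \<in> carrier_vec (dim_col A). cvec_norm v \<le> 1}. cvec_norm (A *\<^sub>v v))"

text \<open>Positivity of an \<open>m \<times> m\<close> matrix with entries in the \<open>n \<times> n\<close> matrices. The inner product
  \<open>\<bullet>c\<close> is linear in its first variable.\<close>

definition positive_block_matrix :: "nat \<Rightarrow> nat \<Rightarrow> (nat \<Rightarrow> nat \<Rightarrow> complex Matrix.mat) \<Rightarrow> bool"
  where "positive_block_matrix m n A \<longleftrightarrow>
    (\<forall>v. (\<forall>i<m. v i \<in> carrier_vec n) \<longrightarrow>
      (\<Sum>i<m. \<Sum>j<m. (A i j *\<^sub>v v j) \<bullet>c v i) \<in> \<real>\<^sub>\<ge>\<^sub>0)"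

definition ucp_maps ::
    "nat \<Rightarrow> ('h::chilbert_space \<Rightarrow>\<^sub>L 'h) set \<Rightarrow> (('h \<Rightarrow>\<^sub>L 'h) \<Rightarrow> complex Matrix.mat) set"
  where "ucp_maps n X = {\<phi> \<in> X \<rightarrow>\<^sub>E carrier_mat n n.
    (\<forall>x\<in>X. \<forall>y\<in>X. \<phi> (x + y) = \<phi> x + \<phi> y) \<and>
    (\<forall>c. \<forall>x\<in>X. \<phi> (c *\<^sub>C x) = c \<cdot>\<^sub>m \<phi> x) \<and>
    \<phi> id_blinfun = 1\<^sub>m n \<and>
    (\<forall>m T. (\<forall>i<m. \<forall>j<m. T i j \<in> X) \<and> positive_op_matrix m T \<longrightarrow>
      positive_block_matrix m n (\<lambda>i j. \<phi> (T i j)))}"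

definition ucp_dist :: "('h::chilbert_space \<Rightarrow>\<^sub>L 'h) set \<Rightarrow> (('h \<Rightarrow>\<^sub>L 'h) \<Rightarrow> real) \<Rightarrow>
    (('h \<Rightarrow>\<^sub>L 'h) \<Rightarrow> complex Matrix.mat) \<Rightarrow> (('h \<Rightarrow>\<^sub>L 'h) \<Rightarrow> complex Matrix.mat) \<Rightarrow> ennreal"
  where "ucp_dist X L \<phi> \<psi> = (SUP x\<in>{x \<in> X. L x \<le> 1}. ennreal (mat_norm (\<phi> x - \<psi> x)))"

section \<open>Complete Gromov-Hausdorff distance\<close>

definition hausdorff_dist :: "('a \<Rightarrow> 'a \<Rightarrow> ennreal) \<Rightarrow> 'a set \<Rightarrow> 'a set \<Rightarrow> ennreal"
  where "hausdorff_dist \<rho> A B = max (SUP a\<in>A. INF b\<in>B. \<rho> a b) (SUP b\<in>B. INF a\<in>A. \<rho> a b)"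

text \<open>\<open>A \<oplus> B\<close> as a block diagonal operator on the Hilbert space direct sum; the coordinate
  projections are the two diagonal corners.\<close>

lift_definition op_sum ::
    "('h::chilbert_space \<Rightarrow>\<^sub>L 'h) \<Rightarrow> ('k::chilbert_space \<Rightarrow>\<^sub>L 'k) \<Rightarrow> ('h \<times> 'k) \<Rightarrow>\<^sub>L ('h \<times> 'k)"
  is "\<lambda>A B p. (A (fst p), B (snd p))"
  subgoal premises prems for A B
    by (rule bounded_linear_Pair[OF bounded_linear_compose[OF prems(1) bounded_linear_fst]
        bounded_linear_compose[OF prems(2) bounded_linear_snd]])
  done

lift_definition proj_left ::
    "(('h::chilbert_space \<times> 'k::chilbert_space) \<Rightarrow>\<^sub>L ('h \<times> 'k)) \<Rightarrow> 'h \<Rightarrow>\<^sub>L 'h"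
  is "\<lambda>T x. fst (T (x, 0))"
  subgoal premises prems for T
    by (rule bounded_linear_compose[OF bounded_linear_fst
        bounded_linear_compose[OF prems bounded_linear_Pair[OF bounded_linear_ident bounded_linear_zero]]])
  done

lift_definition proj_right ::
    "(('h::chilbert_space \<times> 'k::chilbert_space) \<Rightarrow>\<^sub>L ('h \<times> 'k)) \<Rightarrow> 'k \<Rightarrow>\<^sub>L 'k"
  is "\<lambda>T y. snd (T (0, y))"
  subgoal premises prems for T
    by (rule bounded_linear_compose[OF bounded_linear_snd
        bounded_linear_compose[OF prems bounded_linear_Pair[OF bounded_linear_zero bounded_linear_ident]]])
  done

lemma proj_left_op_sum [simp]: "proj_left (op_sum A B) = A"
  by (rule blinfun_eqI) (simp add: proj_left.rep_eq op_sum.rep_eq)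

lemma proj_right_op_sum [simp]: "proj_right (op_sum A B) = B"
  by (rule blinfun_eqI) (simp add: proj_right.rep_eq op_sum.rep_eq)

definition system_sum :: "('h::chilbert_space \<Rightarrow>\<^sub>L 'h) set \<Rightarrow> ('k::chilbert_space \<Rightarrow>\<^sub>L 'k) set \<Rightarrow>
    (('h \<times> 'k) \<Rightarrow>\<^sub>L ('h \<times> 'k)) set"
  where "system_sum X Y = {op_sum x y | x y. x \<in> X \<and> y \<in> Y}"

definition admissible ::
    "('h::chilbert_space \<Rightarrow>\<^sub>L 'h) set \<Rightarrow> (('h \<Rightarrow>\<^sub>L 'h) \<Rightarrow> real) \<Rightarrow>
     ('k::chilbert_space \<Rightarrow>\<^sub>L 'k) set \<Rightarrow> (('k \<Rightarrow>\<^sub>L 'k) \<Rightarrow> real) \<Rightarrow>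
     ((('h \<times> 'k) \<Rightarrow>\<^sub>L ('h \<times> 'k)) \<Rightarrow> real) \<Rightarrow> bool"
  where "admissible X LX Y LY L \<longleftrightarrow>
    compact_quantum_metric_space (system_sum X Y) L \<and>
    (\<forall>x\<in>X. LX x = (INF y\<in>Y. L (op_sum x y))) \<and>
    (\<forall>y\<in>Y. LY y = (INF x\<in>X. L (op_sum x y)))"

definition ucp_embed_left :: "nat \<Rightarrow> ('h::chilbert_space \<Rightarrow>\<^sub>L 'h) set \<Rightarrow>
    ('k::chilbert_space \<Rightarrow>\<^sub>L 'k) set \<Rightarrow> ((('h \<times> 'k) \<Rightarrow>\<^sub>L ('h \<times> 'k)) \<Rightarrow> complex Matrix.mat) set"
  where "ucp_embed_left n X Y = (\<lambda>\<phi>. restrict (\<phi> \<circ> proj_left) (system_sum X Y)) ` ucp_maps n X"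

definition ucp_embed_right :: "nat \<Rightarrow> ('h::chilbert_space \<Rightarrow>\<^sub>L 'h) set \<Rightarrow>
    ('k::chilbert_space \<Rightarrow>\<^sub>L 'k) set \<Rightarrow> ((('h \<times> 'k) \<Rightarrow>\<^sub>L ('h \<times> 'k)) \<Rightarrow> complex Matrix.mat) set"
  where "ucp_embed_right n X Y = (\<lambda>\<phi>. restrict (\<phi> \<circ> proj_right) (system_sum X Y)) ` ucp_maps n Y"

definition complete_GH_dist ::
    "('h::chilbert_space \<Rightarrow>\<^sub>L 'h) set \<Rightarrow> (('h \<Rightarrow>\<^sub>L 'h) \<Rightarrow> real) \<Rightarrow>
     ('k::chilbert_space \<Rightarrow>\<^sub>L 'k) set \<Rightarrow> (('k \<Rightarrow>\<^sub>L 'k) \<Rightarrow> real) \<Rightarrow> ennreal"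
  where "complete_GH_dist X LX Y LY =
    (INF L\<in>{L. admissible X LX Y LY L}. SUP n\<in>{1..}.
      hausdorff_dist (ucp_dist (system_sum X Y) L) (ucp_embed_left n X Y) (ucp_embed_right n X Y))"

section \<open>The circle with its q-geometry\<close>

definition q_int :: "real \<Rightarrow> int \<Rightarrow> real"
  where "q_int q n = (if q = 1 then of_int n
    else (q powi n - q powi (- n)) / (q - inverse q))"

lemma bij_pred_int: "bij (\<lambda>i::int. i - 1)"
  by (rule bij_betw_byWitness[where f' = "\<lambda>i. i + 1"]) auto

lift_definition shift_vec :: "int ell2 \<Rightarrow> int ell2" is "\<lambda>f i. f (i - 1)"
  by (subst summable_on_reindex_bij_betw[OF bij_pred_int])

lemma norm_shift_vec: "norm (shift_vec x) = norm x"
proof -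
  have "(norm (shift_vec x))\<^sup>2 = (norm x)\<^sup>2"
    unfolding ell2_norm_sq shift_vec.rep_eq
    by (rule infsum_reindex_bij_betw[OF bij_pred_int])
  then show ?thesis by simp
qed

lift_definition bilateral_shift :: "int ell2 \<Rightarrow>\<^sub>L int ell2" is shift_vec
proof (rule bounded_linear_intro[where K = 1])
  show "shift_vec (x + y) = shift_vec x + shift_vec y" for x y by transfer simp
  show "shift_vec (r *\<^sub>R x) = r *\<^sub>R shift_vec x" for r x by transfer simp
  show "norm (shift_vec x) \<le> norm x * 1" for x by (simp add: norm_shift_vec)
qed

lemma bilateral_shift_basis_vec: "bilateral_shift (basis_vec j) = basis_vec (j + 1)"
  unfolding bilateral_shift.rep_eq by transfer auto

definition circle_algebra :: "(int ell2 \<Rightarrow>\<^sub>L int ell2) set"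
  where "circle_algebra = cstar_generated {bilateral_shift}"

definition entry :: "(int ell2 \<Rightarrow>\<^sub>L int ell2) \<Rightarrow> int \<Rightarrow> int \<Rightarrow> complex"
  where "entry T j k = cinner (basis_vec j) (T (basis_vec k))"

definition is_q_derivative :: "real \<Rightarrow> (int ell2 \<Rightarrow>\<^sub>L int ell2) \<Rightarrow> (int ell2 \<Rightarrow>\<^sub>L int ell2) \<Rightarrow> bool"
  where "is_q_derivative q T D \<longleftrightarrow>
    D \<in> bounded_ops \<and> (\<forall>j k. entry D j k = \<i> * of_real (q_int q (j - k)) * entry T j k)"

definition Lip_ell2 :: "real \<Rightarrow> (int ell2 \<Rightarrow>\<^sub>L int ell2) set"
  where "Lip_ell2 q = {T \<in> bounded_ops. \<exists>D. is_q_derivative q T D}"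

definition q_derivative :: "real \<Rightarrow> (int ell2 \<Rightarrow>\<^sub>L int ell2) \<Rightarrow> int ell2 \<Rightarrow>\<^sub>L int ell2"
  where "q_derivative q T = (THE D. is_q_derivative q T D)"

definition Lip_circle :: "real \<Rightarrow> (int ell2 \<Rightarrow>\<^sub>L int ell2) set"
  where "Lip_circle q = circle_algebra \<inter> Lip_ell2 q"

definition L_circle :: "real \<Rightarrow> (int ell2 \<Rightarrow>\<^sub>L int ell2) \<Rightarrow> real"
  where "L_circle q T = norm (q_derivative q T)"

end

theory Submission
  imports Defs
begin

text \<open>
  A Lipschitz element of the circle algebra is a Laurent operator, that is, a function on the circle
  with Fourier coefficients \<open>t m\<close>, and its q-derivative is the bounded function with coefficients
  \<open>\<i> [m]_q t m\<close>. Since \<open>\<bar>[m]_q\<bar> \<ge> \<bar>m\<bar>\<close> for every \<open>q\<close> in \<open>(0, 1]\<close>, the function is recovered from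
  its q-derivative, up to its mean value, by convolution with a square summable kernel. The
  Cauchy-Schwarz inequality turns this into a norm estimate (\<open>laurent_norm_le_l2_multiplier\<close>), and
  applied to the tail of the kernel the estimate says that the Fejer means \<open>fejer N\<close> converge in
  norm, uniformly on the unit ball of \<open>L_circle q\<close> and uniformly in \<open>q\<close>, at the rate
  \<open>sqrt (8 / N)\<close> (\<open>norm_diff_fejer_le\<close>).

  The Fejer means are unital completely positive (\<open>fejer_completely_positive\<close>) with values in the
  trigonometric polynomials of degree less than \<open>N\<close>, which belong to all the Lipschitz algebras. They
  connect two parameters \<open>q\<close> and \<open>r\<close>. In degree at most \<open>N\<close> the numbers \<open>[m]_q\<close> and \<open>[m]_r\<close> are
  uniformly close when \<open>q\<close> is close to \<open>r\<close>, so the Fejer mean of an element for \<open>q\<close> is an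
  element for \<open>r\<close> whose seminorm is larger by a factor \<open>1 + \<delta>\<close> at most. Pushing it slightly towards
  the mean value removes the factor (\<open>Lip_circle_approximation\<close>). Hence
  \<open>max (L_q x) (L_r y) (norm (x - y) / \<epsilon>)\<close>, the \<open>bridge_norm\<close>, has the right quotient seminorms
  with a small \<open>\<epsilon>\<close>. It is the slip-norm of a compact quantum metric space, because its unit ball
  is, modulo scalars and up to a small error, a bounded set of trigonometric polynomials of bounded
  degree (\<open>compact_quantum_metric_spaceI\<close>). Finally, composing with \<open>fejer N\<close> transports unital
  completely positive maps on one algebra to the other one. Such maps
  are contractive, so this moves them by at most \<open>\<epsilon> + sqrt (8 / N)\<close> at every matrix level
  (\<open>complete_GH_dist_Lip_circle_le\<close>).
\<close>

section \<open>Complex inner products and operators\<close>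

lemma cinner_scaleC_left: "cinner (c *\<^sub>C x) y = cnj c * cinner x (y :: 'a::chilbert_space)"
  by (metis cinner_commute cinner_scaleC_right complex_cnj_mult)

lemma bounded_linear_scaleC: "bounded_linear (\<lambda>x :: 'a::chilbert_space. c *\<^sub>C x)"
  by (rule bounded_linear_intro[where K = "cmod c"])
    (auto simp: scaleC_add_right norm_scaleC scaleC_of_real[symmetric] scaleC_scaleC mult.commute)

lemmas scaleC_sum_right = linear_sum[OF bounded_linear.linear[OF bounded_linear_scaleC]]
lemmas scaleC_zero_right [simp] = linear_0[OF bounded_linear.linear[OF bounded_linear_scaleC]]
lemmas scaleC_diff_right = linear_diff[OF bounded_linear.linear[OF bounded_linear_scaleC]]

lemma scaleC_one [simp]: "1 *\<^sub>C x = (x :: 'a::chilbert_space)"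
  using scaleC_of_real[of 1 x] by simp

lemma scaleC_zero_left [simp]: "0 *\<^sub>C x = (0 :: 'a::chilbert_space)"
  using scaleC_of_real[of 0 x] by simp

lemma cinner_self: "cinner x x = of_real ((norm (x :: 'a::chilbert_space))\<^sup>2)"
proof -
  have "Im (cinner x x) = 0"
    by (metis cinner_commute Reals_cnj_iff complex_is_Real_iff)
  then show ?thesis
    by (simp add: complex_eq_iff Re_cinner power2_norm_eq_inner)
qed

lemma cmod_cinner_le: "cmod (cinner x y) \<le> norm x * norm (y :: 'a::chilbert_space)"
proof (cases "cinner x y = 0")
  case False
  \<comment> \<open>The phase that makes the inner product real reduces the claim to the real inner product.\<close>
  define u where "u = cnj (cinner x y) / of_real (cmod (cinner x y))"
  have u: "cmod u = 1" using False by (simp add: u_def norm_divide)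
  have "cinner x (u *\<^sub>C y) = of_real (cmod (cinner x y))"
    using False complex_norm_square[of "cinner x y"]
    by (simp add: cinner_scaleC_right u_def power2_eq_square divide_eq_eq mult.commute)
  then have "cmod (cinner x y) = x \<bullet> (u *\<^sub>C y)"
    by (metis Re_cinner Re_complex_of_real)
  also have "\<dots> \<le> norm x * norm (u *\<^sub>C y)" by (rule norm_cauchy_schwarz)
  finally show ?thesis by (simp add: norm_scaleC u)
qed simp

lemma bounded_linear_cinner: "bounded_linear (cinner (x :: 'a::chilbert_space))"
proof (rule bounded_linear_intro[where K = "norm x"])
  show "cinner x (r *\<^sub>R y) = r *\<^sub>R cinner x y" for r y
    by (simp add: scaleC_of_real[symmetric] cinner_scaleC_right scaleR_conv_of_real)
  show "cmod (cinner x y) \<le> norm y * norm x" for y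
    using cmod_cinner_le[of x y] by (simp add: mult.commute)
qed (rule cinner_add_right)

lemmas cinner_sum_right = linear_sum[OF bounded_linear.linear[OF bounded_linear_cinner]]
lemmas cinner_diff_right = linear_diff[OF bounded_linear.linear[OF bounded_linear_cinner]]

lemma cinner_sum_left: "cinner (sum f A) y = (\<Sum>i\<in>A. cinner (f i) (y :: 'a::chilbert_space))"
  by (subst cinner_commute) (simp add: cinner_sum_right cinner_commute[symmetric])

lemma cinner_ext:
  fixes y z :: "'a::chilbert_space"
  assumes "\<And>x. cinner x y = cinner x z"
  shows "y = z"
proof -
  have "cinner (y - z) (y - z) = 0" by (simp add: cinner_diff_right assms)
  then show ?thesis by (simp add: cinner_self)
qed

lemma norm_scaleC_blinfun:
  "norm (c *\<^sub>C (T :: 'a::real_normed_vector \<Rightarrow>\<^sub>L 'b::chilbert_space)) = cmod c * norm T"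
proof -
  have le: "norm (d *\<^sub>C S) \<le> cmod d * norm S" for d and S :: "'a \<Rightarrow>\<^sub>L 'b"
    by (rule norm_blinfun_bound)
      (auto simp: scaleC_blinfun.rep_eq norm_scaleC mult.assoc intro!: mult_left_mono norm_blinfun)
  show ?thesis
  proof (cases "c = 0")
    case False
    have "inverse c *\<^sub>C c *\<^sub>C T = T"
      by (rule blinfun_eqI) (simp add: scaleC_blinfun.rep_eq scaleC_scaleC False)
    then have "cmod c * norm T \<le> norm (c *\<^sub>C T)"
      using le[of "inverse c" "c *\<^sub>C T"] False
      by (simp add: norm_inverse pos_le_divide_eq inverse_eq_divide norm_divide mult.commute)
    with le[of c T] show ?thesis by simp
  qed (use le[of 0 T] in simp)
qed

lemma scaleC_blinfun_of_real:
  "complex_of_real r *\<^sub>C (T :: 'a::real_normed_vector \<Rightarrow>\<^sub>L 'b::chilbert_space) = r *\<^sub>R T"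
  by (rule blinfun_eqI) (simp add: scaleC_blinfun.rep_eq scaleC_of_real scaleR_blinfun.rep_eq)

lemma scaleC_blinfun_minus1: "(-1) *\<^sub>C (T :: 'a::real_normed_vector \<Rightarrow>\<^sub>L 'b::chilbert_space) = - T"
  using scaleC_blinfun_of_real[of "-1" T] by simp

lemma bounded_opsD: "T \<in> bounded_ops \<Longrightarrow> blinfun_apply T (c *\<^sub>C x) = c *\<^sub>C blinfun_apply T x"
  by (simp add: bounded_ops_def)

lemma op_star_eqI:
  fixes S T :: "'h::chilbert_space \<Rightarrow>\<^sub>L 'h"
  assumes "S \<in> bounded_ops" "\<And>x y. cinner (S x) y = cinner x (T y)"
  shows "op_star T = S"
  unfolding op_star_def
proof (rule the_equality)
  fix R assume R: "R \<in> bounded_ops \<and> (\<forall>x y. cinner (R x) y = cinner x (T y))"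
  show "R = S"
  proof (rule blinfun_eqI, rule cinner_ext)
    fix x y show "cinner y (R x) = cinner y (S x)"
      using R assms(2) by (metis cinner_commute)
  qed
qed (use assms in auto)

lemma complex_subspace_add: "complex_subspace X \<Longrightarrow> S \<in> X \<Longrightarrow> T \<in> X \<Longrightarrow> S + T \<in> X"
  by (simp add: complex_subspace_def)

lemma complex_subspace_scaleC: "complex_subspace X \<Longrightarrow> T \<in> X \<Longrightarrow> c *\<^sub>C T \<in> X"
  by (simp add: complex_subspace_def)

lemma blinfun_eq_iff: "S = T \<longleftrightarrow> (\<forall>x. blinfun_apply S x = blinfun_apply T x)"
  by (auto intro: blinfun_eqI)

lemma complex_subspace_sum:
  assumes "complex_subspace X" "\<And>i. i \<in> I \<Longrightarrow> f i \<in> X"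
  shows "sum f I \<in> X"
  using assms(2)
proof (induction I rule: infinite_finite_induct)
  case (insert i I)
  with assms(1) show ?case by (simp add: complex_subspace_def)
qed (use assms(1) in \<open>auto simp: complex_subspace_def\<close>)

lemma complex_subspace_diff:
  assumes "complex_subspace X" "S \<in> X" "T \<in> X"
  shows "S - T \<in> X"
proof -
  have "S + (-1) *\<^sub>C T \<in> X" using assms by (simp add: complex_subspace_def)
  then show ?thesis by (simp add: scaleC_blinfun_minus1)
qed

lemma complex_subspace_bounded_ops: "complex_subspace bounded_ops"
  by (auto simp: complex_subspace_def bounded_ops_def plus_blinfun.rep_eq scaleC_blinfun.rep_eq
      scaleC_add_right scaleC_scaleC mult.commute)

lemma zero_bounded_ops: "0 \<in> bounded_ops"
  by (simp add: bounded_ops_def)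

lemma closed_bounded_ops: "closed (bounded_ops :: ('h::chilbert_space \<Rightarrow>\<^sub>L 'h) set)"
proof -
  have "closed {T :: 'h \<Rightarrow>\<^sub>L 'h. blinfun_apply T (c *\<^sub>C x) = c *\<^sub>C blinfun_apply T x}" for c x
    by (intro closed_Collect_eq continuous_intros
        bounded_linear.continuous_on[OF bounded_linear_scaleC])
  then show ?thesis
    unfolding bounded_ops_def by (intro closed_Collect_all)
qed

section \<open>Operators on square summable families\<close>

lemma cinner_basis_vec: "cinner (basis_vec i) x = ell2_nth x i"
proof -
  have "cinner (basis_vec i) x = (\<Sum>\<^sub>\<infinity>j\<in>{i}. ell2_nth x i)"
    unfolding cinner_ell2_def
    by (rule infsum_cong_neutral) (auto simp: basis_vec.rep_eq split: if_splits)
  then show ?thesis by simp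
qed

lemma norm_basis_vec [simp]: "norm (basis_vec i) = 1"
proof -
  have "complex_of_real ((norm (basis_vec i))\<^sup>2) = 1"
    unfolding cinner_self[symmetric] cinner_basis_vec by (simp add: basis_vec.rep_eq)
  then have "(norm (basis_vec i))\<^sup>2 = 1" using of_real_eq_1_iff by blast
  then show ?thesis by (simp add: power2_eq_1_iff) (use norm_ge_zero[of "basis_vec i"] in linarith)
qed

lemma ell2_nth_sum: "ell2_nth (sum f F) i = (\<Sum>j\<in>F. ell2_nth (f j) i)"
  by (simp add: cinner_basis_vec[symmetric] cinner_sum_right)

lemma ell2_eqI: "(\<And>i. ell2_nth x i = ell2_nth y i) \<Longrightarrow> x = y"
  by (simp add: ell2_nth_inject[symmetric] fun_eq_iff)

text \<open>The square of the distance of \<open>x\<close> from a partial sum of the expansion is the tail of the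
  series of the squares of its coordinates.\<close>

lemma ell2_basis_expansion:
  "((\<lambda>i. ell2_nth x i *\<^sub>C basis_vec i) has_sum x) UNIV"
proof -
  have nsq: "(norm (x - (\<Sum>i\<in>F. ell2_nth x i *\<^sub>C basis_vec i)))\<^sup>2
      = (norm x)\<^sup>2 - (\<Sum>i\<in>F. (cmod (ell2_nth x i))\<^sup>2)" if "finite F" for F
  proof -
    have nth: "ell2_nth (x - (\<Sum>i\<in>F. ell2_nth x i *\<^sub>C basis_vec i)) j
        = (if j \<in> F then 0 else ell2_nth x j)" for j
      using that by (simp add: minus_ell2.rep_eq ell2_nth_sum scaleC_ell2.rep_eq basis_vec.rep_eq
          if_distrib[of "\<lambda>z. _ * z"] sum.delta cong: if_cong)
    have "(norm (x - (\<Sum>i\<in>F. ell2_nth x i *\<^sub>C basis_vec i)))\<^sup>2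
        = (\<Sum>\<^sub>\<infinity>j. if j \<in> F then 0 else (cmod (ell2_nth x j))\<^sup>2)"
      unfolding ell2_norm_sq nth by (rule infsum_cong) simp
    also have "\<dots> = (\<Sum>\<^sub>\<infinity>j\<in>UNIV - F. (cmod (ell2_nth x j))\<^sup>2)"
      by (rule infsum_cong_neutral) auto
    also have "\<dots> = (\<Sum>\<^sub>\<infinity>j. (cmod (ell2_nth x j))\<^sup>2) - (\<Sum>\<^sub>\<infinity>j\<in>F. (cmod (ell2_nth x j))\<^sup>2)"
      by (rule infsum_Diff) (use that ell2_nth_summable[of x] in auto)
    finally show ?thesis using that by (simp add: ell2_norm_sq)
  qed
  have "((\<lambda>F. (norm x)\<^sup>2 - (\<Sum>i\<in>F. (cmod (ell2_nth x i))\<^sup>2)) \<longlongrightarrow> (norm x)\<^sup>2 - (norm x)\<^sup>2)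
      (finite_subsets_at_top UNIV)"
    using has_sum_infsum[OF ell2_nth_summable[of x]]
    by (intro tendsto_diff tendsto_const) (simp add: has_sum_def ell2_norm_sq)
  then have "((\<lambda>F. (norm x)\<^sup>2 - (\<Sum>i\<in>F. (cmod (ell2_nth x i))\<^sup>2)) \<longlongrightarrow> 0)
      (finite_subsets_at_top UNIV)" by simp
  then have "((\<lambda>F. (norm (x - (\<Sum>i\<in>F. ell2_nth x i *\<^sub>C basis_vec i)))\<^sup>2) \<longlongrightarrow> 0)
      (finite_subsets_at_top UNIV)"
    by (rule Lim_transform_eventually)
      (auto intro!: eventually_finite_subsets_at_top_weakI simp: nsq)
  then have "((\<lambda>F. sqrt ((norm (x - (\<Sum>i\<in>F. ell2_nth x i *\<^sub>C basis_vec i)))\<^sup>2)) \<longlongrightarrow> sqrt 0)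
      (finite_subsets_at_top UNIV)"
    by (rule tendsto_real_sqrt)
  then have "((\<lambda>F. norm ((\<Sum>i\<in>F. ell2_nth x i *\<^sub>C basis_vec i) - x)) \<longlongrightarrow> 0)
      (finite_subsets_at_top UNIV)"
    by (simp add: norm_minus_commute)
  then show ?thesis
    unfolding has_sum_def by (rule LIM_zero_cancel[OF tendsto_norm_zero_cancel])
qed

lemma bounded_op_basis_expansion:
  assumes "T \<in> bounded_ops"
  shows "((\<lambda>i. ell2_nth x i *\<^sub>C blinfun_apply T (basis_vec i)) has_sum blinfun_apply T x) UNIV"
  using has_sum_bounded_linear[OF blinfun.bounded_linear_right[of T] ell2_basis_expansion[of x]]
  by (simp add: bounded_opsD[OF assms])

lemma cinner_bounded_op_expansion:
  assumes "T \<in> bounded_ops"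
  shows "((\<lambda>i. ell2_nth x i * cinner y (blinfun_apply T (basis_vec i))) has_sum cinner y (blinfun_apply T x)) UNIV"
  using has_sum_bounded_linear[OF bounded_linear_cinner bounded_op_basis_expansion[OF assms]]
  by (simp add: cinner_scaleC_right)

lemma bounded_ops_ext:
  assumes "S \<in> bounded_ops" "T \<in> bounded_ops" "\<And>j k. entry S j k = entry T j k"
  shows "S = T"
proof -
  have "blinfun_apply S (basis_vec k) = T (basis_vec k)" for k
    using assms(3) by (auto intro!: ell2_eqI simp: entry_def cinner_basis_vec)
  then show ?thesis
    using bounded_op_basis_expansion[OF assms(1)] bounded_op_basis_expansion[OF assms(2)]
    by (auto intro!: blinfun_eqI dest: has_sum_unique)
qed

text \<open>The adjoint is written down by its coordinates: \<open>(T* y) i\<close> has to be \<open>\<langle>T e_i, y\<rangle>\<close>.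
  Testing \<open>T\<close> on \<open>\<Sum>i\<in>F. \<langle>T e_i, y\<rangle> e_i\<close> bounds the square sum of these coordinates.\<close>

lemma adjoint_coordinates_bound:
  assumes T: "T \<in> bounded_ops" and "finite F"
  shows "(\<Sum>i\<in>F. (cmod (cinner (blinfun_apply T (basis_vec i)) y))\<^sup>2) \<le> (norm T * norm y)\<^sup>2"
proof -
  define c where "c i = cinner (blinfun_apply T (basis_vec i)) y" for i
  define s where "s = (\<Sum>i\<in>F. (cmod (c i))\<^sup>2)"
  define w where "w = (\<Sum>i\<in>F. c i *\<^sub>C basis_vec i)"
  have s0: "s \<ge> 0" by (simp add: s_def sum_nonneg)
  have nth: "ell2_nth w i = (if i \<in> F then c i else 0)" for i
    using \<open>finite F\<close> by (simp add: w_def ell2_nth_sum scaleC_ell2.rep_eq basis_vec.rep_eq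
          if_distrib[of "\<lambda>z. _ * z"] sum.delta cong: if_cong)
  have "(norm w)\<^sup>2 = (\<Sum>\<^sub>\<infinity>i\<in>F. (cmod (c i))\<^sup>2)"
    unfolding ell2_norm_sq nth by (rule infsum_cong_neutral) auto
  then have w: "(norm w)\<^sup>2 = s" using \<open>finite F\<close> by (simp add: s_def)
  have "blinfun_apply T w = (\<Sum>i\<in>F. c i *\<^sub>C blinfun_apply T (basis_vec i))"
    by (simp add: w_def blinfun.sum_right bounded_opsD[OF T])
  then have "cinner (blinfun_apply T w) y = (\<Sum>i\<in>F. cnj (c i) * c i)"
    by (simp add: cinner_sum_left cinner_scaleC_left c_def)
  also have "\<dots> = of_real s"
    unfolding s_def of_real_sum
    by (rule sum.cong) (simp_all only: complex_norm_square mult.commute)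
  finally have "s \<le> norm (blinfun_apply T w) * norm y"
    using cmod_cinner_le[of "blinfun_apply T w" y] s0 by simp
  also have "\<dots> \<le> norm T * norm w * norm y"
    by (intro mult_right_mono norm_blinfun) simp
  finally have "(norm w)\<^sup>2 \<le> norm w * (norm T * norm y)" by (simp add: w mult_ac)
  then have "norm w \<le> norm T * norm y"
    by (cases "norm w = 0") (auto simp: power2_eq_square)
  then have "(norm w)\<^sup>2 \<le> (norm T * norm y)\<^sup>2" by (intro power_mono) auto
  then show ?thesis by (simp add: w s_def c_def)
qed

lemma ell2_nth_Ell2:
  assumes "\<And>F. finite F \<Longrightarrow> (\<Sum>i\<in>F. (cmod (f i))\<^sup>2) \<le> B"
  shows "ell2_nth (Ell2 f) = f"
proof -
  have "(\<lambda>i. (cmod (f i))\<^sup>2) summable_on UNIV"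
    using assms by (intro nonneg_bdd_above_summable_on) (auto intro!: bdd_aboveI)
  then show ?thesis by (simp add: Ell2_inverse)
qed

lemma adjoint_exists:
  fixes T :: "'i ell2 \<Rightarrow>\<^sub>L 'i ell2"
  assumes T: "T \<in> bounded_ops"
  obtains S where "S \<in> bounded_ops" "\<And>x y. cinner (blinfun_apply S x) y = cinner x (blinfun_apply T y)"
proof -
  define g where "g y = Ell2 (\<lambda>i. cinner (blinfun_apply T (basis_vec i)) y)" for y :: "'i ell2"
  have nth: "ell2_nth (g y) i = cinner (blinfun_apply T (basis_vec i)) y" for y i
    unfolding g_def by (subst ell2_nth_Ell2[OF adjoint_coordinates_bound[OF T]]) auto
  have norm: "norm (g y) \<le> norm y * norm T" for y
  proof -
    have "(norm (g y))\<^sup>2 \<le> (norm T * norm y)\<^sup>2"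
      unfolding ell2_norm_sq
      by (rule infsum_le_finite_sums[OF ell2_nth_summable])
        (simp add: nth adjoint_coordinates_bound[OF T])
    then show ?thesis by (simp add: power2_le_iff_abs_le mult.commute)
  qed
  have bl: "bounded_linear g"
  proof (rule bounded_linear_intro[where K = "norm T"])
    show "g (x + y) = g x + g y" for x y
      by (rule ell2_eqI) (simp add: nth plus_ell2.rep_eq cinner_add_right)
    show "g (r *\<^sub>R x) = r *\<^sub>R g x" for r x
      by (rule ell2_eqI)
        (simp add: nth scaleC_of_real[symmetric] scaleC_ell2.rep_eq cinner_scaleC_right)
  qed (rule norm)
  show thesis
  proof (rule that)
    show "Blinfun g \<in> bounded_ops"
      by (auto simp: bounded_ops_def bounded_linear_Blinfun_apply[OF bl] nth scaleC_ell2.rep_eq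
          cinner_scaleC_right intro!: ell2_eqI)
    fix x y
    have "((\<lambda>i. ell2_nth y i * cinner x (blinfun_apply T (basis_vec i))) has_sum cinner x (blinfun_apply T y)) UNIV"
      by (rule cinner_bounded_op_expansion[OF T])
    also have "(\<lambda>i. ell2_nth y i * cinner x (blinfun_apply T (basis_vec i)))
        = (\<lambda>i. cnj (ell2_nth (g x) i) * ell2_nth y i)"
      by (simp add: nth cinner_commute[symmetric] mult.commute)
    finally show "cinner (blinfun_apply (Blinfun g) x) y = cinner x (blinfun_apply T y)"
      by (simp add: bounded_linear_Blinfun_apply[OF bl] cinner_ell2_def[of "g x"] infsumI)
  qed
qed

lemma op_star_bounded_ops: "T \<in> bounded_ops \<Longrightarrow> op_star T \<in> (bounded_ops :: ('i ell2 \<Rightarrow>\<^sub>L 'i ell2) set)"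
  by (metis adjoint_exists op_star_eqI)

lemma cinner_op_star:
  fixes T :: "'i ell2 \<Rightarrow>\<^sub>L 'i ell2"
  shows "T \<in> bounded_ops \<Longrightarrow> cinner (blinfun_apply (op_star T) x) y = cinner x (blinfun_apply T y)"
  by (metis adjoint_exists op_star_eqI)

lemma norm_op_star:
  fixes T :: "'i ell2 \<Rightarrow>\<^sub>L 'i ell2"
  assumes T: "T \<in> bounded_ops"
  shows "norm (op_star T) = norm T"
proof -
  have le: "norm (op_star S) \<le> norm S" if S: "S \<in> bounded_ops" for S :: "'i ell2 \<Rightarrow>\<^sub>L 'i ell2"
  proof (rule norm_blinfun_bound)
    fix x
    let ?y = "blinfun_apply (op_star S) x"
    have "(norm ?y)\<^sup>2 = cmod (cinner ?y ?y)"
      by (simp only: cinner_self norm_of_real) simp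
    also have "\<dots> = cmod (cinner x (S ?y))" by (simp add: cinner_op_star[OF S])
    also have "\<dots> \<le> norm x * norm (S ?y)" by (rule cmod_cinner_le)
    also have "\<dots> \<le> norm x * (norm S * norm ?y)" by (intro mult_left_mono norm_blinfun) simp
    finally have "norm ?y * norm ?y \<le> (norm S * norm x) * norm ?y"
      by (simp add: power2_eq_square mult_ac)
    then show "norm ?y \<le> norm S * norm x"
      by (cases "norm ?y = 0") auto
  qed simp
  have "op_star (op_star T) = T"
  proof (rule op_star_eqI[OF T])
    show "cinner (blinfun_apply T x) y = cinner x (op_star T y)" for x y
      by (metis cinner_commute cinner_op_star[OF T])
  qed
  then show ?thesis using le[OF T] le[OF op_star_bounded_ops[OF T]] by simp
qed

section \<open>Powers of the shift\<close>

lemma bij_translate_int: "bij (\<lambda>i::int. i - m)"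
  by (rule bij_betw_byWitness[where f' = "\<lambda>i. i + m"]) auto

lift_definition translate :: "int \<Rightarrow> int ell2 \<Rightarrow> int ell2" is "\<lambda>m f i. f (i - m)"
  by (subst summable_on_reindex_bij_betw[OF bij_translate_int])

lemma norm_translate: "norm (translate m x) = norm x"
proof -
  have "(norm (translate m x))\<^sup>2 = (norm x)\<^sup>2"
    unfolding ell2_norm_sq translate.rep_eq
    by (rule infsum_reindex_bij_betw[OF bij_translate_int])
  then show ?thesis by simp
qed

lift_definition shift_pow :: "int \<Rightarrow> int ell2 \<Rightarrow>\<^sub>L int ell2" is translate
proof (rule bounded_linear_intro[where K = 1])
  show "translate m (x + y) = translate m x + translate m y" for m x y by transfer simp
  show "translate m (r *\<^sub>R x) = r *\<^sub>R translate m x" for m r x by transfer simp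
  show "norm (translate m x) \<le> norm x * 1" for m x by (simp add: norm_translate)
qed

lemma ell2_nth_shift_pow: "ell2_nth (shift_pow m x) i = ell2_nth x (i - m)"
  by (simp add: shift_pow.rep_eq translate.rep_eq)

lemma shift_pow_0: "shift_pow 0 = id_blinfun"
  by (rule blinfun_eqI, rule ell2_eqI) (simp add: ell2_nth_shift_pow)

lemma shift_pow_1: "shift_pow 1 = bilateral_shift"
  by (rule blinfun_eqI, rule ell2_eqI)
    (simp add: ell2_nth_shift_pow bilateral_shift.rep_eq shift_vec.rep_eq)

lemma shift_pow_compose: "shift_pow m o\<^sub>L shift_pow n = shift_pow (m + n)"
  by (rule blinfun_eqI, rule ell2_eqI) (simp add: ell2_nth_shift_pow algebra_simps)

lemma shift_pow_bounded_ops: "shift_pow m \<in> bounded_ops"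
  by (auto simp: bounded_ops_def ell2_nth_shift_pow scaleC_ell2.rep_eq intro!: ell2_eqI)

lemma norm_shift_pow_le: "norm (shift_pow m) \<le> 1"
  by (rule norm_blinfun_bound) (auto simp: shift_pow.rep_eq norm_translate)

lemma cinner_shift_pow: "cinner (shift_pow m x) y = cinner x (shift_pow (- m) y)"
proof -
  have "cinner (shift_pow m x) y = (\<Sum>\<^sub>\<infinity>i. cnj (ell2_nth x (i - m)) * ell2_nth y ((i - m) + m))"
    by (simp add: cinner_ell2_def ell2_nth_shift_pow)
  also have "\<dots> = (\<Sum>\<^sub>\<infinity>i. cnj (ell2_nth x i) * ell2_nth y (i + m))"
    by (rule infsum_reindex_bij_betw[OF bij_translate_int])
  finally show ?thesis by (simp add: cinner_ell2_def ell2_nth_shift_pow)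
qed

lemma op_star_shift_pow: "op_star (shift_pow m) = shift_pow (- m)"
  by (rule op_star_eqI[OF shift_pow_bounded_ops]) (simp add: cinner_shift_pow)

lemma shift_pow_basis_vec: "shift_pow m (basis_vec k) = basis_vec (k + m)"
  by (rule ell2_eqI) (auto simp: ell2_nth_shift_pow basis_vec.rep_eq)

section \<open>Entries of operators and Laurent operators\<close>

lemma bounded_linear_entry: "bounded_linear (\<lambda>T. entry T j k)"
  unfolding entry_def
  by (rule bounded_linear_compose[OF bounded_linear_cinner blinfun.bounded_linear_left])

lemmas entry_add = linear_add[OF bounded_linear.linear[OF bounded_linear_entry]]
lemmas entry_diff = linear_diff[OF bounded_linear.linear[OF bounded_linear_entry]]
lemmas entry_zero [simp] = linear_0[OF bounded_linear.linear[OF bounded_linear_entry]]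
lemmas entry_sum = linear_sum[OF bounded_linear.linear[OF bounded_linear_entry]]

lemma entry_scaleC: "entry (c *\<^sub>C T) j k = c * entry T j k"
  by (simp add: entry_def scaleC_blinfun.rep_eq cinner_scaleC_right)

lemma entry_shift_pow: "entry (shift_pow m) j k = (if j = k + m then 1 else 0)"
  by (simp add: entry_def shift_pow_basis_vec cinner_basis_vec basis_vec.rep_eq)

lemma entry_id: "entry id_blinfun j k = (if j = k then 1 else 0)"
  by (simp add: shift_pow_0[symmetric] entry_shift_pow)

lemma entry_op_star: "T \<in> bounded_ops \<Longrightarrow> entry (op_star T) j k = cnj (entry T k j)"
  unfolding entry_def by (metis cinner_commute cinner_op_star)

lemma cmod_entry_le: "cmod (entry T j k) \<le> norm T"
  using cmod_cinner_le[of "basis_vec j" "T (basis_vec k)"] norm_blinfun[of T "basis_vec k"]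
  by (simp add: entry_def)

text \<open>A Laurent operator is the operator of multiplication by a bounded function on the circle;
  the entry \<open>(m, 0)\<close> is the \<open>m\<close>-th Fourier coefficient of that function.\<close>

definition laurent :: "(int ell2 \<Rightarrow>\<^sub>L int ell2) \<Rightarrow> bool"
  where "laurent T \<longleftrightarrow> T \<in> bounded_ops \<and> (\<forall>j k. entry T j k = entry T (j - k) 0)"

lemma laurent_bounded_ops: "laurent T \<Longrightarrow> T \<in> bounded_ops"
  by (simp add: laurent_def)

lemma laurent_entry: "laurent T \<Longrightarrow> entry T j k = entry T (j - k) 0"
  unfolding laurent_def by blast

lemma laurent_shift_pow: "laurent (shift_pow m)"
  by (auto simp: laurent_def shift_pow_bounded_ops entry_shift_pow)

lemma complex_subspace_laurent: "complex_subspace {T. laurent T}"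
  unfolding complex_subspace_def mem_Collect_eq laurent_def
  by (auto simp: entry_add entry_scaleC complex_subspace_bounded_ops complex_subspace_add
    complex_subspace_scaleC zero_bounded_ops)

lemma laurent_ext:
  assumes "laurent S" "laurent T" "\<And>m. entry S m 0 = entry T m 0"
  shows "S = T"
proof (rule bounded_ops_ext)
  show "entry S j k = entry T j k" for j k
    by (metis assms laurent_entry)
qed (use assms in \<open>auto dest: laurent_bounded_ops\<close>)

text \<open>An operator with absolutely summable Fourier coefficients is the sum of its Fourier series.\<close>

lemma laurent_norm_le_infsum:
  assumes T: "laurent T" and sum: "(\<lambda>m. cmod (entry T m 0)) summable_on UNIV"
  shows "norm T \<le> (\<Sum>\<^sub>\<infinity>m. cmod (entry T m 0))"
proof -
  let ?f = "\<lambda>m. entry T m 0 *\<^sub>C shift_pow m"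
  have le: "norm (?f m) \<le> cmod (entry T m 0)" for m
    using norm_shift_pow_le[of m] by (simp add: norm_scaleC_blinfun mult_left_le)
  have abs: "(\<lambda>m. norm (?f m)) summable_on UNIV"
    by (rule Infinite_Sum.abs_summable_on_comparison_test'[OF sum le])
  have hs: "(?f has_sum infsum ?f UNIV) UNIV"
    by (rule has_sum_infsum[OF abs_summable_summable[OF abs]])
  have entry: "entry (infsum ?f UNIV) j k = entry T (j - k) 0" for j k
  proof -
    have "((\<lambda>m. entry (?f m) j k) has_sum entry (infsum ?f UNIV) j k) UNIV"
      using has_sum_bounded_linear[OF bounded_linear_entry hs] .
    moreover have "((\<lambda>m. entry (?f m) j k) has_sum entry T (j - k) 0) UNIV"
      by (rule has_sum_finite_neutralI[of "{j - k}"]) (auto simp: entry_scaleC entry_shift_pow)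
    ultimately show ?thesis by (rule has_sum_unique)
  qed
  have "?f m \<in> bounded_ops" for m
    by (rule complex_subspace_scaleC[OF complex_subspace_bounded_ops shift_pow_bounded_ops])
  then have "sum ?f F \<in> bounded_ops" for F
    by (rule complex_subspace_sum[OF complex_subspace_bounded_ops])
  then have "infsum ?f UNIV \<in> bounded_ops"
    using Lim_in_closed_set[OF closed_bounded_ops _ _ hs[unfolded has_sum_def]] by simp
  then have "infsum ?f UNIV = T"
    using entry laurent_entry[OF T] by (intro bounded_ops_ext laurent_bounded_ops[OF T]) simp_all
  then have "norm T = norm (infsum ?f UNIV)" by simp
  also have "\<dots> \<le> (\<Sum>\<^sub>\<infinity>m. norm (?f m))" by (rule norm_infsum_bound[OF abs])
  also have "\<dots> \<le> (\<Sum>\<^sub>\<infinity>m. cmod (entry T m 0))"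
    by (rule infsum_mono[OF abs sum le])
  finally show ?thesis .
qed

text \<open>The basic estimate. Convolution with a kernel whose Fourier coefficients \<open>c\<close> are square
  summable maps bounded functions to continuous ones: the column \<open>D e_0\<close> consists of the Fourier
  coefficients of \<open>D\<close>, so these have square sum at most \<open>(norm D)\<^sup>2\<close>, and the Cauchy-Schwarz
  inequality bounds the absolute sum of the coefficients of \<open>T\<close>.\<close>

lemma laurent_norm_le_l2_multiplier:
  assumes T: "laurent T"
    and c: "\<And>m. cmod (entry T m 0) \<le> c m * cmod (entry D m 0)"
    and C: "\<And>F. finite F \<Longrightarrow> (\<Sum>m\<in>F. (c m)\<^sup>2) \<le> C\<^sup>2" and "0 \<le> C"
  shows "norm T \<le> C * norm D"
proof -
  have fin: "(\<Sum>m\<in>F. cmod (entry T m 0)) \<le> C * norm D" if F: "finite F" for F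
  proof -
    have "(\<Sum>m\<in>F. cmod (entry T m 0)) \<le> (\<Sum>m\<in>F. c m * cmod (entry D m 0))"
      by (rule sum_mono) (rule c)
    also have "\<dots> \<le> C * norm D"
    proof (rule power2_le_imp_le)
      have "(\<Sum>m\<in>F. c m * cmod (entry D m 0))\<^sup>2
          \<le> (\<Sum>m\<in>F. (c m)\<^sup>2) * (\<Sum>m\<in>F. (cmod (entry D m 0))\<^sup>2)"
        by (rule Cauchy_Schwarz_ineq_sum)
      also have "\<dots> \<le> C\<^sup>2 * (norm D)\<^sup>2"
      proof (rule mult_mono[OF C[OF F]])
        have "(\<Sum>m\<in>F. (cmod (entry D m 0))\<^sup>2) \<le> (norm (D (basis_vec 0)))\<^sup>2"
          unfolding entry_def cinner_basis_vec by (rule ell2_finite_sum_le[OF F])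
        also have "\<dots> \<le> (norm D)\<^sup>2"
          using norm_blinfun[of D "basis_vec 0"] by (intro power_mono) auto
        finally show "(\<Sum>m\<in>F. (cmod (entry D m 0))\<^sup>2) \<le> (norm D)\<^sup>2" .
      qed (auto intro: sum_nonneg)
      finally show "(\<Sum>m\<in>F. c m * cmod (entry D m 0))\<^sup>2 \<le> (C * norm D)\<^sup>2"
        by (simp add: power_mult_distrib)
    qed (use \<open>0 \<le> C\<close> in simp)
    finally show ?thesis .
  qed
  have sum: "(\<lambda>m. cmod (entry T m 0)) summable_on UNIV"
    using fin by (intro nonneg_bdd_above_summable_on) (auto intro!: bdd_aboveI)
  have "norm T \<le> (\<Sum>\<^sub>\<infinity>m. cmod (entry T m 0))" by (rule laurent_norm_le_infsum[OF T sum])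
  also have "\<dots> \<le> C * norm D" by (rule infsum_le_finite_sums[OF sum fin])
  finally show ?thesis .
qed

section \<open>The continuous functions on the circle\<close>

text \<open>The bounded operators commuting with the shift and with its inverse form a C*-algebra, and
  their matrices are constant along diagonals.\<close>

definition shift_commutant :: "(int ell2 \<Rightarrow>\<^sub>L int ell2) set"
  where "shift_commutant = {T \<in> bounded_ops. \<forall>m. T o\<^sub>L shift_pow m = shift_pow m o\<^sub>L T}"

lemma shift_commutant_iff:
  "T \<in> shift_commutant \<longleftrightarrow> T \<in> bounded_ops \<and>
    (\<forall>m x. blinfun_apply T (shift_pow m x) = shift_pow m (blinfun_apply T x))"
  by (simp add: shift_commutant_def blinfun_eq_iff)

lemma shift_commutantD:
  "T \<in> shift_commutant \<Longrightarrow> blinfun_apply T (shift_pow m x) = shift_pow m (blinfun_apply T x)"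
  by (simp add: shift_commutant_iff)

lemma cstar_subalgebra_shift_commutant: "cstar_subalgebra shift_commutant"
  unfolding cstar_subalgebra_def
proof (intro conjI ballI)
  show "complex_subspace shift_commutant"
    by (auto simp: complex_subspace_def[of shift_commutant] shift_commutant_iff blinfun.add_left
        blinfun.add_right scaleC_blinfun.rep_eq bounded_opsD[OF shift_pow_bounded_ops]
        complex_subspace_add[OF complex_subspace_bounded_ops]
        complex_subspace_scaleC[OF complex_subspace_bounded_ops] zero_bounded_ops)
  show "S o\<^sub>L T \<in> shift_commutant" if "S \<in> shift_commutant" "T \<in> shift_commutant" for S T
    using that by (simp add: shift_commutant_iff bounded_ops_def)
  show "op_star T \<in> shift_commutant" if T: "T \<in> shift_commutant" for T
  proof -
    have b: "T \<in> bounded_ops" using T by (simp add: shift_commutant_def)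
    have "blinfun_apply (op_star T) (shift_pow m x) = shift_pow m (op_star T x)" for m x
    proof (rule cinner_ext)
      fix y
      have "cinner (op_star T (shift_pow m x)) y = cinner (shift_pow m (op_star T x)) y"
        by (simp add: cinner_op_star[OF b] cinner_shift_pow shift_commutantD[OF T])
      then show "cinner y (op_star T (shift_pow m x)) = cinner y (shift_pow m (op_star T x))"
        by (metis cinner_commute)
    qed
    then show ?thesis
      by (simp add: shift_commutant_iff op_star_bounded_ops[OF b])
  qed
  have "closed {T. T o\<^sub>L shift_pow m = shift_pow m o\<^sub>L T}" for m
    by (intro closed_Collect_eq continuous_intros)
  then have "closed (bounded_ops \<inter> {T. \<forall>m. T o\<^sub>L shift_pow m = shift_pow m o\<^sub>L T})"
    by (intro closed_Int closed_bounded_ops closed_Collect_all)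
  then show "closed shift_commutant" by (simp add: shift_commutant_def Int_def)
qed (auto simp: shift_commutant_def)

lemma circle_algebra_subset: "circle_algebra \<subseteq> shift_commutant"
proof -
  have "bilateral_shift \<in> shift_commutant"
    by (auto simp: shift_pow_1[symmetric] shift_commutant_def shift_pow_bounded_ops
        shift_pow_compose add.commute)
  then show ?thesis
    using cstar_subalgebra_shift_commutant unfolding circle_algebra_def cstar_generated_def by auto
qed

lemma cstar_subalgebra_circle_algebra: "cstar_subalgebra circle_algebra"
proof -
  have "circle_algebra \<subseteq> bounded_ops"
    using circle_algebra_subset by (auto simp: shift_commutant_def)
  then show ?thesis
    unfolding cstar_subalgebra_def circle_algebra_def cstar_generated_def complex_subspace_def
    by (auto intro!: closed_Inter)
qed

lemma shift_pow_circle_algebra: "shift_pow m \<in> circle_algebra"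
proof -
  have U: "bilateral_shift \<in> circle_algebra"
    by (auto simp: circle_algebra_def cstar_generated_def)
  have mult: "S o\<^sub>L T \<in> circle_algebra" if "S \<in> circle_algebra" "T \<in> circle_algebra" for S T
    using that cstar_subalgebra_circle_algebra by (simp add: cstar_subalgebra_def)
  have "shift_pow 1 \<in> circle_algebra" using U by (simp add: shift_pow_1)
  moreover from this have "shift_pow (-1) \<in> circle_algebra"
    using cstar_subalgebra_circle_algebra
    by (simp add: cstar_subalgebra_def flip: op_star_shift_pow)
  ultimately show ?thesis
  proof (induction m rule: int_induct[where k = 0])
    case base
    then show ?case using mult[of "shift_pow 1" "shift_pow (-1)"] by (simp add: shift_pow_compose)
  next
    case (step1 i)
    then show ?case using mult[of "shift_pow i" "shift_pow 1"] by (simp add: shift_pow_compose)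
  next
    case (step2 i)
    then show ?case using mult[of "shift_pow i" "shift_pow (-1)"] by (simp add: shift_pow_compose)
  qed
qed

lemma circle_algebra_laurent:
  assumes "T \<in> circle_algebra"
  shows "laurent T"
proof -
  have T: "T \<in> shift_commutant" using assms circle_algebra_subset by blast
  have "entry T j k = entry T (j - k) 0" for j k
  proof -
    have "entry T j k = cinner (basis_vec j) (blinfun_apply T (shift_pow k (basis_vec 0)))"
      by (simp add: entry_def shift_pow_basis_vec)
    also have "\<dots> = entry T (j - k) 0"
      by (simp add: shift_commutantD[OF T] entry_def cinner_basis_vec ell2_nth_shift_pow)
    finally show ?thesis .
  qed
  then show ?thesis using T by (simp add: laurent_def shift_commutant_def)
qed

section \<open>Fejer means\<close>

definition fejer_weight :: "nat \<Rightarrow> int \<Rightarrow> real"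
  where "fejer_weight N m = max 0 (1 - \<bar>real_of_int m\<bar> / real N)"

definition fejer :: "nat \<Rightarrow> (int ell2 \<Rightarrow>\<^sub>L int ell2) \<Rightarrow> int ell2 \<Rightarrow>\<^sub>L int ell2"
  where "fejer N T =
    (\<Sum>m\<in>{- int N..int N}. (of_real (fejer_weight N m) * entry T m 0) *\<^sub>C shift_pow m)"

lemma fejer_weight_eq_0: "N > 0 \<Longrightarrow> \<bar>m\<bar> \<ge> int N \<Longrightarrow> fejer_weight N m = 0"
  by (simp add: fejer_weight_def field_simps)

lemma entry_fejer:
  assumes "N > 0"
  shows "entry (fejer N T) j k = of_real (fejer_weight N (j - k)) * entry T (j - k) 0"
proof -
  have "entry (fejer N T) j k = (\<Sum>m\<in>{- int N..int N}.
      if m = j - k then of_real (fejer_weight N m) * entry T m 0 else 0)"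
    unfolding fejer_def entry_sum
    by (rule sum.cong) (auto simp: entry_scaleC entry_shift_pow)
  also have "\<dots> = of_real (fejer_weight N (j - k)) * entry T (j - k) 0"
    using fejer_weight_eq_0[OF assms, of "j - k"] by (auto simp: sum.delta)
  finally show ?thesis .
qed

lemma fejer_circle_algebra: "fejer N T \<in> circle_algebra"
  using cstar_subalgebra_circle_algebra shift_pow_circle_algebra
  unfolding fejer_def cstar_subalgebra_def
  by (intro complex_subspace_sum) (auto simp: complex_subspace_def)

lemma laurent_fejer: "laurent (fejer N T)"
  by (rule circle_algebra_laurent[OF fejer_circle_algebra])

lemma fejer_add: "fejer N (S + T) = fejer N S + fejer N T"
  by (simp add: fejer_def entry_add sum.distrib[symmetric] blinfun_eq_iff blinfun.sum_left
      scaleC_blinfun.rep_eq blinfun.add_left distrib_left scaleC_add_left)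

lemma fejer_scaleC: "fejer N (c *\<^sub>C T) = c *\<^sub>C fejer N T"
  by (simp add: fejer_def entry_scaleC blinfun_eq_iff blinfun.sum_left
      scaleC_blinfun.rep_eq scaleC_sum_right scaleC_scaleC mult_ac)

lemma fejer_id:
  assumes "N > 0" shows "fejer N id_blinfun = id_blinfun"
  by (rule laurent_ext[OF laurent_fejer])
    (use laurent_shift_pow[of 0] in \<open>auto simp: shift_pow_0 entry_fejer[OF assms] entry_id fejer_weight_def\<close>)

text \<open>The number of pairs in \<open>{..<N} \<times> {..<N}\<close> with difference \<open>m\<close> is \<open>N - \<bar>m\<bar>\<close>.\<close>

lemma sum_differences:
  fixes f :: "int \<Rightarrow> complex"
  shows "(\<Sum>a<N. \<Sum>b<N. f (int a - int b)) = (\<Sum>m\<in>{- int N..int N}. of_int (int N - \<bar>m\<bar>) * f m)"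
proof (induction N)
  case (Suc N)
  have neg: "(\<Sum>a<Suc N. f (int a - int N)) = (\<Sum>m\<in>{- int N..0}. f m)"
    by (rule sum.reindex_bij_witness[where i = "\<lambda>m. nat (m + int N)" and j = "\<lambda>a. int a - int N"]) auto
  have pos: "(\<Sum>b<N. f (int N - int b)) = (\<Sum>m\<in>{1..int N}. f m)"
    by (rule sum.reindex_bij_witness[where i = "\<lambda>m. nat (int N - m)" and j = "\<lambda>b. int N - int b"]) auto
  have "{- int N..int N} = {- int N..0} \<union> {1..int N}" by auto
  then have split: "(\<Sum>m\<in>{- int N..int N}. f m) = (\<Sum>m\<in>{- int N..0}. f m) + (\<Sum>m\<in>{1..int N}. f m)"
    by (simp add: sum.union_disjoint)
  have "(\<Sum>a<Suc N. \<Sum>b<Suc N. f (int a - int b))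
      = (\<Sum>a<N. \<Sum>b<N. f (int a - int b)) + (\<Sum>a<Suc N. f (int a - int N)) + (\<Sum>b<N. f (int N - int b))"
    by (simp add: sum.distrib)
  also have "\<dots> = (\<Sum>m\<in>{- int N..int N}. of_int (int (Suc N) - \<bar>m\<bar>) * f m)"
    unfolding Suc.IH neg pos add.assoc split[symmetric] sum.distrib[symmetric]
    by (rule sum.cong) (auto simp: algebra_simps)
  also have "\<dots> = (\<Sum>m\<in>{- int (Suc N)..int (Suc N)}. of_int (int (Suc N) - \<bar>m\<bar>) * f m)"
  proof (rule sum.mono_neutral_left)
    show "\<forall>m\<in>{- int (Suc N)..int (Suc N)} - {- int N..int N}. of_int (int (Suc N) - \<bar>m\<bar>) * f m = 0"
    proof
      fix m assume "m \<in> {- int (Suc N)..int (Suc N)} - {- int N..int N}"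
      then have "\<bar>m\<bar> = int (Suc N)" by auto
      then show "of_int (int (Suc N) - \<bar>m\<bar>) * f m = 0" by simp
    qed
  qed auto
  finally show ?case .
qed simp

definition window :: "nat \<Rightarrow> int \<Rightarrow> int ell2 \<Rightarrow> int ell2"
  where "window N l v = (\<Sum>a<N. ell2_nth v (l + int a) *\<^sub>C basis_vec (l + int a))"

lemma has_sum_finite_sum:
  fixes f :: "'i \<Rightarrow> 'a \<Rightarrow> 'b::topological_comm_monoid_add"
  assumes "\<And>i. i \<in> I \<Longrightarrow> (f i has_sum s i) A"
  shows "((\<lambda>x. \<Sum>i\<in>I. f i x) has_sum (\<Sum>i\<in>I. s i)) A"
proof -
  have "((\<lambda>F. \<Sum>i\<in>I. sum (f i) F) \<longlongrightarrow> (\<Sum>i\<in>I. s i)) (finite_subsets_at_top A)"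
    using assms by (intro tendsto_sum) (simp add: has_sum_def)
  then show ?thesis unfolding has_sum_def by (subst (asm) sum.swap)
qed

text \<open>The triangular weights count the pairs of points of a window of length \<open>N\<close> with a given
  difference. Hence the Fejer mean is the average over all windows of the compressions of \<open>T\<close>,
  which exhibits it as a unital completely positive map.\<close>

lemma fejer_has_sum_windows:
  assumes T: "laurent T" and N: "N > 0"
  shows "((\<lambda>l. cinner (window N l v) (blinfun_apply T (window N l w)))
    has_sum of_nat N * cinner v (fejer N T w)) UNIV"
proof -
  have pair: "((\<lambda>l. cnj (ell2_nth v (l + int a)) * ell2_nth w (l + int b))
      has_sum cinner v (shift_pow (int a - int b) w)) UNIV" for a b
  proof -
    have bij: "bij (\<lambda>l. l + int a)" using bij_translate_int[of "- int a"] by simp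
    have "((\<lambda>i. cnj (ell2_nth v i) * ell2_nth (shift_pow (int a - int b) w) i)
        has_sum cinner v (shift_pow (int a - int b) w)) UNIV"
      unfolding cinner_ell2_def
      by (rule has_sum_infsum[OF ell2_inner_summable[OF ell2_nth_summable ell2_nth_summable]])
    then have "((\<lambda>l. cnj (ell2_nth v (l + int a)) * ell2_nth (shift_pow (int a - int b) w) (l + int a))
        has_sum cinner v (shift_pow (int a - int b) w)) UNIV"
      by (subst has_sum_reindex_bij_betw[OF bij])
    then show ?thesis by (simp add: ell2_nth_shift_pow algebra_simps)
  qed
  have summand: "cinner (window N l v) (blinfun_apply T (window N l w))
      = (\<Sum>a<N. \<Sum>b<N. entry T (int a - int b) 0 *
          (cnj (ell2_nth v (l + int a)) * ell2_nth w (l + int b)))" for l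
  proof -
    have "cinner (window N l v) (blinfun_apply T (window N l w))
        = (\<Sum>a<N. \<Sum>b<N. cnj (ell2_nth v (l + int a)) * (ell2_nth w (l + int b) *
          entry T (l + int a) (l + int b)))"
      unfolding window_def
      by (simp add: cinner_sum_left cinner_sum_right blinfun.sum_right cinner_scaleC_left
          cinner_scaleC_right bounded_opsD[OF laurent_bounded_ops[OF T]] entry_def sum_distrib_left)
        (subst sum.swap, simp add: mult_ac)
    also have "\<dots> = (\<Sum>a<N. \<Sum>b<N. entry T (int a - int b) 0 *
          (cnj (ell2_nth v (l + int a)) * ell2_nth w (l + int b)))"
      by (subst laurent_entry[OF T], intro sum.cong refl) simp
    finally show ?thesis .
  qed
  have "((\<lambda>l. cinner (window N l v) (blinfun_apply T (window N l w)))
      has_sum (\<Sum>a<N. \<Sum>b<N. entry T (int a - int b) 0 * cinner v (shift_pow (int a - int b) w))) UNIV"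
    unfolding summand by (intro has_sum_finite_sum has_sum_cmult_right pair)
  also have "(\<Sum>a<N. \<Sum>b<N. entry T (int a - int b) 0 * cinner v (shift_pow (int a - int b) w))
      = (\<Sum>m\<in>{- int N..int N}. of_int (int N - \<bar>m\<bar>) * (entry T m 0 * cinner v (shift_pow m w)))"
    by (rule sum_differences)
  also have "\<dots> = of_nat N * cinner v (fejer N T w)"
    unfolding fejer_def blinfun.sum_left cinner_sum_right sum_distrib_left
  proof (rule sum.cong[OF refl])
    fix m assume "m \<in> {- int N..int N}"
    then have "real_of_int (int N - \<bar>m\<bar>) = real N * fejer_weight N m"
      using N by (auto simp: fejer_weight_def max_def field_simps)
    then have "(of_int (int N - \<bar>m\<bar>) :: complex) = of_nat N * of_real (fejer_weight N m)"
      by (metis of_real_mult of_real_of_int_eq of_real_of_nat_eq)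
    then show "of_int (int N - \<bar>m\<bar>) * (entry T m 0 * cinner v (shift_pow m w))
        = of_nat N * cinner v (((of_real (fejer_weight N m) * entry T m 0) *\<^sub>C shift_pow m) w)"
      by (simp add: scaleC_blinfun.rep_eq cinner_scaleC_right mult_ac)
  qed
  finally show ?thesis .
qed

lemma norm_window_has_sum:
  assumes N: "N > 0"
  shows "((\<lambda>l. (norm (window N l v))\<^sup>2) has_sum real N * (norm v)\<^sup>2) UNIV"
proof -
  have "laurent id_blinfun" using laurent_shift_pow[of 0] by (simp add: shift_pow_0)
  from fejer_has_sum_windows[OF this N, of v v]
  have "((\<lambda>l. cinner (window N l v) (window N l v)) has_sum of_nat N * cinner v v) UNIV"
    by (simp add: fejer_id[OF N])
  from has_sum_Re[OF this] show ?thesis by (simp add: cinner_self)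
qed

text \<open>Averaging over windows gives \<open>\<bar>\<langle>v, fejer N T w\<rangle>\<bar> \<le> norm T * (norm v ^ 2 + norm w ^ 2) / 2\<close>, and
  the test vector \<open>v\<close> is taken parallel to \<open>fejer N T w\<close> with the norm of \<open>w\<close>.\<close>

lemma norm_fejer_le:
  assumes T: "laurent T" and N: "N > 0"
  shows "norm (fejer N T) \<le> norm T"
proof (rule norm_blinfun_bound)
  fix w
  have half: "cmod (cinner v (fejer N T w)) \<le> norm T * ((norm v)\<^sup>2 + (norm w)\<^sup>2) / 2" for v w
  proof -
    let ?b = "\<lambda>l. norm T / 2 * ((norm (window N l v))\<^sup>2 + (norm (window N l w))\<^sup>2)"
    have b: "(?b has_sum norm T / 2 * (real N * (norm v)\<^sup>2 + real N * (norm w)\<^sup>2)) UNIV"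
      by (intro has_sum_cmult_right has_sum_add norm_window_has_sum N)
    have "cmod (cinner (window N l v) (T (window N l w))) \<le> ?b l" for l
    proof -
      have "cmod (cinner (window N l v) (T (window N l w)))
          \<le> norm (window N l v) * (norm T * norm (window N l w))"
        by (rule order_trans[OF cmod_cinner_le mult_left_mono[OF norm_blinfun]]) simp
      also have "\<dots> = norm T / 2 * (2 * norm (window N l v) * norm (window N l w))" by simp
      also have "\<dots> \<le> ?b l" by (rule mult_left_mono[OF sum_squares_bound]) simp
      finally show ?thesis .
    qed
    note le = this
    have abs: "(\<lambda>l. cmod (cinner (window N l v) (blinfun_apply T (window N l w)))) summable_on UNIV"
      by (rule Infinite_Sum.abs_summable_on_comparison_test'[OF has_sum_imp_summable[OF b] le])
    have "cmod (of_nat N * cinner v (fejer N T w))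
        \<le> (\<Sum>\<^sub>\<infinity>l. cmod (cinner (window N l v) (T (window N l w))))"
      by (rule norm_has_sum_bound[OF has_sum_infsum[OF abs] fejer_has_sum_windows[OF T N]])
    also have "\<dots> \<le> norm T / 2 * (real N * (norm v)\<^sup>2 + real N * (norm w)\<^sup>2)"
      by (rule has_sum_mono[OF has_sum_infsum[OF abs] b le])
    finally have "cmod (of_nat N * cinner v (fejer N T w))
        \<le> norm T / 2 * (real N * (norm v)\<^sup>2 + real N * (norm w)\<^sup>2)" .
    then have "real N * cmod (cinner v (fejer N T w)) \<le> real N * (norm T * ((norm v)\<^sup>2 + (norm w)\<^sup>2) / 2)"
      by (simp add: norm_mult algebra_simps)
    then show ?thesis using N by simp
  qed
  show "norm (fejer N T w) \<le> norm T * norm w"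
  proof (cases "norm (fejer N T w) = 0 \<or> norm w = 0")
    case False
    define u where "u = (norm w / norm (fejer N T w)) *\<^sub>R fejer N T w"
    have u: "norm u = norm w" using False by (simp add: u_def)
    have "cinner u (fejer N T w) = of_real (norm w * norm (fejer N T w))"
      using False by (simp add: u_def scaleC_of_real[symmetric] cinner_scaleC_left cinner_self
          power2_eq_square)
    then have "norm w * norm (fejer N T w) = cmod (cinner u (fejer N T w))"
      by (simp add: norm_mult)
    also have "\<dots> \<le> norm w * (norm T * norm w)"
      using half[of u w] u by (simp add: power2_eq_square mult_ac)
    finally show ?thesis using False by simp
  qed (auto simp: zero_le_mult_iff)
qed simp

text \<open>The quadratic form of \<open>fejer N\<close> applied to a matrix of operators is the average of the
  quadratic form of the matrix at the windows of the vectors.\<close>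

lemma fejer_completely_positive:
  assumes T: "\<And>i j. i < m \<Longrightarrow> j < m \<Longrightarrow> laurent (T i j)" and pos: "positive_op_matrix m T" and N: "N > 0"
  shows "positive_op_matrix m (\<lambda>i j. fejer N (T i j))"
  unfolding positive_op_matrix_def
proof
  fix v :: "nat \<Rightarrow> int ell2"
  let ?s = "\<Sum>i<m. \<Sum>j<m. cinner (v i) (fejer N (T i j) (v j))"
  have hs: "((\<lambda>l. \<Sum>i<m. \<Sum>j<m. cinner (window N l (v i)) (T i j (window N l (v j))))
      has_sum (\<Sum>i<m. \<Sum>j<m. of_nat N * cinner (v i) (fejer N (T i j) (v j)))) UNIV"
    by (intro has_sum_finite_sum fejer_has_sum_windows T N) auto
  have pos: "(\<Sum>i<m. \<Sum>j<m. cinner (window N l (v i)) (T i j (window N l (v j)))) \<in> \<real>\<^sub>\<ge>\<^sub>0" for l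
    using pos[unfolded positive_op_matrix_def, rule_format, of "\<lambda>i. window N l (v i)"] .
  have "(\<Sum>i<m. \<Sum>j<m. of_nat N * cinner (v i) (fejer N (T i j) (v j))) \<in> (\<real>\<^sub>\<ge>\<^sub>0 :: complex set)"
  proof (rule Lim_in_closed_set[OF _ _ _ hs[unfolded has_sum_def]])
    have "sum f F \<in> \<real>\<^sub>\<ge>\<^sub>0" if "\<And>l. f l \<in> \<real>\<^sub>\<ge>\<^sub>0" for f :: "int \<Rightarrow> complex" and F
      using that by (simp add: complex_nonneg_Reals_iff sum_nonneg)
    from this[OF pos] show "\<forall>\<^sub>F F in finite_subsets_at_top UNIV. (\<Sum>l\<in>F. \<Sum>i<m. \<Sum>j<m.
        cinner (window N l (v i)) (T i j (window N l (v j)))) \<in> \<real>\<^sub>\<ge>\<^sub>0"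
      by (intro always_eventually allI)
  qed simp_all
  then have "of_nat N * ?s \<in> \<real>\<^sub>\<ge>\<^sub>0" by (simp add: sum_distrib_left)
  then show "?s \<in> \<real>\<^sub>\<ge>\<^sub>0"
    using N by (simp add: complex_nonneg_Reals_iff zero_le_mult_iff)
qed

section \<open>The q-derivative\<close>

lemma q_int_0 [simp]: "q_int q 0 = 0"
  by (simp add: q_int_def)

lemma q_int_minus: "q_int q (- n) = - q_int q n"
  by (simp add: q_int_def minus_divide_left)

text \<open>This recursion covers \<open>q = 1\<close> as well, so that the continuity at \<open>q = 1\<close> and the lower bound
  follow from it by the same inductions as for \<open>q < 1\<close>.\<close>

lemma q_int_Suc:
  assumes "q \<in> {0<..1}"
  shows "q_int q (int (Suc n)) = q * q_int q (int n) + inverse q ^ n"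
proof (cases "q = 1")
  case False
  with assms have q: "0 < q" "q < 1" by auto
  have ne: "q - inverse q \<noteq> 0"
    using q one_less_inverse[of q] by auto
  have powi: "q powi int m = q ^ m" "q powi - int m = inverse q ^ m" for m
    by (simp_all add: power_int_def)
  have "q * inverse q ^ Suc n = inverse q ^ n" using q by simp
  then have "q ^ Suc n - inverse q ^ Suc n
      = q * (q ^ n - inverse q ^ n) + inverse q ^ n * (q - inverse q)"
    by (simp add: algebra_simps)
  then show ?thesis
    using ne unfolding q_int_def powi by (simp add: False add_divide_distrib)
qed (simp add: q_int_def)

text \<open>The induction step is \<open>q * n + q powi (- n) \<ge> n + 1\<close>, an instance of the weighted inequality
  of the arithmetic and geometric means. It follows from Bernoulli's inequality for \<open>q powi (- n)\<close>
  and \<open>q + 1 / q \<ge> 2\<close>.\<close>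

lemma q_int_of_nat_ge:
  assumes "q \<in> {0<..1}"
  shows "real n \<le> q_int q (int n)"
proof (induction n)
  case (Suc n)
  have q: "0 < q" "q \<le> 1" using assms by auto
  have "1 + real n * (inverse q - 1) \<le> (1 + (inverse q - 1)) ^ n"
    using one_le_inverse[OF q] by (intro Bernoulli_inequality) linarith
  then have "1 + real n * (inverse q - 1) \<le> inverse q ^ n" by simp
  moreover have "q * real n \<le> q * q_int q (int n)"
    using Suc q by (intro mult_left_mono) auto
  moreover have "real n * 2 \<le> real n * (q + inverse q)"
  proof (rule mult_left_mono)
    have "0 \<le> (q - 1)\<^sup>2 / q" using q by simp
    also have "(q - 1)\<^sup>2 / q = q + inverse q - 2"
      using q by (simp add: field_simps power2_eq_square)
    finally show "2 \<le> q + inverse q" by simp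
  qed simp
  ultimately show ?case
    unfolding q_int_Suc[OF assms] by (simp add: algebra_simps)
qed simp

lemma abs_q_int_ge:
  assumes "q \<in> {0<..1}"
  shows "\<bar>real_of_int n\<bar> \<le> \<bar>q_int q n\<bar>"
proof (cases n rule: int_cases2)
  case (nonneg m)
  then show ?thesis using q_int_of_nat_ge[OF assms, of m] by simp
next
  case (nonpos m)
  then show ?thesis using q_int_of_nat_ge[OF assms, of m] by (simp add: q_int_minus)
qed

lemma tendsto_q_int:
  assumes "q0 \<in> {0<..1}"
  shows "((\<lambda>q. q_int q n) \<longlongrightarrow> q_int q0 n) (at q0 within {0<..1})"
proof -
  have nat: "((\<lambda>q. q_int q (int n)) \<longlongrightarrow> q_int q0 (int n)) (at q0 within {0<..1})" for n
  proof (induction n)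
    case (Suc n)
    have "((\<lambda>q. q * q_int q (int n) + inverse q ^ n) \<longlongrightarrow> q0 * q_int q0 (int n) + inverse q0 ^ n)
        (at q0 within {0<..1})"
      using assms by (intro tendsto_intros Suc) auto
    then show ?case
      unfolding q_int_Suc[OF assms]
      by (rule Lim_transform_eventually)
        (auto simp: eventually_at_filter q_int_Suc simp del: of_nat_Suc)
  qed simp
  show ?thesis
  proof (cases n rule: int_cases2)
    case (nonpos m)
    then show ?thesis using tendsto_minus[OF nat[of m]] by (simp add: q_int_minus)
  qed (simp add: nat)
qed

lemma is_q_derivative_unique: "is_q_derivative q T D \<Longrightarrow> is_q_derivative q T E \<Longrightarrow> D = E"
  by (rule bounded_ops_ext) (auto simp: is_q_derivative_def)

lemma q_derivative_eqI: "is_q_derivative q T D \<Longrightarrow> q_derivative q T = D"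
  unfolding q_derivative_def by (rule the_equality) (auto intro: is_q_derivative_unique)

lemma Lip_circleI:
  "T \<in> circle_algebra \<Longrightarrow> is_q_derivative q T D \<Longrightarrow> T \<in> Lip_circle q"
  using laurent_bounded_ops[OF circle_algebra_laurent, of T]
  by (auto simp: Lip_circle_def Lip_ell2_def)

lemma is_q_derivative_q_derivative:
  "T \<in> Lip_circle q \<Longrightarrow> is_q_derivative q T (q_derivative q T)"
  by (auto simp: Lip_circle_def Lip_ell2_def q_derivative_eqI)

lemma Lip_circle_laurent: "T \<in> Lip_circle q \<Longrightarrow> laurent T"
  by (auto simp: Lip_circle_def intro: circle_algebra_laurent)

lemma entry_q_derivative:
  "T \<in> Lip_circle q \<Longrightarrow>
    entry (q_derivative q T) j k = \<i> * of_real (q_int q (j - k)) * entry T j k"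
  using is_q_derivative_q_derivative[of T q] by (auto simp: is_q_derivative_def)

lemma laurent_q_derivative:
  assumes "T \<in> Lip_circle q" shows "laurent (q_derivative q T)"
  unfolding laurent_def
proof (intro conjI allI)
  show "q_derivative q T \<in> bounded_ops"
    using is_q_derivative_q_derivative[OF assms] by (simp add: is_q_derivative_def)
  show "entry (q_derivative q T) j k = entry (q_derivative q T) (j - k) 0" for j k
    using laurent_entry[OF Lip_circle_laurent[OF assms], of j k]
    by (simp add: entry_q_derivative[OF assms])
qed

lemma is_q_derivative_add:
  "is_q_derivative q S D \<Longrightarrow> is_q_derivative q T E \<Longrightarrow> is_q_derivative q (S + T) (D + E)"
  by (simp add: is_q_derivative_def entry_add distrib_left
      complex_subspace_add[OF complex_subspace_bounded_ops])

lemma is_q_derivative_scaleC: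
  "is_q_derivative q T D \<Longrightarrow> is_q_derivative q (c *\<^sub>C T) (c *\<^sub>C D)"
  by (simp add: is_q_derivative_def entry_scaleC complex_subspace_scaleC[OF complex_subspace_bounded_ops])

lemma is_q_derivative_op_star:
  assumes "T \<in> bounded_ops" "is_q_derivative q T D"
  shows "is_q_derivative q (op_star T) (op_star D)"
  unfolding is_q_derivative_def
proof (intro conjI allI)
  show "op_star D \<in> bounded_ops"
    using assms by (simp add: is_q_derivative_def op_star_bounded_ops)
  fix j k
  have "q_int q (j - k) = - q_int q (k - j)" using q_int_minus[of q "k - j"] by simp
  then show "entry (op_star D) j k = \<i> * of_real (q_int q (j - k)) * entry (op_star T) j k"
    using assms by (simp add: is_q_derivative_def entry_op_star)
qed

lemma is_q_derivative_shift_pow: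
  "is_q_derivative q (shift_pow m) ((\<i> * of_real (q_int q m)) *\<^sub>C shift_pow m)"
  by (auto simp: is_q_derivative_def entry_scaleC entry_shift_pow
      complex_subspace_scaleC[OF complex_subspace_bounded_ops] shift_pow_bounded_ops)

lemma shift_pow_Lip_circle: "shift_pow m \<in> Lip_circle q"
  by (rule Lip_circleI[OF shift_pow_circle_algebra is_q_derivative_shift_pow])

lemma operator_system_Lip_circle: "operator_system (Lip_circle q)"
  unfolding operator_system_def
proof (intro conjI ballI)
  have sub: "complex_subspace circle_algebra"
    using cstar_subalgebra_circle_algebra by (simp add: cstar_subalgebra_def)
  show "Lip_circle q \<subseteq> bounded_ops"
    by (auto intro: laurent_bounded_ops Lip_circle_laurent)
  show "id_blinfun \<in> Lip_circle q"
    using shift_pow_Lip_circle[of 0] by (simp add: shift_pow_0)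
  have mem: "T \<in> Lip_circle q \<longleftrightarrow> T \<in> circle_algebra \<and> is_q_derivative q T (q_derivative q T)" for T
    using is_q_derivative_q_derivative Lip_circleI by (auto simp: Lip_circle_def)
  have add: "S + T \<in> Lip_circle q" if "S \<in> Lip_circle q" "T \<in> Lip_circle q" for S T
    using that by (auto simp: mem[of S] mem[of T]
        intro: Lip_circleI complex_subspace_add[OF sub] is_q_derivative_add)
  have scale: "c *\<^sub>C T \<in> Lip_circle q" if "T \<in> Lip_circle q" for c T
    using that by (auto simp: mem[of T]
        intro: Lip_circleI complex_subspace_scaleC[OF sub] is_q_derivative_scaleC)
  have "0 \<in> Lip_circle q"
    using scale[of id_blinfun 0] \<open>id_blinfun \<in> Lip_circle q\<close>
    by (metis norm_scaleC_blinfun norm_eq_zero mult_zero_left norm_zero)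
  then show "complex_subspace (Lip_circle q)"
    by (simp add: complex_subspace_def add scale)
  show "op_star T \<in> Lip_circle q" if "T \<in> Lip_circle q" for T
  proof (rule Lip_circleI)
    show "op_star T \<in> circle_algebra"
      using that cstar_subalgebra_circle_algebra by (simp add: cstar_subalgebra_def mem)
    show "is_q_derivative q (op_star T) (op_star (q_derivative q T))"
      using that laurent_bounded_ops[OF Lip_circle_laurent[OF that]]
      by (simp add: is_q_derivative_op_star mem)
  qed
qed

lemmas complex_subspace_Lip_circle =
  operator_system_Lip_circle[unfolded operator_system_def, THEN conjunct2, THEN conjunct1]

lemma slip_norm_L_circle: "slip_norm (Lip_circle q) (L_circle q)"
  unfolding slip_norm_def
proof (intro conjI ballI allI)
  show "L_circle q (S + T) \<le> L_circle q S + L_circle q T"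
    if "S \<in> Lip_circle q" "T \<in> Lip_circle q" for S T
    unfolding L_circle_def
    using q_derivative_eqI[OF is_q_derivative_add[OF that[THEN is_q_derivative_q_derivative]]]
    by (simp add: norm_triangle_ineq)
  show "L_circle q (c *\<^sub>C T) = cmod c * L_circle q T" if "T \<in> Lip_circle q" for c T
    unfolding L_circle_def
    using q_derivative_eqI[OF is_q_derivative_scaleC[OF that[THEN is_q_derivative_q_derivative]]]
    by (simp add: norm_scaleC_blinfun)
  show "L_circle q (op_star T) = L_circle q T" if "T \<in> Lip_circle q" for T
    unfolding L_circle_def
    using q_derivative_eqI[OF is_q_derivative_op_star[OF laurent_bounded_ops[OF Lip_circle_laurent[OF that]]
          is_q_derivative_q_derivative[OF that]]]
      norm_op_star[OF laurent_bounded_ops[OF laurent_q_derivative[OF that]]]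
    by simp
  have "is_q_derivative q id_blinfun 0"
    by (simp add: is_q_derivative_def zero_bounded_ops entry_id)
  then show "L_circle q id_blinfun = 0"
    by (simp add: L_circle_def q_derivative_eqI)
qed (simp add: L_circle_def)

section \<open>Fejer means and the q-derivative\<close>

lemma fejer_Lip_circle: "fejer N T \<in> Lip_circle q"
  unfolding fejer_def
  by (intro complex_subspace_sum[OF complex_subspace_Lip_circle]
      complex_subspace_scaleC[OF complex_subspace_Lip_circle] shift_pow_Lip_circle)

lemma fejer_1: "fejer 1 T = entry T 0 0 *\<^sub>C id_blinfun"
proof (rule laurent_ext[OF laurent_fejer])
  show "laurent (entry T 0 0 *\<^sub>C id_blinfun)"
    using complex_subspace_scaleC[OF complex_subspace_laurent] laurent_shift_pow[of 0]
    by (simp add: shift_pow_0)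
  show "entry (fejer 1 T) m 0 = entry (entry T 0 0 *\<^sub>C id_blinfun) m 0" for m
    by (simp add: entry_fejer entry_scaleC entry_id fejer_weight_def)
qed

text \<open>Since \<open>2 * max N k \<ge> N + k\<close>, the summands are dominated by those of the telescoping series
  of \<open>4 / ((N + k - 1) * (N + k))\<close>.\<close>

lemma sum_inverse_square_max_le:
  assumes N: "N > 0"
  shows "(\<Sum>k\<in>{1..M}. (1 / real (max N k))\<^sup>2) \<le> 4 / real N"
proof -
  have "(\<Sum>k\<in>{1..M}. (1 / real (max N k))\<^sup>2) \<le> 4 * (1 / real N - 1 / real (N + M))"
  proof (induction M)
    case (Suc M)
    let ?s = "real (N + Suc M)"
    have "(1 / real (max N (Suc M)))\<^sup>2 \<le> (2 / ?s)\<^sup>2"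
    proof (rule power_mono)
      have "?s \<le> 2 * real (max N (Suc M))" by (simp add: max_def)
      then show "1 / real (max N (Suc M)) \<le> 2 / ?s"
        using N by (simp add: field_simps)
    qed simp
    also have "\<dots> = 4 / (?s * ?s)" by (simp add: power2_eq_square)
    also have "\<dots> \<le> 4 / (real (N + M) * ?s)"
      using N by (intro divide_left_mono mult_right_mono mult_pos_pos) auto
    also have "\<dots> = 4 * (1 / real (N + M) - 1 / ?s)"
      using N by (simp add: field_simps)
    finally show ?case using Suc by simp
  qed simp
  also have "\<dots> \<le> 4 / real N" by simp
  finally show ?thesis .
qed

text \<open>The kernel \<open>k\<close> with \<open>T - fejer N T = k * d_q T\<close> has Fourier coefficients
  \<open>min 1 (\<bar>m\<bar> / N) / [m]_q\<close> up to a factor of modulus one, and these are at most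
  \<open>1 / max N \<bar>m\<bar>\<close> because \<open>\<bar>[m]_q\<bar> \<ge> \<bar>m\<bar>\<close>. This is what makes the rate of convergence of the
  Fejer means uniform in \<open>q\<close>.\<close>

lemma norm_diff_fejer_le:
  assumes q: "q \<in> {0<..1}" and T: "T \<in> Lip_circle q" and N: "N > 0"
  shows "norm (T - fejer N T) \<le> sqrt (8 / real N) * L_circle q T"
  unfolding L_circle_def
proof (rule laurent_norm_le_l2_multiplier)
  define c where "c m = (if m = 0 then 0 else 1 / real_of_int (max (int N) \<bar>m\<bar>))" for m :: int
  show "laurent (T - fejer N T)"
    using complex_subspace_diff[OF complex_subspace_laurent] Lip_circle_laurent[OF T] laurent_fejer
    by simp
  show "cmod (entry (T - fejer N T) m 0) \<le> c m * cmod (entry (q_derivative q T) m 0)" for m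
  proof -
    have "0 \<le> fejer_weight N m" "fejer_weight N m \<le> 1"
      by (auto simp: fejer_weight_def)
    moreover have "entry (T - fejer N T) m 0 = of_real (1 - fejer_weight N m) * entry T m 0"
      by (simp add: entry_diff entry_fejer[OF N] algebra_simps)
    ultimately have "cmod (entry (T - fejer N T) m 0) = (1 - fejer_weight N m) * cmod (entry T m 0)"
      by (simp add: norm_mult del: of_real_diff)
    also have "1 - fejer_weight N m = c m * \<bar>real_of_int m\<bar>"
      using N by (auto simp: fejer_weight_def c_def max_def field_simps)
    also have "c m * \<bar>real_of_int m\<bar> * cmod (entry T m 0) \<le> c m * \<bar>q_int q m\<bar> * cmod (entry T m 0)"
      using abs_q_int_ge[OF q] by (intro mult_right_mono mult_left_mono) (auto simp: c_def)
    also have "\<dots> = c m * cmod (entry (q_derivative q T) m 0)"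
      by (simp add: entry_q_derivative[OF T] norm_mult)
    finally show ?thesis .
  qed
  show "(\<Sum>m\<in>F. (c m)\<^sup>2) \<le> (sqrt (8 / real N))\<^sup>2" if F: "finite F" for F
  proof -
    obtain M where M: "F \<subseteq> {- int M..int M}"
    proof (rule that)
      have "\<bar>m\<bar> \<le> int (\<Sum>m\<in>F. nat \<bar>m\<bar>)" if "m \<in> F" for m
        using member_le_sum[OF that, of "\<lambda>m. nat \<bar>m\<bar>"] F by linarith
      then show "F \<subseteq> {- int (\<Sum>m\<in>F. nat \<bar>m\<bar>)..int (\<Sum>m\<in>F. nat \<bar>m\<bar>)}"
        by (force simp: abs_le_iff)
    qed
    have pos: "(\<Sum>m\<in>{1..int M}. (c m)\<^sup>2) = (\<Sum>k\<in>{1..M}. (1 / real (max N k))\<^sup>2)"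
      by (rule sum.reindex_bij_witness[where i = int and j = nat]) (auto simp: c_def max_def)
    have neg: "(\<Sum>m\<in>{- int M..-1}. (c m)\<^sup>2) = (\<Sum>k\<in>{1..M}. (1 / real (max N k))\<^sup>2)"
      by (rule sum.reindex_bij_witness[where i = "\<lambda>k. - int k" and j = "\<lambda>m. nat (- m)"])
        (auto simp: c_def max_def)
    have split: "{- int M..int M} = {- int M..-1} \<union> ({1..int M} \<union> {0})" by auto
    have "(\<Sum>m\<in>F. (c m)\<^sup>2) \<le> (\<Sum>m\<in>{- int M..int M}. (c m)\<^sup>2)"
      using M by (intro sum_mono2) auto
    also have "\<dots> = (\<Sum>m\<in>{- int M..-1}. (c m)\<^sup>2) + ((\<Sum>m\<in>{1..int M}. (c m)\<^sup>2) + (c 0)\<^sup>2)"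
      unfolding split by (subst sum.union_disjoint | simp)+
    also have "\<dots> \<le> 4 / real N + (4 / real N + 0)"
      unfolding pos neg
      by (intro add_mono sum_inverse_square_max_le[OF N]) (simp add: c_def)
    finally show ?thesis using N by simp
  qed
qed (use N in simp)

text \<open>Replacing \<open>[m]_q\<close> by \<open>[m]_r\<close> in the finitely many coefficients that survive in a Fejer mean
  perturbs its derivative by little.\<close>

lemma L_circle_fejer_le:
  assumes q: "q \<in> {0<..1}" and T: "T \<in> Lip_circle q" and N: "N > 0" and "0 \<le> \<eta>"
    and \<eta>: "\<And>m. \<bar>m\<bar> \<le> int N \<Longrightarrow> \<bar>q_int r m - q_int q m\<bar> \<le> \<eta>"
  shows "L_circle r (fejer N T) \<le> (1 + \<eta> * sqrt (2 * real N + 1)) * L_circle q T"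
proof -
  let ?D = "q_derivative q T" and ?E = "q_derivative r (fejer N T)"
  define c where "c m = (if \<bar>m\<bar> \<le> int N then \<eta> else 0)" for m
  have "norm (?E - fejer N ?D) \<le> (\<eta> * sqrt (2 * real N + 1)) * norm ?D"
  proof (rule laurent_norm_le_l2_multiplier)
    show "laurent (?E - fejer N ?D)"
      using complex_subspace_diff[OF complex_subspace_laurent] laurent_fejer
        laurent_q_derivative[OF fejer_Lip_circle] by simp
    show "cmod (entry (?E - fejer N ?D) m 0) \<le> c m * cmod (entry ?D m 0)" for m
    proof (cases "m = 0 \<or> \<bar>m\<bar> > int N")
      case True
      then have "entry (?E - fejer N ?D) m 0 = 0"
        using fejer_weight_eq_0[OF N, of m]
        by (auto simp: entry_diff entry_fejer[OF N] entry_q_derivative[OF fejer_Lip_circle]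
            entry_q_derivative[OF T])
      then show ?thesis using \<open>0 \<le> \<eta>\<close> by (simp add: c_def)
    next
      case False
      have w: "0 \<le> fejer_weight N m" "fejer_weight N m \<le> 1"
        by (auto simp: fejer_weight_def)
      have "entry (?E - fejer N ?D) m 0
          = \<i> * of_real (fejer_weight N m * (q_int r m - q_int q m)) * entry T m 0"
        by (simp add: entry_diff entry_fejer[OF N] entry_q_derivative[OF fejer_Lip_circle]
            entry_q_derivative[OF T] algebra_simps)
      then have "cmod (entry (?E - fejer N ?D) m 0)
          = (fejer_weight N m * \<bar>q_int r m - q_int q m\<bar>) * cmod (entry T m 0)"
        using w by (simp add: norm_mult abs_mult del: of_real_mult of_real_diff)
      also have "\<dots> \<le> (1 * \<eta>) * (\<bar>q_int q m\<bar> * cmod (entry T m 0))"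
      proof (intro mult_mono)
        have "1 \<le> \<bar>q_int q m\<bar>" using abs_q_int_ge[OF q, of m] False by linarith
        then show "cmod (entry T m 0) \<le> \<bar>q_int q m\<bar> * cmod (entry T m 0)"
          using mult_right_mono[of 1 "\<bar>q_int q m\<bar>" "cmod (entry T m 0)"] by simp
      qed (use w False \<eta>[of m] \<open>0 \<le> \<eta>\<close> in auto)
      also have "\<dots> = c m * cmod (entry ?D m 0)"
        using False by (simp add: c_def entry_q_derivative[OF T] norm_mult)
      finally show ?thesis .
    qed
    show "(\<Sum>m\<in>F. (c m)\<^sup>2) \<le> (\<eta> * sqrt (2 * real N + 1))\<^sup>2" if F: "finite F" for F
    proof -
      have "(\<Sum>m\<in>F. (c m)\<^sup>2) \<le> (\<Sum>m\<in>F \<union> {- int N..int N}. (c m)\<^sup>2)"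
        using F by (intro sum_mono2) auto
      also have "\<dots> = (\<Sum>m\<in>{- int N..int N}. (c m)\<^sup>2)"
        using F by (intro sum.mono_neutral_right) (auto simp: c_def abs_le_iff)
      also have "\<dots> = (\<Sum>m\<in>{- int N..int N}. \<eta>\<^sup>2)"
        by (rule sum.cong) (auto simp: c_def abs_le_iff)
      also have "\<dots> = (\<eta> * sqrt (2 * real N + 1))\<^sup>2"
        by (simp add: power_mult_distrib nat_add_distrib)
      finally show ?thesis .
    qed
  qed (use \<open>0 \<le> \<eta>\<close> in simp)
  moreover have "norm (fejer N ?D) \<le> norm ?D"
    by (rule norm_fejer_le[OF laurent_q_derivative[OF T] N])
  moreover have "norm ?E \<le> norm (?E - fejer N ?D) + norm (fejer N ?D)"
    using norm_triangle_ineq[of "?E - fejer N ?D" "fejer N ?D"] by simp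
  ultimately show ?thesis by (simp add: L_circle_def distrib_right)
qed

text \<open>For \<open>T\<close> of Lipschitz seminorm at most one, the two terms bound the distance of \<open>T\<close> from its
  Fejer mean and \<open>\<delta>\<close> times its distance from its mean value, which is the Fejer mean for \<open>N = 1\<close>.\<close>

definition fejer_error :: "nat \<Rightarrow> real \<Rightarrow> real"
  where "fejer_error N \<delta> = sqrt (8 / real N) + \<delta> * sqrt 8"

text \<open>A convex combination of the Fejer mean and the mean value, on which every Lipschitz seminorm
  vanishes, compensates for the factor \<open>1 + \<delta>\<close>. Exactness matters: the quotient seminorms of an
  admissible seminorm have to coincide with the given ones.\<close>

lemma Lip_circle_approximation:
  assumes q: "q \<in> {0<..1}" and T: "T \<in> Lip_circle q" and N: "N > 0" and "0 \<le> \<eta>"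
    and \<eta>: "\<And>m. \<bar>m\<bar> \<le> int N \<Longrightarrow> \<bar>q_int r m - q_int q m\<bar> \<le> \<eta>"
  shows "\<exists>S\<in>Lip_circle r. L_circle r S \<le> L_circle q T \<and>
    norm (T - S) \<le> fejer_error N (\<eta> * sqrt (2 * real N + 1)) * L_circle q T"
proof -
  define \<delta> where "\<delta> = \<eta> * sqrt (2 * real N + 1)"
  define a where "a = 1 / (1 + \<delta>)"
  define b where "b = \<delta> / (1 + \<delta>)"
  define S where "S = of_real a *\<^sub>C fejer N T + of_real b *\<^sub>C fejer 1 T"
  have \<delta>: "0 \<le> \<delta>" using \<open>0 \<le> \<eta>\<close> by (simp add: \<delta>_def)
  have ab: "0 \<le> a" "a \<le> 1" "0 \<le> b" "b \<le> \<delta>" "a + b = 1" "a * (1 + \<delta>) = 1"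
    using \<delta> by (auto simp: a_def b_def field_simps mult_nonneg_nonneg)
  note sub = complex_subspace_Lip_circle[of r]
  note slip = slip_norm_L_circle[of r, unfolded slip_norm_def]
  have mem: "of_real a *\<^sub>C fejer N T \<in> Lip_circle r" "of_real b *\<^sub>C fejer 1 T \<in> Lip_circle r"
    by (intro complex_subspace_scaleC[OF sub] fejer_Lip_circle)+
  have id: "id_blinfun \<in> Lip_circle r"
    using shift_pow_Lip_circle[of 0] by (simp add: shift_pow_0)
  have L0: "0 \<le> L_circle q T" by (simp add: L_circle_def)
  show ?thesis
  proof (intro bexI conjI)
    show "S \<in> Lip_circle r" unfolding S_def by (rule complex_subspace_add[OF sub mem])
    have "L_circle r (fejer 1 T) = 0"
      using slip id fejer_1[of T] by simp
    then have "L_circle r (of_real b *\<^sub>C fejer 1 T) = 0"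
      using slip fejer_Lip_circle by simp
    moreover have "L_circle r (of_real a *\<^sub>C fejer N T) = a * L_circle r (fejer N T)"
      using slip fejer_Lip_circle ab by simp
    ultimately have "L_circle r S \<le> a * L_circle r (fejer N T)"
      using slip mem unfolding S_def by fastforce
    also have "\<dots> \<le> a * ((1 + \<delta>) * L_circle q T)"
      unfolding \<delta>_def using ab by (intro mult_left_mono L_circle_fejer_le[OF q T N \<open>0 \<le> \<eta>\<close> \<eta>])
    finally show "L_circle r S \<le> L_circle q T" using ab by (simp add: mult.assoc[symmetric])
    have "T = a *\<^sub>R T + b *\<^sub>R T" using ab by (simp add: scaleR_add_left[symmetric])
    then have "T - S = a *\<^sub>R (T - fejer N T) + b *\<^sub>R (T - fejer 1 T)"
      unfolding S_def scaleC_blinfun_of_real by (simp add: scaleR_diff_right)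
    then have "norm (T - S) \<le> a * norm (T - fejer N T) + b * norm (T - fejer 1 T)"
      using norm_triangle_ineq[of "a *\<^sub>R (T - fejer N T)" "b *\<^sub>R (T - fejer 1 T)"] ab by simp
    also have "\<dots> \<le> 1 * (sqrt (8 / real N) * L_circle q T) + \<delta> * (sqrt (8 / real 1) * L_circle q T)"
      using ab L0 \<delta> N by (intro add_mono mult_mono norm_diff_fejer_le[OF q T]) auto
    finally show "norm (T - S) \<le> fejer_error N (\<eta> * sqrt (2 * real N + 1)) * L_circle q T"
      by (simp add: fejer_error_def \<delta>_def algebra_simps)
  qed
qed

section \<open>Contractivity of states and of unital completely positive maps\<close>

text \<open>Both for states and for completely positive maps, contractivity comes from the positivity of
  a family of numbers indexed by the unit circle. The rotations \<open>1\<close> and \<open>\<i>\<close> force \<open>\<beta> = cnj \<alpha>\<close>, and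
  the rotation that moves \<open>\<alpha>\<close> to the negative half-line gives the estimate.\<close>

lemma cmod_le_if_rotations_nonneg:
  assumes "\<And>\<zeta>. cmod \<zeta> = 1 \<Longrightarrow> 2 * of_real r + \<zeta> * \<alpha> + cnj \<zeta> * \<beta> \<in> (\<real>\<^sub>\<ge>\<^sub>0 :: complex set)"
  shows "cmod \<alpha> \<le> r"
proof -
  have "\<beta> = cnj \<alpha>"
    using assms[of 1] assms[of \<i>] by (simp add: complex_nonneg_Reals_iff complex_eq_iff)
  show ?thesis
  proof (cases "\<alpha> = 0")
    case True
    then show ?thesis using assms[of 1] \<open>\<beta> = cnj \<alpha>\<close> by (simp add: complex_nonneg_Reals_iff)
  next
    case False
    define \<zeta> where "\<zeta> = - cnj \<alpha> / of_real (cmod \<alpha>)"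
    have "\<zeta> * \<alpha> = - of_real (cmod \<alpha>)"
      using False complex_norm_square[of \<alpha>]
      by (simp add: \<zeta>_def power2_eq_square divide_eq_eq mult.commute)
    moreover from this have "cnj \<zeta> * \<beta> = - of_real (cmod \<alpha>)"
      unfolding \<open>\<beta> = cnj \<alpha>\<close> by (metis complex_cnj_complex_of_real complex_cnj_minus complex_cnj_mult)
    moreover have "cmod \<zeta> = 1" using False by (simp add: \<zeta>_def norm_divide)
    ultimately have "2 * of_real r - 2 * of_real (cmod \<alpha>) \<in> (\<real>\<^sub>\<ge>\<^sub>0 :: complex set)"
      using assms[of \<zeta>] by (simp add: algebra_simps)
    then show ?thesis by (simp add: complex_nonneg_Reals_iff)
  qed
qed

text \<open>As a definite description, \<open>op_star T\<close> is the adjoint of \<open>T\<close> only where an adjoint exists.\<close>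

definition has_adjoints :: "('h::chilbert_space \<Rightarrow>\<^sub>L 'h) set \<Rightarrow> bool"
  where "has_adjoints X \<longleftrightarrow>
    (\<forall>T\<in>X. \<forall>x y. cinner (blinfun_apply (op_star T) x) y = cinner x (blinfun_apply T y))"

lemma operator_systemD:
  assumes "operator_system X"
  shows "X \<subseteq> bounded_ops" "complex_subspace X" "T \<in> X \<Longrightarrow> op_star T \<in> X" "id_blinfun \<in> X"
  using assms by (auto simp: operator_system_def)

text \<open>For \<open>\<bar>\<zeta>\<bar> = 1\<close> the operator \<open>2 * norm T + \<zeta> T + (\<zeta> T)*\<close> is positive.\<close>

lemma state_le_norm:
  assumes X: "operator_system X" "has_adjoints X" and \<phi>: "\<phi> \<in> states X" and T: "T \<in> X"
  shows "cmod (\<phi> T) \<le> norm T"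
proof (rule cmod_le_if_rotations_nonneg)
  fix \<zeta> :: complex assume \<zeta>: "cmod \<zeta> = 1"
  define S where "S = of_real (2 * norm T) *\<^sub>C id_blinfun + \<zeta> *\<^sub>C T + cnj \<zeta> *\<^sub>C op_star T"
  note sub = operator_systemD(2)[OF X(1)]
  have mem: "of_real (2 * norm T) *\<^sub>C id_blinfun \<in> X" "\<zeta> *\<^sub>C T \<in> X" "cnj \<zeta> *\<^sub>C op_star T \<in> X"
    using operator_systemD[OF X(1)] T by (auto intro: complex_subspace_scaleC)
  have S: "S \<in> X" unfolding S_def by (intro complex_subspace_add[OF sub] mem)
  have "positive_op S"
    unfolding positive_op_def
  proof
    fix v
    have "cinner v (op_star T v) = cnj (cinner v (T v))"
      using X(2) T by (metis cinner_commute has_adjoints_def)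
    then have "cinner v (S v) = of_real (2 * norm T * (norm v)\<^sup>2)
        + (\<zeta> * cinner v (T v) + cnj (\<zeta> * cinner v (T v)))"
      by (simp add: S_def blinfun.add_left scaleC_blinfun.rep_eq cinner_add_right
          cinner_scaleC_right cinner_self)
    also have "\<dots> = of_real (2 * (norm T * (norm v)\<^sup>2 + Re (\<zeta> * cinner v (T v))))"
      unfolding complex_add_cnj by simp
    also have "\<dots> \<in> \<real>\<^sub>\<ge>\<^sub>0"
    proof -
      have "\<bar>Re (\<zeta> * cinner v (T v))\<bar> \<le> cmod (\<zeta> * cinner v (T v))" by (rule abs_Re_le_cmod)
      also have "\<dots> \<le> norm v * (norm T * norm v)"
        using order_trans[OF cmod_cinner_le mult_left_mono[OF norm_blinfun]] \<zeta>
        by (simp add: norm_mult)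
      finally have "- Re (\<zeta> * cinner v (T v)) \<le> norm T * (norm v)\<^sup>2"
        by (simp add: power2_eq_square mult_ac)
      then show ?thesis unfolding nonneg_Reals_of_real_iff by simp
    qed
    finally show "cinner v (S v) \<in> \<real>\<^sub>\<ge>\<^sub>0" .
  qed
  then have "\<phi> S \<in> \<real>\<^sub>\<ge>\<^sub>0" using \<phi> S by (simp add: states_def)
  moreover have "\<phi> S = of_real (2 * norm T) * \<phi> id_blinfun + \<zeta> * \<phi> T + cnj \<zeta> * \<phi> (op_star T)"
    using \<phi> mem sub T operator_systemD[OF X(1)]
    unfolding S_def states_def by (simp add: complex_subspace_add)
  ultimately show "2 * of_real (norm T) + \<zeta> * \<phi> T + cnj \<zeta> * \<phi> (op_star T) \<in> \<real>\<^sub>\<ge>\<^sub>0"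
    using \<phi> by (simp add: states_def)
qed

lemma cscalar_prod_eq_sum:
  assumes "v \<in> carrier_vec n" "w \<in> carrier_vec n"
  shows "v \<bullet>c w = (\<Sum>i<n. vec_index v i * cnj (vec_index w i))"
  using assms by (auto simp: scalar_prod_def conjugate_complex_def atLeast0LessThan intro!: sum.cong)

lemma cscalar_prod_self:
  assumes "v \<in> carrier_vec n"
  shows "v \<bullet>c v = of_real ((cvec_norm v)\<^sup>2)"
proof -
  have "(cvec_norm v)\<^sup>2 = (\<Sum>i<n. (cmod (vec_index v i))\<^sup>2)"
    using assms by (simp add: cvec_norm_def sum_nonneg)
  then show ?thesis
    using assms by (simp add: cscalar_prod_eq_sum complex_norm_square[symmetric])
qed

lemma cscalar_prod_smult:
  assumes "v \<in> carrier_vec n" "w \<in> carrier_vec n"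
  shows "(c \<cdot>\<^sub>v v) \<bullet>c w = c * (v \<bullet>c w)" "v \<bullet>c (c \<cdot>\<^sub>v w) = cnj c * (v \<bullet>c w)"
  using assms
  by (auto simp: cscalar_prod_eq_sum[where n = n] sum_distrib_left intro!: sum.cong)

lemma scalar_mat_mult_vec:
  fixes v :: "complex Matrix.vec"
  assumes "v \<in> carrier_vec n"
  shows "(c \<cdot>\<^sub>m 1\<^sub>m n) *\<^sub>v v = c \<cdot>\<^sub>v v"
  using assms by (intro eq_vecI) (auto simp: smult_scalar_prod_distrib[where n = n])

lemma mat_norm_leI:
  assumes A: "A \<in> carrier_mat n n"
    and le: "\<And>v. v \<in> carrier_vec n \<Longrightarrow> cvec_norm v \<le> 1 \<Longrightarrow> cvec_norm (A *\<^sub>v v) \<le> r"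
  shows "mat_norm A \<le> r"
  unfolding mat_norm_def
proof (rule cSUP_least)
  have "0\<^sub>v n \<in> {v \<in> carrier_vec (dim_col A). cvec_norm v \<le> 1}"
    using A by (simp add: cvec_norm_def)
  then show "{v \<in> carrier_vec (dim_col A). cvec_norm v \<le> 1} \<noteq> {}" by blast
qed (use assms in auto)

text \<open>The operator matrix with rows \<open>(r, T)\<close> and \<open>(T*, r)\<close> is positive for \<open>r = norm T\<close>, and
  contractivity of a completely positive map is read off from the positivity of its image.\<close>

lemma ucp_le_norm:
  assumes X: "operator_system X" "has_adjoints X" and \<phi>: "\<phi> \<in> ucp_maps n X" and T: "T \<in> X"
  shows "mat_norm (\<phi> T) \<le> norm T"
proof (rule mat_norm_leI)
  define r where "r = norm T"
  define M where "M i j = (if i = j then of_real r *\<^sub>C id_blinfun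
      else if i < j then T else op_star T)" for i j :: nat
  note sub = operator_systemD(2)[OF X(1)]
  have carrier: "\<phi> S \<in> carrier_mat n n" if "S \<in> X" for S
    using \<phi> that by (auto simp: ucp_maps_def)
  show "\<phi> T \<in> carrier_mat n n" by (rule carrier[OF T])
  have star: "op_star T \<in> X" and id: "id_blinfun \<in> X"
    using operator_systemD[OF X(1)] T by auto
  have M: "M i j \<in> X" for i j :: nat
    using operator_systemD[OF X(1)] T by (auto simp: M_def intro: complex_subspace_scaleC)
  have "positive_op_matrix 2 M"
    unfolding positive_op_matrix_def
  proof
    fix v :: "nat \<Rightarrow> 'a"
    have "cinner (v 1) (op_star T (v 0)) = cnj (cinner (v 0) (T (v 1)))"
      using X(2) T by (metis cinner_commute has_adjoints_def)
    then have "(\<Sum>i<2. \<Sum>j<2. cinner (v i) (M i j (v j)))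
        = of_real (r * (norm (v 0))\<^sup>2 + r * (norm (v 1))\<^sup>2)
          + (cinner (v 0) (T (v 1)) + cnj (cinner (v 0) (T (v 1))))"
      by (simp add: M_def numeral_2_eq_2 scaleC_blinfun.rep_eq cinner_scaleC_right cinner_self)
    also have "\<dots> = of_real (r * (norm (v 0))\<^sup>2 + r * (norm (v 1))\<^sup>2 + 2 * Re (cinner (v 0) (T (v 1))))"
      unfolding complex_add_cnj by simp
    also have "\<dots> \<in> \<real>\<^sub>\<ge>\<^sub>0"
    proof -
      have "\<bar>Re (cinner (v 0) (T (v 1)))\<bar> \<le> cmod (cinner (v 0) (T (v 1)))" by (rule abs_Re_le_cmod)
      also have "\<dots> \<le> norm (v 0) * (r * norm (v 1))"
        unfolding r_def by (rule order_trans[OF cmod_cinner_le mult_left_mono[OF norm_blinfun]]) simp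
      also have "2 * \<dots> = r * (2 * norm (v 0) * norm (v 1))" by simp
      also have "\<dots> \<le> r * ((norm (v 0))\<^sup>2 + (norm (v 1))\<^sup>2)"
        by (rule mult_left_mono[OF sum_squares_bound]) (simp add: r_def)
      finally have "- (2 * Re (cinner (v 0) (T (v 1)))) \<le> r * ((norm (v 0))\<^sup>2 + (norm (v 1))\<^sup>2)"
        by simp
      then show ?thesis unfolding nonneg_Reals_of_real_iff by (simp add: distrib_left)
    qed
    finally show "(\<Sum>i<2. \<Sum>j<2. cinner (v i) (M i j (v j))) \<in> \<real>\<^sub>\<ge>\<^sub>0" .
  qed
  then have block: "positive_block_matrix 2 n (\<lambda>i j. \<phi> (M i j))"
    using \<phi> M unfolding ucp_maps_def by blast
  fix w :: "complex Matrix.vec" assume w: "w \<in> carrier_vec n" "cvec_norm w \<le> 1"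
  define b where "b = \<phi> T *\<^sub>v w"
  have b: "b \<in> carrier_vec n" using carrier[OF T] w by (simp add: b_def)
  have cvec_nonneg: "0 \<le> cvec_norm x" for x by (simp add: cvec_norm_def sum_nonneg)
  have "cvec_norm b \<le> r"
  proof (cases "cvec_norm b = 0")
    case False
    then have pos: "0 < cvec_norm b" using cvec_nonneg[of b] by simp
    define u where "u = of_real (1 / cvec_norm b) \<cdot>\<^sub>v b"
    define \<alpha> where "\<alpha> = b \<bullet>c u"
    define \<beta> where "\<beta> = (\<phi> (op_star T) *\<^sub>v u) \<bullet>c w"
    have u: "u \<in> carrier_vec n" using b by (simp add: u_def)
    have uu: "u \<bullet>c u = 1"
      using pos by (simp add: u_def cscalar_prod_smult[OF b] cscalar_prod_smult[OF _ b] b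
          cscalar_prod_self[OF b] power2_eq_square)
    have \<alpha>: "\<alpha> = of_real (cvec_norm b)"
      using pos by (simp add: \<alpha>_def u_def cscalar_prod_smult[OF b b] cscalar_prod_self[OF b]
          power2_eq_square)
    have "cmod \<alpha> \<le> r"
    proof (rule cmod_le_if_rotations_nonneg)
      fix \<zeta> :: complex assume \<zeta>: "cmod \<zeta> = 1"
      define v where "v i = (if i = 0 then cnj \<zeta> \<cdot>\<^sub>v u else w)" for i :: nat
      have v: "v i \<in> carrier_vec n" for i using u w by (simp add: v_def)
      have \<phi>r: "\<phi> (of_real r *\<^sub>C id_blinfun) = of_real r \<cdot>\<^sub>m 1\<^sub>m n"
        using \<phi> id by (simp add: ucp_maps_def)
      have diag: "(\<phi> (of_real r *\<^sub>C id_blinfun) *\<^sub>v x) \<bullet>c x = of_real r * (x \<bullet>c x)"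
        if "x \<in> carrier_vec n" for x
        unfolding \<phi>r using that by (simp add: scalar_mat_mult_vec cscalar_prod_smult)
      have vv: "v 0 \<bullet>c v 0 = 1"
        using \<zeta> uu complex_norm_square[of \<zeta>]
        by (simp add: v_def cscalar_prod_smult[OF u] cscalar_prod_smult[OF _ u] u mult.commute)
      have "(\<Sum>i<2. \<Sum>j<2. (\<phi> (M i j) *\<^sub>v v j) \<bullet>c v i) \<in> \<real>\<^sub>\<ge>\<^sub>0"
        using block v unfolding positive_block_matrix_def by blast
      also have "(\<Sum>i<2. \<Sum>j<2. (\<phi> (M i j) *\<^sub>v v j) \<bullet>c v i)
          = of_real r * (v 0 \<bullet>c v 0) + (\<phi> T *\<^sub>v v 1) \<bullet>c v 0
            + (\<phi> (op_star T) *\<^sub>v v 0) \<bullet>c v 1 + of_real r * (v 1 \<bullet>c v 1)"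
        using diag[OF v] by (simp add: numeral_2_eq_2 M_def)
      also have "(\<phi> T *\<^sub>v v 1) \<bullet>c v 0 = \<zeta> * \<alpha>"
        using cscalar_prod_smult(2)[OF b u] by (simp add: v_def \<alpha>_def b_def[symmetric])
      also have "(\<phi> (op_star T) *\<^sub>v v 0) \<bullet>c v 1 = cnj \<zeta> * \<beta>"
        using carrier[OF star] u w
        by (simp add: v_def \<beta>_def mult_mat_vec cscalar_prod_smult[of _ n])
      finally have *: "of_real r * 1 + \<zeta> * \<alpha> + cnj \<zeta> * \<beta> + of_real (r * (cvec_norm w)\<^sup>2) \<in> \<real>\<^sub>\<ge>\<^sub>0"
        unfolding vv using w by (simp add: v_def cscalar_prod_self)
      have "r * (cvec_norm w)\<^sup>2 \<le> r * 1"
        using w cvec_nonneg[of w]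
        by (intro mult_left_mono power_le_one) (auto simp: r_def)
      with * show "2 * of_real r + \<zeta> * \<alpha> + cnj \<zeta> * \<beta> \<in> \<real>\<^sub>\<ge>\<^sub>0"
        by (simp add: complex_nonneg_Reals_iff)
    qed
    then show ?thesis using pos by (simp add: \<alpha>)
  qed (simp add: r_def)
  then show "cvec_norm (\<phi> T *\<^sub>v w) \<le> norm T" by (simp add: b_def r_def)
qed

section \<open>A criterion for compact quantum metric spaces\<close>

lemma state_sum:
  assumes "operator_system X" "\<phi> \<in> states X" "\<And>i. i \<in> I \<Longrightarrow> b i \<in> X" "finite I"
  shows "\<phi> (\<Sum>i\<in>I. g i *\<^sub>C b i) = (\<Sum>i\<in>I. g i * \<phi> (b i))"
  using assms(4,3)
proof (induction I)
  case empty
  have "0 = 0 *\<^sub>C (id_blinfun :: 'a \<Rightarrow>\<^sub>L 'a)"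
    by (simp add: blinfun_eq_iff scaleC_blinfun.rep_eq)
  then have "\<phi> 0 = 0 * \<phi> id_blinfun"
    using assms(1,2) by (metis (mono_tags, lifting) mem_Collect_eq operator_systemD(4) states_def)
  then show ?case by simp
next
  case (insert i I)
  note sub = operator_systemD(2)[OF assms(1)]
  have "(\<Sum>i\<in>I. g i *\<^sub>C b i) \<in> X" "g i *\<^sub>C b i \<in> X"
    using insert.prems by (auto intro: complex_subspace_sum[OF sub] complex_subspace_scaleC[OF sub])
  then show ?case
    using insert assms(2) by (simp add: states_def)
qed

text \<open>Rieffel's criterion: the metric of a slip-norm induces the weak-* topology as soon as the
  Lipschitz ball is totally bounded modulo scalars. Total boundedness is used in the form that
  the ball lies, modulo scalars and up to \<open>\<delta>\<close>, in a bounded subset of a finite-dimensional space.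
  The values of two states on a spanning family of that space then control their distance.\<close>

lemma compact_quantum_metric_spaceI:
  fixes X :: "('h::chilbert_space \<Rightarrow>\<^sub>L 'h) set"
  assumes X: "operator_system X" "has_adjoints X" and slip: "slip_norm X L"
    and tb: "\<And>\<delta>. \<delta> > 0 \<Longrightarrow> \<exists>(I :: 'i set) b K. finite I \<and> b ` I \<subseteq> X \<and>
      (\<forall>a\<in>X. L a \<le> 1 \<longrightarrow> (\<exists>c g. (\<forall>i\<in>I. cmod (g i) \<le> K) \<and>
        norm (a - (c *\<^sub>C id_blinfun + (\<Sum>i\<in>I. g i *\<^sub>C b i))) \<le> \<delta>))"
  shows "compact_quantum_metric_space X L"
proof -
  note sub = operator_systemD(2)[OF X(1)]
  have id: "id_blinfun \<in> X" by (rule operator_systemD(4)[OF X(1)])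
  have st_add: "\<phi> (x + y) = \<phi> x + \<phi> y" if "\<phi> \<in> states X" "x \<in> X" "y \<in> X" for \<phi> x y
    using that by (simp add: states_def)
  have st_scale: "\<phi> (c *\<^sub>C x) = c * \<phi> x" if "\<phi> \<in> states X" "x \<in> X" for \<phi> c x
    using that by (simp add: states_def)
  have st_id: "\<phi> id_blinfun = 1" if "\<phi> \<in> states X" for \<phi>
    using that by (simp add: states_def)
  have key: "\<exists>(I :: 'i set) b K. finite I \<and> b ` I \<subseteq> X \<and> 0 \<le> K \<and>
      (\<forall>\<phi>\<in>states X. \<forall>\<psi>\<in>states X. \<forall>a\<in>X. L a \<le> 1 \<longrightarrow>
        cmod (\<phi> a - \<psi> a) \<le> 2 * \<delta> + K * (\<Sum>i\<in>I. cmod (\<phi> (b i) - \<psi> (b i))))"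
    if \<delta>: "\<delta> > 0" for \<delta>
  proof -
    obtain I :: "'i set" and b K where I: "finite I" "b ` I \<subseteq> X"
      and approx: "\<forall>a\<in>X. L a \<le> 1 \<longrightarrow> (\<exists>c g. (\<forall>i\<in>I. cmod (g i) \<le> K) \<and>
        norm (a - (c *\<^sub>C id_blinfun + (\<Sum>i\<in>I. g i *\<^sub>C b i))) \<le> \<delta>)"
      using tb[OF \<delta>] by (elim exE conjE) (rule that)
    have "cmod (\<phi> a - \<psi> a) \<le> 2 * \<delta> + \<bar>K\<bar> * (\<Sum>i\<in>I. cmod (\<phi> (b i) - \<psi> (b i)))"
      if st: "\<phi> \<in> states X" "\<psi> \<in> states X" and a: "a \<in> X" "L a \<le> 1" for \<phi> \<psi> a
    proof -
      obtain c g where g: "\<forall>i\<in>I. cmod (g i) \<le> K"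
        and le: "norm (a - (c *\<^sub>C id_blinfun + (\<Sum>i\<in>I. g i *\<^sub>C b i))) \<le> \<delta>"
        using approx[rule_format, OF a] by (elim exE conjE) (rule that)
      define s where "s = c *\<^sub>C id_blinfun + (\<Sum>i\<in>I. g i *\<^sub>C b i)"
      define e where "e = a - s"
      have mem: "c *\<^sub>C id_blinfun \<in> X" "(\<Sum>i\<in>I. g i *\<^sub>C b i) \<in> X"
        using I id by (auto intro!: complex_subspace_sum[OF sub] complex_subspace_scaleC[OF sub])
      have s: "s \<in> X" unfolding s_def by (intro complex_subspace_add[OF sub] mem)
      have e: "e \<in> X" unfolding e_def by (intro complex_subspace_diff[OF sub] a s)
      have val: "\<omega> a = \<omega> e + (c + (\<Sum>i\<in>I. g i * \<omega> (b i)))" if "\<omega> \<in> states X" for \<omega>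
      proof -
        have "\<omega> a = \<omega> (e + s)" by (simp add: e_def)
        also have "\<dots> = \<omega> e + (\<omega> (c *\<^sub>C id_blinfun) + \<omega> (\<Sum>i\<in>I. g i *\<^sub>C b i))"
          using st_add[OF that e s] st_add[OF that mem] by (simp add: s_def)
        also have "\<omega> (\<Sum>i\<in>I. g i *\<^sub>C b i) = (\<Sum>i\<in>I. g i * \<omega> (b i))"
          by (rule state_sum[OF X(1) that]) (use I in auto)
        finally show ?thesis by (simp add: st_scale[OF that id] st_id[OF that])
      qed
      have "\<phi> a - \<psi> a = (\<phi> e - \<psi> e) + (\<Sum>i\<in>I. g i * (\<phi> (b i) - \<psi> (b i)))"
        unfolding val[OF st(1)] val[OF st(2)]
        by (simp add: right_diff_distrib sum_subtractf)
      also have "cmod \<dots> \<le> (cmod (\<phi> e) + cmod (\<psi> e)) + (\<Sum>i\<in>I. cmod (g i * (\<phi> (b i) - \<psi> (b i))))"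
        by (intro norm_triangle_le add_mono norm_triangle_ineq4 norm_sum)
      also have "\<dots> \<le> (\<delta> + \<delta>) + (\<Sum>i\<in>I. \<bar>K\<bar> * cmod (\<phi> (b i) - \<psi> (b i)))"
      proof (intro add_mono sum_mono)
        show "cmod (\<phi> e) \<le> \<delta>" "cmod (\<psi> e) \<le> \<delta>"
          using state_le_norm[OF X st(1) e] state_le_norm[OF X st(2) e] le
          by (simp_all add: e_def s_def)
        show "cmod (g i * (\<phi> (b i) - \<psi> (b i))) \<le> \<bar>K\<bar> * cmod (\<phi> (b i) - \<psi> (b i))" if "i \<in> I" for i
          using g[rule_format, OF that] by (auto simp: norm_mult intro!: mult_right_mono)
      qed
      finally show ?thesis by (simp add: sum_distrib_left)
    qed
    with I show ?thesis by (intro exI[of _ I] exI[of _ b] exI[of _ "\<bar>K\<bar>"]) auto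
  qed
  have finite: "state_dist X L \<phi> \<psi> < \<infinity>" if st: "\<phi> \<in> states X" "\<psi> \<in> states X" for \<phi> \<psi>
  proof -
    obtain I :: "'i set" and b K where
      le: "\<forall>\<phi>\<in>states X. \<forall>\<psi>\<in>states X. \<forall>a\<in>X. L a \<le> 1 \<longrightarrow>
        cmod (\<phi> a - \<psi> a) \<le> 2 * 1 + K * (\<Sum>i\<in>I. cmod (\<phi> (b i) - \<psi> (b i)))"
    proof -
      have "(0::real) < 1" by simp
      from key[OF this] show thesis by (elim exE conjE) (rule that)
    qed
    have "state_dist X L \<phi> \<psi> \<le> ennreal (2 * 1 + K * (\<Sum>i\<in>I. cmod (\<phi> (b i) - \<psi> (b i))))"
      unfolding state_dist_def
      by (rule SUP_least, rule ennreal_leI, rule le[rule_format, OF st]) auto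
    also have "\<dots> < \<infinity>" by simp
    finally show ?thesis .
  qed
  define d where "d = (\<lambda>\<phi> \<psi>. enn2real (state_dist X L \<phi> \<psi>))"
  have d_ge: "cmod (\<phi> a - \<psi> a) \<le> d \<phi> \<psi>"
    if st: "\<phi> \<in> states X" "\<psi> \<in> states X" and a: "a \<in> X" "L a \<le> 1" for \<phi> \<psi> a
  proof -
    have "ennreal (cmod (\<phi> a - \<psi> a)) \<le> state_dist X L \<phi> \<psi>"
      unfolding state_dist_def by (rule SUP_upper) (use a in auto)
    then show ?thesis
      using finite[OF st] by (simp add: d_def ennreal_le_iff[symmetric] ennreal_enn2real_if
          less_top del: ennreal_le_iff)
  qed
  have d_le: "d \<phi> \<psi> \<le> r" if "0 \<le> r" "\<And>a. a \<in> X \<Longrightarrow> L a \<le> 1 \<Longrightarrow> cmod (\<phi> a - \<psi> a) \<le> r" for \<phi> \<psi> r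
    unfolding d_def state_dist_def
    by (rule enn2real_leI[OF \<open>0 \<le> r\<close>], rule SUP_least) (auto intro!: ennreal_leI that(2))
  have eval_le: "cmod (\<phi> a - \<psi> a) \<le> (L a + 1) * d \<phi> \<psi>"
    if st: "\<phi> \<in> states X" "\<psi> \<in> states X" and a: "a \<in> X" for \<phi> \<psi> a
  proof -
    define t where "t = 1 / (L a + 1)"
    have L0: "0 \<le> L a" using slip a by (simp add: slip_norm_def)
    then have t: "0 < t" "t * L a \<le> 1" "t * (L a + 1) = 1" by (auto simp: t_def field_simps)
    have mem: "of_real t *\<^sub>C a \<in> X" by (rule complex_subspace_scaleC[OF sub a])
    have "L (of_real t *\<^sub>C a) \<le> 1" using slip a t by (simp add: slip_norm_def)
    from d_ge[OF st mem this] have "t * cmod (\<phi> a - \<psi> a) \<le> d \<phi> \<psi>"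
      using t by (simp add: st_scale[OF st(1) a] st_scale[OF st(2) a] norm_mult
          flip: right_diff_distrib)
    then have "(L a + 1) * (t * cmod (\<phi> a - \<psi> a)) \<le> (L a + 1) * d \<phi> \<psi>"
      using L0 by (intro mult_left_mono) auto
    then show ?thesis using t by (simp add: mult.assoc[symmetric] mult.commute[of "L a + 1" t])
  qed
  have ext: "\<phi> \<in> extensional X" if "\<phi> \<in> states X" for \<phi>
    using that by (simp add: states_def)
  interpret M: Metric_space "states X" d
  proof
    show "0 \<le> d \<phi> \<psi>" for \<phi> \<psi> by (simp add: d_def)
    show "d \<phi> \<psi> = d \<psi> \<phi>" for \<phi> \<psi>
      by (simp add: d_def state_dist_def norm_minus_commute)
    show "d \<phi> \<psi> = 0 \<longleftrightarrow> \<phi> = \<psi>" if st: "\<phi> \<in> states X" "\<psi> \<in> states X" for \<phi> \<psi>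
    proof
      assume "d \<phi> \<psi> = 0"
      then have "\<phi> a = \<psi> a" if "a \<in> X" for a
        using eval_le[OF st that] by simp
      then show "\<phi> = \<psi>" by (intro extensionalityI[OF ext ext] st)
    next
      assume "\<phi> = \<psi>"
      then have "d \<phi> \<psi> \<le> 0" by (intro d_le) auto
      then show "d \<phi> \<psi> = 0" by (intro antisym) (simp_all add: d_def)
    qed
    show "d \<phi> \<omega> \<le> d \<phi> \<psi> + d \<psi> \<omega>"
      if st: "\<phi> \<in> states X" "\<psi> \<in> states X" "\<omega> \<in> states X" for \<phi> \<psi> \<omega>
    proof (rule d_le)
      show "0 \<le> d \<phi> \<psi> + d \<psi> \<omega>" by (simp add: d_def)
      fix a assume a: "a \<in> X" "L a \<le> 1"
      have "cmod (\<phi> a - \<omega> a) \<le> cmod (\<phi> a - \<psi> a) + cmod (\<psi> a - \<omega> a)"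
        using norm_triangle_ineq[of "\<phi> a - \<psi> a" "\<psi> a - \<omega> a"] by simp
      then show "cmod (\<phi> a - \<omega> a) \<le> d \<phi> \<psi> + d \<psi> \<omega>"
        using d_ge[OF st(1,2) a] d_ge[OF st(2,3) a] by linarith
    qed
  qed
  have top_ws: "topspace (weak_star_topology X) = states X"
    by (auto simp: weak_star_topology_def topspace_product_topology_alt extensional_arb[OF ext])
  have ws_eval: "continuous_map (weak_star_topology X) euclidean (\<lambda>\<phi>. \<phi> a)" if "a \<in> X" for a
    unfolding weak_star_topology_def
    by (rule continuous_map_from_subtopology[OF continuous_map_product_projection[OF that]])
  have M_eval: "continuous_map M.mtopology euclidean (\<lambda>\<phi>. \<phi> a)" if a: "a \<in> X" for a
    unfolding continuous_map_def
  proof (intro conjI allI impI)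
    fix V :: "complex set" assume "openin euclidean V"
    then have V: "open V" by simp
    show "openin M.mtopology {\<phi> \<in> topspace M.mtopology. \<phi> a \<in> V}"
      unfolding M.openin_mtopology M.topspace_mtopology
    proof (intro conjI allI impI)
      fix \<phi> assume \<phi>: "\<phi> \<in> {\<phi> \<in> states X. \<phi> a \<in> V}"
      then obtain \<epsilon> where \<epsilon>: "\<epsilon> > 0" "ball (\<phi> a) \<epsilon> \<subseteq> V"
        using V by (auto simp: open_contains_ball)
      have L0: "0 \<le> L a" using slip a by (simp add: slip_norm_def)
      have "M.mball \<phi> (\<epsilon> / (L a + 1)) \<subseteq> {\<phi> \<in> states X. \<phi> a \<in> V}"
      proof
        fix \<psi> assume "\<psi> \<in> M.mball \<phi> (\<epsilon> / (L a + 1))"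
        then have \<psi>: "\<psi> \<in> states X" "d \<phi> \<psi> < \<epsilon> / (L a + 1)" by auto
        have "cmod (\<phi> a - \<psi> a) \<le> (L a + 1) * d \<phi> \<psi>" using \<phi> \<psi> a by (intro eval_le) auto
        also have "\<dots> < \<epsilon>" using \<psi>(2) L0 by (simp add: pos_less_divide_eq mult.commute)
        finally have "\<psi> a \<in> ball (\<phi> a) \<epsilon>" by (simp add: dist_norm)
        then show "\<psi> \<in> {\<phi> \<in> states X. \<phi> a \<in> V}" using \<psi> \<epsilon> by auto
      qed
      then show "\<exists>r>0. M.mball \<phi> r \<subseteq> {\<phi> \<in> states X. \<phi> a \<in> V}"
        using \<epsilon> L0 by (intro exI[of _ "\<epsilon> / (L a + 1)"]) auto
    qed auto
  qed auto
  have "M.mtopology = weak_star_topology X"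
    unfolding topology_eq
  proof (intro allI iffI)
    fix U assume "openin (weak_star_topology X) U"
    then have U: "openin (weak_star_topology X) U" .
    have "continuous_map M.mtopology (weak_star_topology X) (\<lambda>\<phi>. \<phi>)"
      unfolding weak_star_topology_def continuous_map_in_subtopology continuous_map_componentwise
      using ext M_eval by auto
    from openin_continuous_map_preimage[OF this U]
    show "openin M.mtopology U"
      using openin_subset[OF U] by (simp add: top_ws Collect_conj_eq Int_absorb1)
  next
    fix U assume U: "openin M.mtopology U"
    show "openin (weak_star_topology X) U"
    proof (subst openin_subopen, intro ballI)
      fix \<phi> assume \<phi>: "\<phi> \<in> U"
      obtain r where r: "r > 0" "M.mball \<phi> r \<subseteq> U"
        using U \<phi> unfolding M.openin_mtopology by blast
      have st\<phi>: "\<phi> \<in> states X" using U \<phi> unfolding M.openin_mtopology by blast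
      obtain I :: "'i set" and b K where I: "finite I" "b ` I \<subseteq> X" "0 \<le> K"
        and le: "\<forall>\<phi>\<in>states X. \<forall>\<psi>\<in>states X. \<forall>a\<in>X. L a \<le> 1 \<longrightarrow>
          cmod (\<phi> a - \<psi> a) \<le> 2 * (r / 8) + K * (\<Sum>i\<in>I. cmod (\<phi> (b i) - \<psi> (b i)))"
      proof -
        have "r / 8 > 0" using r by simp
        from key[OF this] show thesis by (elim exE conjE) (rule that)
      qed
      define p where "p = (K + 1) * (real (card I) + 1)"
      define \<eta> where "\<eta> = r / (4 * p)"
      have p: "p > 0" unfolding p_def using I by (intro mult_pos_pos) auto
      then have \<eta>: "\<eta> > 0" using r by (simp add: \<eta>_def)
      define W where "W J = {\<psi> \<in> states X. \<forall>i\<in>J. cmod (\<phi> (b i) - \<psi> (b i)) < \<eta>}" for J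
      have "openin (weak_star_topology X) (W J)" if "finite J" "b ` J \<subseteq> X" for J
        using that
      proof (induction J)
        case empty
        then show ?case using openin_topspace[of "weak_star_topology X"] by (simp add: W_def top_ws)
      next
        case (insert i J)
        have "W (insert i J) = W J \<inter> {\<psi> \<in> topspace (weak_star_topology X). \<psi> (b i) \<in> ball (\<phi> (b i)) \<eta>}"
          by (auto simp: W_def top_ws dist_norm)
        moreover have "openin (weak_star_topology X)
            {\<psi> \<in> topspace (weak_star_topology X). \<psi> (b i) \<in> ball (\<phi> (b i)) \<eta>}"
          by (rule openin_continuous_map_preimage[OF ws_eval]) (use insert in auto)
        ultimately show ?case using insert by (simp only: openin_Int insert_subset image_insert)
      qed
      then have "openin (weak_star_topology X) (W I)" using I by blast
      moreover have "\<phi> \<in> W I" using st\<phi> \<eta> by (simp add: W_def)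
      moreover have "W I \<subseteq> U"
      proof
        fix \<psi> assume \<psi>: "\<psi> \<in> W I"
        have "d \<phi> \<psi> \<le> r / 2"
        proof (rule d_le)
          fix a assume a: "a \<in> X" "L a \<le> 1"
          have "(\<Sum>i\<in>I. cmod (\<phi> (b i) - \<psi> (b i))) \<le> (real (card I) + 1) * \<eta>"
            using sum_bounded_above[of I "\<lambda>i. cmod (\<phi> (b i) - \<psi> (b i))" \<eta>] \<psi> \<eta>
            by (force simp: W_def distrib_right intro: less_imp_le)
          then have "K * (\<Sum>i\<in>I. cmod (\<phi> (b i) - \<psi> (b i))) \<le> (K + 1) * ((real (card I) + 1) * \<eta>)"
            using I by (intro mult_mono) (simp_all add: sum_nonneg)
          also have "\<dots> = p * \<eta>" by (simp only: p_def mult.assoc)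
          also have "\<dots> = r / 4" using p by (simp add: \<eta>_def)
          finally show "cmod (\<phi> a - \<psi> a) \<le> r / 2"
            using le[rule_format, OF st\<phi> _ a, of \<psi>] \<psi> by (simp add: W_def)
        qed (use r in simp)
        then have "\<psi> \<in> M.mball \<phi> r" using r st\<phi> \<psi> by (simp add: W_def)
        then show "\<psi> \<in> U" using r by blast
      qed
      ultimately show "\<exists>T. openin (weak_star_topology X) T \<and> \<phi> \<in> T \<and> T \<subseteq> U" by blast
    qed
  qed
  then show ?thesis
    unfolding compact_quantum_metric_space_def d_def[symmetric]
    using X slip finite M.Metric_space_axioms by blast
qed

section \<open>Direct sums of operator systems\<close>

lemma has_adjoints_Lip_circle: "has_adjoints (Lip_circle q)"
  unfolding has_adjoints_def
  by (intro ballI allI cinner_op_star laurent_bounded_ops Lip_circle_laurent)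

lemma op_sum_mem: "A \<in> X \<Longrightarrow> B \<in> Y \<Longrightarrow> op_sum A B \<in> system_sum X Y"
  by (auto simp: system_sum_def)

lemma op_sum_add: "op_sum A B + op_sum C D = op_sum (A + C) (B + D)"
  by (rule blinfun_eqI) (simp add: op_sum.rep_eq blinfun.add_left)

lemma op_sum_diff: "op_sum A B - op_sum C D = op_sum (A - C) (B - D)"
  by (rule blinfun_eqI) (simp add: op_sum.rep_eq blinfun.diff_left)

lemma op_sum_scaleC: "c *\<^sub>C op_sum A B = op_sum (c *\<^sub>C A) (c *\<^sub>C B)"
  by (rule blinfun_eqI) (simp add: op_sum.rep_eq scaleC_blinfun.rep_eq scaleC_prod_def)

lemma op_sum_zero: "op_sum 0 0 = 0"
  by (rule blinfun_eqI) (simp add: op_sum.rep_eq zero_prod_def)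

lemma op_sum_id: "op_sum id_blinfun id_blinfun = id_blinfun"
  by (rule blinfun_eqI) (simp add: op_sum.rep_eq)

lemma op_sum_sum: "(\<Sum>i\<in>I. op_sum (f i) (g i)) = op_sum (sum f I) (sum g I)"
  by (induction I rule: infinite_finite_induct) (simp_all add: op_sum_zero op_sum_add)

lemma norm_op_sum_le: "norm (op_sum A B) \<le> norm A + norm B"
proof (rule norm_blinfun_bound)
  fix p
  have "norm (op_sum A B p) \<le> norm (A (fst p)) + norm (B (snd p))"
    by (simp add: op_sum.rep_eq norm_Pair_le)
  also have "\<dots> \<le> norm A * norm p + norm B * norm p"
    using norm_fst_le[of "fst p" "snd p"] norm_snd_le[of "snd p" "fst p"]
    by (intro add_mono order_trans[OF norm_blinfun mult_left_mono]) auto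
  finally show "norm (op_sum A B p) \<le> (norm A + norm B) * norm p" by (simp add: distrib_right)
qed simp

lemma op_sum_bounded_ops:
  "A \<in> bounded_ops \<Longrightarrow> B \<in> bounded_ops \<Longrightarrow> op_sum A B \<in> bounded_ops"
  by (simp add: bounded_ops_def op_sum.rep_eq scaleC_prod_def)

lemma op_star_op_sum:
  assumes X: "operator_system X" "has_adjoints X" "A \<in> X"
    and Y: "operator_system Y" "has_adjoints Y" "B \<in> Y"
  shows "op_star (op_sum A B) = op_sum (op_star A) (op_star B)"
proof (rule op_star_eqI)
  show "op_sum (op_star A) (op_star B) \<in> bounded_ops"
    using operator_systemD[OF X(1)] operator_systemD[OF Y(1)] X(3) Y(3)
    by (intro op_sum_bounded_ops) auto
  show "cinner (op_sum (op_star A) (op_star B) p) r = cinner p (op_sum A B r)" for p r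
    using X Y by (simp add: op_sum.rep_eq cinner_prod_def has_adjoints_def)
qed

lemma operator_system_sum:
  assumes X: "operator_system X" "has_adjoints X" and Y: "operator_system Y" "has_adjoints Y"
  shows "operator_system (system_sum X Y)"
  unfolding operator_system_def
proof (intro conjI ballI)
  note X' = operator_systemD[OF X(1)] and Y' = operator_systemD[OF Y(1)]
  have zero: "0 \<in> X" "0 \<in> Y" using X'(2) Y'(2) by (auto simp: complex_subspace_def)
  show "system_sum X Y \<subseteq> bounded_ops"
    using X'(1) Y'(1) by (auto simp: system_sum_def intro: op_sum_bounded_ops)
  show "complex_subspace (system_sum X Y)"
    unfolding complex_subspace_def
  proof (intro conjI ballI allI)
    show "0 \<in> system_sum X Y" using op_sum_mem[OF zero] by (simp add: op_sum_zero)
    show "S + T \<in> system_sum X Y" if "S \<in> system_sum X Y" "T \<in> system_sum X Y" for S T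
      using that complex_subspace_add[OF X'(2)] complex_subspace_add[OF Y'(2)]
      by (fastforce simp: system_sum_def op_sum_add)
    show "c *\<^sub>C T \<in> system_sum X Y" if "T \<in> system_sum X Y" for c T
      using that complex_subspace_scaleC[OF X'(2)] complex_subspace_scaleC[OF Y'(2)]
      by (fastforce simp: system_sum_def op_sum_scaleC)
  qed
  show "op_star T \<in> system_sum X Y" if T: "T \<in> system_sum X Y" for T
  proof -
    obtain A B where AB: "T = op_sum A B" "A \<in> X" "B \<in> Y"
      using T by (auto simp: system_sum_def)
    then have "op_star T = op_sum (op_star A) (op_star B)"
      by (simp add: op_star_op_sum[OF X _ Y])
    then show ?thesis using X'(3)[OF AB(2)] Y'(3)[OF AB(3)] by (auto simp: system_sum_def)
  qed
  show "id_blinfun \<in> system_sum X Y"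
    using op_sum_mem[OF X'(4) Y'(4)] by (simp add: op_sum_id)
qed

lemma has_adjoints_sum:
  assumes X: "operator_system X" "has_adjoints X" and Y: "operator_system Y" "has_adjoints Y"
  shows "has_adjoints (system_sum X Y)"
  using assms by (auto simp: has_adjoints_def system_sum_def op_star_op_sum[OF X _ Y]
      op_sum.rep_eq cinner_prod_def)

section \<open>The bridge seminorm\<close>

definition bridge_norm ::
    "(('h::chilbert_space \<Rightarrow>\<^sub>L 'h) \<Rightarrow> real) \<Rightarrow> (('h \<Rightarrow>\<^sub>L 'h) \<Rightarrow> real) \<Rightarrow> real \<Rightarrow>
      (('h \<times> 'h) \<Rightarrow>\<^sub>L ('h \<times> 'h)) \<Rightarrow> real"
  where "bridge_norm LX LY \<epsilon> T = max (max (LX (proj_left T)) (LY (proj_right T)))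
    (norm (proj_left T - proj_right T) / \<epsilon>)"

lemma bridge_norm_le_iff:
  assumes "\<epsilon> > 0"
  shows "bridge_norm LX LY \<epsilon> (op_sum A B) \<le> t \<longleftrightarrow> LX A \<le> t \<and> LY B \<le> t \<and> norm (A - B) \<le> \<epsilon> * t"
  using assms by (simp add: bridge_norm_def divide_le_eq mult.commute)

lemma max_scale_three:
  "max (max (c * x) (c * y)) (c * z / e) = c * max (max x y) (z / (e :: real))" if "c \<ge> 0"
  using that by (simp add: max_mult_distrib_left)

lemma op_star_diff:
  fixes S T :: "'i ell2 \<Rightarrow>\<^sub>L 'i ell2"
  assumes "S \<in> bounded_ops" "T \<in> bounded_ops"
  shows "op_star (S - T) = op_star S - op_star T"
proof (rule op_star_eqI)
  show "op_star S - op_star T \<in> bounded_ops"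
    by (intro complex_subspace_diff[OF complex_subspace_bounded_ops] op_star_bounded_ops assms)
  show "cinner ((op_star S - op_star T) x) y = cinner x ((S - T) y)" for x y
  proof -
    have "cinner y ((op_star S - op_star T) x) = cnj (cinner x ((S - T) y))"
      using assms
      by (simp add: blinfun.diff_left cinner_diff_right cinner_op_star[symmetric] cinner_commute[of y])
    then show ?thesis by (metis cinner_commute)
  qed
qed

lemma slip_norm_bridge_norm:
  fixes X Y :: "('i ell2 \<Rightarrow>\<^sub>L 'i ell2) set"
  assumes X: "operator_system X" "has_adjoints X" "slip_norm X LX"
    and Y: "operator_system Y" "has_adjoints Y" "slip_norm Y LY" and \<epsilon>: "\<epsilon> > 0"
  shows "slip_norm (system_sum X Y) (bridge_norm LX LY \<epsilon>)"
  unfolding slip_norm_def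
proof (intro conjI ballI allI)
  note LX = X(3)[unfolded slip_norm_def] and LY = Y(3)[unfolded slip_norm_def]
  show "0 \<le> bridge_norm LX LY \<epsilon> T" for T
    using \<epsilon> by (simp add: bridge_norm_def le_max_iff_disj)
  show "bridge_norm LX LY \<epsilon> (S + T) \<le> bridge_norm LX LY \<epsilon> S + bridge_norm LX LY \<epsilon> T"
    if ST: "S \<in> system_sum X Y" "T \<in> system_sum X Y" for S T
  proof -
    obtain A B C D where eq: "S = op_sum A B" "T = op_sum C D"
      and mem: "A \<in> X" "B \<in> Y" "C \<in> X" "D \<in> Y"
      using ST by (auto simp: system_sum_def)
    let ?s = "bridge_norm LX LY \<epsilon> S" and ?t = "bridge_norm LX LY \<epsilon> T"
    have s: "LX A \<le> ?s" "LY B \<le> ?s" "norm (A - B) \<le> \<epsilon> * ?s"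
      using bridge_norm_le_iff[OF \<epsilon>, of LX LY A B ?s] by (simp_all add: eq)
    have t: "LX C \<le> ?t" "LY D \<le> ?t" "norm (C - D) \<le> \<epsilon> * ?t"
      using bridge_norm_le_iff[OF \<epsilon>, of LX LY C D ?t] by (simp_all add: eq)
    have "LX (A + C) \<le> LX A + LX C" "LY (B + D) \<le> LY B + LY D" using LX LY mem by auto
    moreover have "norm ((A + C) - (B + D)) \<le> norm (A - B) + norm (C - D)"
      by (simp add: add_diff_add norm_triangle_ineq)
    ultimately have "bridge_norm LX LY \<epsilon> (op_sum (A + C) (B + D)) \<le> ?s + ?t"
      unfolding bridge_norm_le_iff[OF \<epsilon>] distrib_left using s t by linarith
    then show ?thesis by (simp add: eq op_sum_add)
  qed
  show "bridge_norm LX LY \<epsilon> (c *\<^sub>C T) = cmod c * bridge_norm LX LY \<epsilon> T"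
    if T: "T \<in> system_sum X Y" for c T
  proof -
    obtain A B where eq: "T = op_sum A B" and mem: "A \<in> X" "B \<in> Y"
      using T by (auto simp: system_sum_def)
    have "c *\<^sub>C A - c *\<^sub>C B = c *\<^sub>C (A - B)"
      by (rule blinfun_eqI) (simp add: scaleC_blinfun.rep_eq blinfun.diff_left scaleC_diff_right)
    then show ?thesis
      using LX LY mem
      by (simp add: eq op_sum_scaleC bridge_norm_def norm_scaleC_blinfun max_scale_three)
  qed
  show "bridge_norm LX LY \<epsilon> (op_star T) = bridge_norm LX LY \<epsilon> T"
    if T: "T \<in> system_sum X Y" for T
  proof -
    obtain A B where eq: "T = op_sum A B" and mem: "A \<in> X" "B \<in> Y"
      using T by (auto simp: system_sum_def)
    have bd: "A \<in> bounded_ops" "B \<in> bounded_ops"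
      using mem operator_systemD(1)[OF X(1)] operator_systemD(1)[OF Y(1)] by auto
    have "norm (op_star A - op_star B) = norm (A - B)"
      unfolding op_star_diff[OF bd, symmetric]
      by (intro norm_op_star complex_subspace_diff[OF complex_subspace_bounded_ops] bd)
    then show ?thesis
      using LX LY mem
      by (simp add: eq op_star_op_sum[OF X(1,2) _ Y(1,2)] bridge_norm_def)
  qed
  have "bridge_norm LX LY \<epsilon> (op_sum id_blinfun id_blinfun) = 0"
    using LX LY by (simp add: bridge_norm_def)
  then show "bridge_norm LX LY \<epsilon> id_blinfun = 0" by (simp add: op_sum_id)
qed

text \<open>The quotient seminorms are computed by lifting an element of one system to an element of the
  other one that is no worse for its seminorm and close in norm.\<close>

lemma admissible_bridge_norm:
  assumes cqms: "compact_quantum_metric_space (system_sum X Y) (bridge_norm LX LY \<epsilon>)" and \<epsilon>: "\<epsilon> > 0"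
    and XY: "\<And>x. x \<in> X \<Longrightarrow> \<exists>y\<in>Y. LY y \<le> LX x \<and> norm (x - y) \<le> \<epsilon> * LX x"
    and YX: "\<And>y. y \<in> Y \<Longrightarrow> \<exists>x\<in>X. LX x \<le> LY y \<and> norm (x - y) \<le> \<epsilon> * LY y"
  shows "admissible X LX Y LY (bridge_norm LX LY \<epsilon>)"
  unfolding admissible_def
proof (intro conjI ballI cqms)
  fix x assume x: "x \<in> X"
  then obtain y where y: "y \<in> Y" "LY y \<le> LX x" "norm (x - y) \<le> \<epsilon> * LX x" using XY by blast
  have lower: "LX x \<le> bridge_norm LX LY \<epsilon> (op_sum x z)" for z
    by (simp add: bridge_norm_def)
  have "bridge_norm LX LY \<epsilon> (op_sum x y) \<le> LX x"
    using y by (simp add: bridge_norm_le_iff[OF \<epsilon>])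
  then have "(INF z\<in>Y. bridge_norm LX LY \<epsilon> (op_sum x z)) \<le> LX x"
    using y(1) lower by (intro cINF_lower2[of _ _ y] bdd_belowI2[where m = "LX x"])
  moreover have "LX x \<le> (INF z\<in>Y. bridge_norm LX LY \<epsilon> (op_sum x z))"
    using y(1) by (intro cINF_greatest lower) auto
  ultimately show "LX x = (INF z\<in>Y. bridge_norm LX LY \<epsilon> (op_sum x z))" by (rule antisym[rotated])
next
  fix y assume y: "y \<in> Y"
  then obtain x where x: "x \<in> X" "LX x \<le> LY y" "norm (x - y) \<le> \<epsilon> * LY y" using YX by blast
  have lower: "LY y \<le> bridge_norm LX LY \<epsilon> (op_sum z y)" for z
    by (simp add: bridge_norm_def)
  have "bridge_norm LX LY \<epsilon> (op_sum x y) \<le> LY y"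
    using x by (simp add: bridge_norm_le_iff[OF \<epsilon>])
  then have "(INF z\<in>X. bridge_norm LX LY \<epsilon> (op_sum z y)) \<le> LY y"
    using x(1) lower by (intro cINF_lower2[of _ _ x] bdd_belowI2[where m = "LY y"])
  moreover have "LY y \<le> (INF z\<in>X. bridge_norm LX LY \<epsilon> (op_sum z y))"
    using x(1) by (intro cINF_greatest lower) auto
  ultimately show "LY y = (INF z\<in>X. bridge_norm LX LY \<epsilon> (op_sum z y))" by (rule antisym[rotated])
qed

lemma fejer_minus_scalar:
  assumes N: "N > 0"
  shows "(\<Sum>m\<in>{- int N..int N}. (of_real (fejer_weight N m) * entry T m 0 - (if m = 0 then c else 0))
      *\<^sub>C shift_pow m) = fejer N T - c *\<^sub>C id_blinfun"
proof (rule blinfun_eqI)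
  fix x
  have "(\<Sum>m\<in>{- int N..int N}. (if m = 0 then c else 0) *\<^sub>C shift_pow m x) = c *\<^sub>C x"
  proof -
    have "(\<Sum>m\<in>{- int N..int N}. (if m = 0 then c else 0) *\<^sub>C shift_pow m x)
        = (\<Sum>m\<in>{- int N..int N}. if m = 0 then c *\<^sub>C x else 0)"
      by (rule sum.cong) (auto simp: shift_pow_0)
    then show ?thesis by (simp add: sum.delta)
  qed
  moreover have "(a - b) *\<^sub>C v = a *\<^sub>C v - b *\<^sub>C v" for a b and v :: "int ell2"
    using scaleC_add_left[of "a - b" b v] by simp
  ultimately show "blinfun_apply (\<Sum>m\<in>{- int N..int N}.
      (of_real (fejer_weight N m) * entry T m 0 - (if m = 0 then c else 0)) *\<^sub>C shift_pow m) x
      = blinfun_apply (fejer N T - c *\<^sub>C id_blinfun) x"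
    by (simp add: fejer_def blinfun.sum_left blinfun.diff_left scaleC_blinfun.rep_eq sum_subtractf)
qed

text \<open>The difference of the mean values of \<open>x\<close> and \<open>y\<close> is controlled by the third term of the
  bridge seminorm only; without it the sum would have infinite diameter.\<close>

lemma compact_quantum_metric_space_bridge:
  assumes q: "q \<in> {0<..1}" and r: "r \<in> {0<..1}" and \<epsilon>: "\<epsilon> > 0"
  shows "compact_quantum_metric_space (system_sum (Lip_circle q) (Lip_circle r))
    (bridge_norm (L_circle q) (L_circle r) \<epsilon>)"
proof (rule compact_quantum_metric_spaceI)
  note os = operator_system_Lip_circle has_adjoints_Lip_circle
  show "operator_system (system_sum (Lip_circle q) (Lip_circle r))"
    by (intro operator_system_sum os)
  show "has_adjoints (system_sum (Lip_circle q) (Lip_circle r))"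
    by (intro has_adjoints_sum os)
  show "slip_norm (system_sum (Lip_circle q) (Lip_circle r)) (bridge_norm (L_circle q) (L_circle r) \<epsilon>)"
    by (intro slip_norm_bridge_norm os slip_norm_L_circle \<epsilon>)
  fix \<delta> :: real assume \<delta>: "\<delta> > 0"
  \<comment> \<open>The Fejer means of both summands contribute an error of at most \<open>\<delta> / 2\<close>.\<close>
  obtain N :: nat where N: "32 / \<delta>\<^sup>2 < real N" using reals_Archimedean2 by blast
  have "0 < 32 / \<delta>\<^sup>2" using \<delta> by simp
  with N have N0: "N > 0" by (metis less_trans of_nat_0_less_iff)
  have "8 / real N \<le> (\<delta> / 2)\<^sup>2"
    using N N0 \<delta> by (simp add: field_simps power2_eq_square)
  then have rate: "2 * sqrt (8 / real N) \<le> \<delta>"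
    using \<delta> real_le_lsqrt[of "\<delta> / 2" "8 / real N"] by simp
  define b where "b = (\<lambda>(s, m). if s then op_sum (shift_pow m) 0 else op_sum 0 (shift_pow m))"
  define I where "I = (UNIV :: bool set) \<times> {- int N..int N}"
  have zero: "0 \<in> Lip_circle p" for p
    using complex_subspace_Lip_circle by (simp add: complex_subspace_def)
  have "finite I" by (simp add: I_def)
  moreover have "b ` I \<subseteq> system_sum (Lip_circle q) (Lip_circle r)"
    by (auto simp: b_def intro!: op_sum_mem zero shift_pow_Lip_circle)
  moreover have "\<exists>c g. (\<forall>i\<in>I. cmod (g i) \<le> 1 + \<epsilon>) \<and>
      norm (a - (c *\<^sub>C id_blinfun + (\<Sum>i\<in>I. g i *\<^sub>C b i))) \<le> \<delta>"
    if a: "a \<in> system_sum (Lip_circle q) (Lip_circle r)"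
      and La: "bridge_norm (L_circle q) (L_circle r) \<epsilon> a \<le> 1" for a
  proof -
    obtain x y where xy: "a = op_sum x y" "x \<in> Lip_circle q" "y \<in> Lip_circle r"
      using a by (auto simp: system_sum_def)
    have L: "L_circle q x \<le> 1" "L_circle r y \<le> 1" "norm (x - y) \<le> \<epsilon>"
      using La bridge_norm_le_iff[OF \<epsilon>, of "L_circle q" "L_circle r" x y 1] by (simp_all add: xy)
    \<comment> \<open>A common scalar is subtracted from \<open>x\<close> and \<open>y\<close>, which makes the mean value of \<open>x\<close> vanish and that of \<open>y\<close> small.\<close>
    define c where "c = entry x 0 0"
    define h where "h T m = of_real (fejer_weight N m) * entry T m 0 - (if m = 0 then c else 0)"
      for T :: "int ell2 \<Rightarrow>\<^sub>L int ell2" and m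
    define g where "g = (\<lambda>(s, m). if s then h x m else h y m)"
    have coeff: "cmod (h T m) \<le> 1" if T: "T \<in> Lip_circle p" "L_circle p T \<le> 1" "p \<in> {0<..1}" "m \<noteq> 0" for T p m
    proof -
      have "cmod (h T m) = \<bar>fejer_weight N m\<bar> * cmod (entry T m 0)"
        using that by (simp add: h_def norm_mult)
      also have "\<dots> \<le> \<bar>q_int p m\<bar> * cmod (entry T m 0)"
      proof (rule mult_right_mono)
        have "\<bar>fejer_weight N m\<bar> \<le> 1" by (auto simp: fejer_weight_def)
        then show "\<bar>fejer_weight N m\<bar> \<le> \<bar>q_int p m\<bar>"
          using abs_q_int_ge[OF that(3), of m] that(4) by linarith
      qed simp
      also have "\<dots> = cmod (entry (q_derivative p T) m 0)"
        by (simp add: entry_q_derivative[OF T(1)] norm_mult)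
      also have "\<dots> \<le> 1" using cmod_entry_le[of "q_derivative p T" m 0] T(2) by (simp add: L_circle_def)
      finally show ?thesis .
    qed
    have w0: "fejer_weight N 0 = 1" by (simp add: fejer_weight_def)
    have "cmod (h y 0) \<le> norm (x - y)"
      using cmod_entry_le[of "y - x" 0 0]
      by (simp add: h_def c_def w0 entry_diff norm_minus_commute)
    then have "cmod (h x m) \<le> 1 + \<epsilon>" "cmod (h y m) \<le> 1 + \<epsilon>" for m
      using coeff[OF xy(2) L(1) q, of m] coeff[OF xy(3) L(2) r, of m] L(3) \<epsilon>
      by (cases "m = 0"; force simp: h_def c_def w0)+
    then have "\<forall>i\<in>I. cmod (g i) \<le> 1 + \<epsilon>" by (auto simp: g_def)
    moreover have "norm (a - (c *\<^sub>C id_blinfun + (\<Sum>i\<in>I. g i *\<^sub>C b i))) \<le> \<delta>"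
    proof -
      have sc0: "d *\<^sub>C (0 :: int ell2 \<Rightarrow>\<^sub>L int ell2) = 0" for d
        by (rule blinfun_eqI) (simp add: scaleC_blinfun.rep_eq)
      have "(\<Sum>i\<in>I. g i *\<^sub>C b i) = (\<Sum>s\<in>UNIV. \<Sum>m\<in>{- int N..int N}. g (s, m) *\<^sub>C b (s, m))"
        by (simp add: I_def sum.cartesian_product)
      also have "\<dots> = (\<Sum>m\<in>{- int N..int N}. h y m *\<^sub>C op_sum 0 (shift_pow m))
          + (\<Sum>m\<in>{- int N..int N}. h x m *\<^sub>C op_sum (shift_pow m) 0)"
        by (simp add: UNIV_bool g_def b_def add.commute)
      also have "\<dots> = op_sum (fejer N x - c *\<^sub>C id_blinfun) (fejer N y - c *\<^sub>C id_blinfun)"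
        unfolding fejer_minus_scalar[OF N0, symmetric] h_def[symmetric]
        by (simp add: op_sum_scaleC sc0 op_sum_sum op_sum_add)
      finally have "c *\<^sub>C id_blinfun + (\<Sum>i\<in>I. g i *\<^sub>C b i) = op_sum (fejer N x) (fejer N y)"
        by (simp add: op_sum_id[symmetric] op_sum_scaleC op_sum_add)
      then have "norm (a - (c *\<^sub>C id_blinfun + (\<Sum>i\<in>I. g i *\<^sub>C b i)))
          = norm (op_sum (x - fejer N x) (y - fejer N y))"
        by (simp add: xy op_sum_diff)
      also have "\<dots> \<le> norm (x - fejer N x) + norm (y - fejer N y)" by (rule norm_op_sum_le)
      also have "\<dots> \<le> sqrt (8 / real N) * 1 + sqrt (8 / real N) * 1"
        by (intro add_mono order_trans[OF norm_diff_fejer_le[OF q xy(2) N0] mult_left_mono[OF L(1)]]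
            order_trans[OF norm_diff_fejer_le[OF r xy(3) N0] mult_left_mono[OF L(2)]]) simp_all
      finally show ?thesis using rate by simp
    qed
    ultimately show ?thesis by blast
  qed
  ultimately show "\<exists>(I :: (bool \<times> int) set) b K. finite I \<and>
      b ` I \<subseteq> system_sum (Lip_circle q) (Lip_circle r) \<and>
      (\<forall>a\<in>system_sum (Lip_circle q) (Lip_circle r). bridge_norm (L_circle q) (L_circle r) \<epsilon> a \<le> 1 \<longrightarrow>
        (\<exists>c g. (\<forall>i\<in>I. cmod (g i) \<le> K) \<and>
          norm (a - (c *\<^sub>C id_blinfun + (\<Sum>i\<in>I. g i *\<^sub>C b i))) \<le> \<delta>))"
    by (intro exI[of _ I] exI[of _ b] exI[of _ "1 + \<epsilon>"]) blast
qed

section \<open>Transport of completely positive maps\<close>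

lemma ucp_diff_le:
  assumes X: "operator_system X" "has_adjoints X" and \<phi>: "\<phi> \<in> ucp_maps n X" and ST: "S \<in> X" "T \<in> X"
  shows "mat_norm (\<phi> S - \<phi> T) \<le> norm (S - T)"
proof -
  note sub = operator_systemD(2)[OF X(1)]
  have carrier: "\<phi> S \<in> carrier_mat n n" "\<phi> T \<in> carrier_mat n n"
    using \<phi> ST by (auto simp: ucp_maps_def)
  have mem: "(-1) *\<^sub>C T \<in> X" by (rule complex_subspace_scaleC[OF sub ST(2)])
  have "\<phi> (S + (-1) *\<^sub>C T) = \<phi> S + (-1) \<cdot>\<^sub>m \<phi> T"
    using \<phi> ST mem by (simp add: ucp_maps_def)
  also have "\<dots> = \<phi> S - \<phi> T" by (rule eq_matI) (use carrier in auto)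
  finally have "\<phi> S - \<phi> T = \<phi> (S - T)" by (simp add: scaleC_blinfun_minus1)
  then show ?thesis
    using ucp_le_norm[OF X \<phi> complex_subspace_diff[OF sub ST]] by simp
qed

text \<open>Fejer means turn a unital completely positive map on one Lipschitz algebra into one on any
  other, because they take values in the trigonometric polynomials, which all of them contain.\<close>

lemma ucp_fejer:
  assumes \<phi>: "\<phi> \<in> ucp_maps n (Lip_circle q)" and N: "N > 0"
  shows "restrict (\<phi> \<circ> fejer N) (Lip_circle r) \<in> ucp_maps n (Lip_circle r)"
proof -
  let ?\<psi> = "restrict (\<phi> \<circ> fejer N) (Lip_circle r)"
  have id: "id_blinfun \<in> Lip_circle p" for p
    by (rule operator_systemD(4)[OF operator_system_Lip_circle])
  have cp: "\<forall>m T. (\<forall>i<m. \<forall>j<m. T i j \<in> Lip_circle q) \<and> positive_op_matrix m T \<longrightarrow>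
      positive_block_matrix m n (\<lambda>i j. \<phi> (T i j))"
    using \<phi> by (simp add: ucp_maps_def)
  have block: "positive_block_matrix m n (\<lambda>i j. ?\<psi> (T i j))"
    if T: "\<forall>i<m. \<forall>j<m. T i j \<in> Lip_circle r" "positive_op_matrix m T" for m T
  proof -
    have "positive_op_matrix m (\<lambda>i j. fejer N (T i j))"
    proof (rule fejer_completely_positive[OF _ T(2) N])
      show "laurent (T i j)" if "i < m" "j < m" for i j
        using T(1) that by (blast intro: Lip_circle_laurent)
    qed
    then have "positive_block_matrix m n (\<lambda>i j. \<phi> (fejer N (T i j)))"
      using cp[rule_format, of m "\<lambda>i j. fejer N (T i j)"] by (simp add: fejer_Lip_circle)
    then show ?thesis
      using T(1) by (simp add: positive_block_matrix_def)
  qed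
  have add: "?\<psi> (S + T) = ?\<psi> S + ?\<psi> T" if "S \<in> Lip_circle r" "T \<in> Lip_circle r" for S T
    using \<phi> that complex_subspace_add[OF complex_subspace_Lip_circle that]
    by (simp add: fejer_add ucp_maps_def fejer_Lip_circle)
  have scale: "?\<psi> (c *\<^sub>C T) = c \<cdot>\<^sub>m ?\<psi> T" if "T \<in> Lip_circle r" for c T
    using \<phi> that complex_subspace_scaleC[OF complex_subspace_Lip_circle that]
    by (simp add: fejer_scaleC ucp_maps_def fejer_Lip_circle)
  have "?\<psi> id_blinfun = 1\<^sub>m n"
    using \<phi> id by (simp add: fejer_id[OF N] ucp_maps_def)
  moreover have "?\<psi> \<in> Lip_circle r \<rightarrow>\<^sub>E carrier_mat n n"
    using \<phi> fejer_Lip_circle[of N _ q] by (auto simp: ucp_maps_def)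
  ultimately show ?thesis
    unfolding ucp_maps_def mem_Collect_eq using block add scale by blast
qed

lemma hausdorff_dist_leI:
  assumes "\<And>a. a \<in> A \<Longrightarrow> \<exists>b\<in>B. \<rho> a b \<le> e" "\<And>b. b \<in> B \<Longrightarrow> \<exists>a\<in>A. \<rho> a b \<le> e"
  shows "hausdorff_dist \<rho> A B \<le> e"
  unfolding hausdorff_dist_def
  using assms by (auto intro!: SUP_least intro: INF_lower2)

text \<open>For \<open>(x, y)\<close> in the unit ball of the bridge seminorm, \<open>\<phi> x\<close> and \<open>\<phi> (fejer N y)\<close> differ by at most
  \<open>norm (x - y) + norm (y - fejer N y)\<close>, whatever the size of the matrices.\<close>

lemma complete_GH_dist_Lip_circle_le:
  assumes q: "q \<in> {0<..1}" and r: "r \<in> {0<..1}" and N: "N > 0" and \<eta>0: "0 \<le> \<eta>"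
    and \<eta>: "\<And>m. \<bar>m\<bar> \<le> int N \<Longrightarrow> \<bar>q_int r m - q_int q m\<bar> \<le> \<eta>"
  shows "complete_GH_dist (Lip_circle q) (L_circle q) (Lip_circle r) (L_circle r)
    \<le> ennreal (fejer_error N (\<eta> * sqrt (2 * real N + 1)) + sqrt (8 / real N))"
proof -
  define \<epsilon> where "\<epsilon> = fejer_error N (\<eta> * sqrt (2 * real N + 1))"
  define S where "S = system_sum (Lip_circle q) (Lip_circle r)"
  define L where "L = bridge_norm (L_circle q) (L_circle r) \<epsilon>"
  have \<epsilon>: "\<epsilon> > 0" using N \<eta>0 by (simp add: \<epsilon>_def fejer_error_def add_pos_nonneg)
  have sym: "\<bar>q_int q m - q_int r m\<bar> \<le> \<eta>" if "\<bar>m\<bar> \<le> int N" for m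
    using \<eta>[OF that] by (simp add: abs_minus_commute)
  have adm: "admissible (Lip_circle q) (L_circle q) (Lip_circle r) (L_circle r) L"
    unfolding L_def
  proof (rule admissible_bridge_norm[OF compact_quantum_metric_space_bridge[OF q r \<epsilon>] \<epsilon>])
    show "\<exists>y\<in>Lip_circle r. L_circle r y \<le> L_circle q x \<and> norm (x - y) \<le> \<epsilon> * L_circle q x"
      if "x \<in> Lip_circle q" for x
      unfolding \<epsilon>_def by (rule Lip_circle_approximation[OF q that N \<eta>0 \<eta>])
    show "\<exists>x\<in>Lip_circle q. L_circle q x \<le> L_circle r y \<and> norm (x - y) \<le> \<epsilon> * L_circle r y"
      if "y \<in> Lip_circle r" for y
      using Lip_circle_approximation[OF r that N \<eta>0 sym]
      by (simp add: \<epsilon>_def norm_minus_commute)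
  qed
  have unfold_L: "\<exists>x\<in>Lip_circle q. \<exists>y\<in>Lip_circle r. a = op_sum x y \<and> norm (x - y) \<le> \<epsilon> \<and>
      norm (x - fejer N x) \<le> sqrt (8 / real N) \<and> norm (y - fejer N y) \<le> sqrt (8 / real N)"
    if a: "a \<in> S" "L a \<le> 1" for a
  proof -
    obtain x y where xy: "a = op_sum x y" "x \<in> Lip_circle q" "y \<in> Lip_circle r"
      using a by (auto simp: S_def system_sum_def)
    have Lxy: "L_circle q x \<le> 1" "L_circle r y \<le> 1" "norm (x - y) \<le> \<epsilon>"
      using a(2) bridge_norm_le_iff[OF \<epsilon>, of "L_circle q" "L_circle r" x y 1]
      by (simp_all add: L_def xy)
    have "norm (x - fejer N x) \<le> sqrt (8 / real N) * 1"
      by (rule order_trans[OF norm_diff_fejer_le[OF q xy(2) N] mult_left_mono[OF Lxy(1)]]) simp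
    moreover have "norm (y - fejer N y) \<le> sqrt (8 / real N) * 1"
      by (rule order_trans[OF norm_diff_fejer_le[OF r xy(3) N] mult_left_mono[OF Lxy(2)]]) simp
    ultimately show ?thesis using xy Lxy by auto
  qed
  have haus: "hausdorff_dist (ucp_dist S L) (ucp_embed_left n (Lip_circle q) (Lip_circle r))
      (ucp_embed_right n (Lip_circle q) (Lip_circle r)) \<le> ennreal (\<epsilon> + sqrt (8 / real N))" for n
  proof (rule hausdorff_dist_leI)
    fix \<phi>' assume "\<phi>' \<in> ucp_embed_left n (Lip_circle q) (Lip_circle r)"
    then obtain \<phi> where \<phi>: "\<phi> \<in> ucp_maps n (Lip_circle q)" and \<phi>': "\<phi>' = restrict (\<phi> \<circ> proj_left) S"
      by (auto simp: ucp_embed_left_def S_def)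
    define \<psi>' where "\<psi>' = restrict (restrict (\<phi> \<circ> fejer N) (Lip_circle r) \<circ> proj_right) S"
    have "mat_norm (\<phi>' a - \<psi>' a) \<le> \<epsilon> + sqrt (8 / real N)" if a: "a \<in> S" "L a \<le> 1" for a
    proof -
      obtain x y where xy: "x \<in> Lip_circle q" "y \<in> Lip_circle r" "a = op_sum x y"
        and le: "norm (x - y) \<le> \<epsilon>" "norm (y - fejer N y) \<le> sqrt (8 / real N)"
        using unfold_L[OF a] by blast
      have "mat_norm (\<phi>' a - \<psi>' a) = mat_norm (\<phi> x - \<phi> (fejer N y))"
        using a xy by (simp add: \<phi>' \<psi>'_def)
      also have "\<dots> \<le> norm (x - fejer N y)"
        by (rule ucp_diff_le[OF operator_system_Lip_circle has_adjoints_Lip_circle \<phi> xy(1) fejer_Lip_circle])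
      also have "\<dots> \<le> norm (x - y) + norm (y - fejer N y)"
        using norm_triangle_ineq[of "x - y" "y - fejer N y"] by simp
      finally show ?thesis using le by linarith
    qed
    then have "ucp_dist S L \<phi>' \<psi>' \<le> ennreal (\<epsilon> + sqrt (8 / real N))"
      unfolding ucp_dist_def by (intro SUP_least ennreal_leI) auto
    then show "\<exists>\<psi>'\<in>ucp_embed_right n (Lip_circle q) (Lip_circle r).
        ucp_dist S L \<phi>' \<psi>' \<le> ennreal (\<epsilon> + sqrt (8 / real N))"
      using ucp_fejer[OF \<phi> N, of r] by (auto simp: ucp_embed_right_def \<psi>'_def S_def)
  next
    fix \<psi>' assume "\<psi>' \<in> ucp_embed_right n (Lip_circle q) (Lip_circle r)"
    then obtain \<psi> where \<psi>: "\<psi> \<in> ucp_maps n (Lip_circle r)" and \<psi>': "\<psi>' = restrict (\<psi> \<circ> proj_right) S"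
      by (auto simp: ucp_embed_right_def S_def)
    define \<phi>' where "\<phi>' = restrict (restrict (\<psi> \<circ> fejer N) (Lip_circle q) \<circ> proj_left) S"
    have "mat_norm (\<phi>' a - \<psi>' a) \<le> \<epsilon> + sqrt (8 / real N)" if a: "a \<in> S" "L a \<le> 1" for a
    proof -
      obtain x y where xy: "x \<in> Lip_circle q" "y \<in> Lip_circle r" "a = op_sum x y"
        and le: "norm (x - y) \<le> \<epsilon>" "norm (x - fejer N x) \<le> sqrt (8 / real N)"
        using unfold_L[OF a] by blast
      have "mat_norm (\<phi>' a - \<psi>' a) = mat_norm (\<psi> (fejer N x) - \<psi> y)"
        using a xy by (simp add: \<psi>' \<phi>'_def)
      also have "\<dots> \<le> norm (fejer N x - y)"
        by (rule ucp_diff_le[OF operator_system_Lip_circle has_adjoints_Lip_circle \<psi> fejer_Lip_circle xy(2)])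
      also have "\<dots> \<le> norm (x - y) + norm (x - fejer N x)"
        using norm_triangle_ineq4[of "x - y" "x - fejer N x"] by simp
      finally show ?thesis using le by linarith
    qed
    then have "ucp_dist S L \<phi>' \<psi>' \<le> ennreal (\<epsilon> + sqrt (8 / real N))"
      unfolding ucp_dist_def by (intro SUP_least ennreal_leI) auto
    then show "\<exists>\<phi>'\<in>ucp_embed_left n (Lip_circle q) (Lip_circle r).
        ucp_dist S L \<phi>' \<psi>' \<le> ennreal (\<epsilon> + sqrt (8 / real N))"
      using ucp_fejer[OF \<psi> N, of q] by (auto simp: ucp_embed_left_def \<phi>'_def S_def)
  qed
  have "(SUP n\<in>{1..}. hausdorff_dist (ucp_dist S L) (ucp_embed_left n (Lip_circle q) (Lip_circle r))
      (ucp_embed_right n (Lip_circle q) (Lip_circle r))) \<le> ennreal (\<epsilon> + sqrt (8 / real N))"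
    by (rule SUP_least) (rule haus)
  then show ?thesis
    unfolding complete_GH_dist_def \<epsilon>_def[symmetric] S_def
    by (intro INF_lower2[where i = L]) (simp_all add: adm)
qed

section \<open>Continuity in the deformation parameter\<close>

theorem theorem7p5:
  fixes q0 :: real
  assumes "q0 \<in> {0<..1}"
  shows "((\<lambda>q. complete_GH_dist (Lip_circle q) (L_circle q) (Lip_circle q0) (L_circle q0))
           \<longlongrightarrow> 0) (at q0 within {0<..1})"
proof (rule order_tendstoI)
  fix a :: ennreal assume "0 < a"
  then obtain z where z: "0 < z" "z < a" using dense by blast
  define e where "e = enn2real z"
  have "z < \<infinity>" using z(2) by (rule order.strict_trans2) simp
  then have e: "0 < e" "ennreal e < a"
    using z by (simp_all add: e_def enn2real_positive_iff)
  \<comment> \<open>The bound of the preceding lemma is \<open>2 * sqrt (8 / N) + \<eta> * sqrt (2 * N + 1) * sqrt 8\<close>. The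
    degree \<open>N\<close> and then \<open>\<eta>\<close> are chosen such that each of the three parts is at most \<open>e / 4\<close>.\<close>
  obtain N :: nat where N: "128 / e\<^sup>2 < real N" using reals_Archimedean2 by blast
  have "0 < 128 / e\<^sup>2" using e by simp
  with N have N0: "N > 0" by (metis less_trans of_nat_0_less_iff)
  have "8 / real N \<le> (e / 4)\<^sup>2"
    using N N0 e by (simp add: field_simps power2_eq_square)
  then have rate: "sqrt (8 / real N) \<le> e / 4"
    using e by (intro real_le_lsqrt) auto
  define \<eta> where "\<eta> = e / (4 * sqrt 8 * sqrt (2 * real N + 1))"
  have \<eta>: "\<eta> > 0" using e by (simp add: \<eta>_def)
  have "\<forall>\<^sub>F q in at q0 within {0<..1}. \<forall>m\<in>{- int N..int N}. dist (q_int q m) (q_int q0 m) < \<eta>"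
    using tendsto_q_int[OF assms] \<eta> by (intro eventually_ball_finite ballI) (auto intro: tendstoD)
  moreover have "\<forall>\<^sub>F q in at q0 within {0<..1}. q \<in> {0<..1}"
    by (simp add: eventually_at_filter)
  ultimately show "\<forall>\<^sub>F q in at q0 within {0<..1}.
      complete_GH_dist (Lip_circle q) (L_circle q) (Lip_circle q0) (L_circle q0) < a"
  proof eventually_elim
    case (elim q)
    have "complete_GH_dist (Lip_circle q) (L_circle q) (Lip_circle q0) (L_circle q0)
        \<le> ennreal (fejer_error N (\<eta> * sqrt (2 * real N + 1)) + sqrt (8 / real N))"
    proof (rule complete_GH_dist_Lip_circle_le[OF elim(2) assms N0])
      show "\<bar>q_int q0 m - q_int q m\<bar> \<le> \<eta>" if "\<bar>m\<bar> \<le> int N" for m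
      proof -
        have "m \<in> {- int N..int N}" using that by auto
        with elim(1) have "dist (q_int q m) (q_int q0 m) < \<eta>" by blast
        then show ?thesis by (simp add: dist_real_def abs_minus_commute)
      qed
    qed (use \<eta> in simp)
    also have "fejer_error N (\<eta> * sqrt (2 * real N + 1)) = sqrt (8 / real N) + e / 4"
      by (simp add: fejer_error_def \<eta>_def)
    also have "ennreal (sqrt (8 / real N) + e / 4 + sqrt (8 / real N)) \<le> ennreal e"
      using rate e by (intro ennreal_leI) linarith
    finally show ?case using e(2) by (rule order.strict_trans1)
  qed
qed simp

end
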